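(* There exists an absolute constant $\bar c_2>0$ such that the following holds. Let $\lambda\in[1,2)$ and let $\beta\in(0,1)$ be such that $\lambda\le 2-\bar c_2\,\beta$. Then there is a bounded domain $G_\beta\subset\mathbb{R}^2$ which satisfies a $\beta/4$-quasihyperbolic boundary condition, for which $\dim_{\mathcal{M}}(\partial G_\beta)=\lambda$, and which does not satisfy the $(q,p)$-Poincaré inequality whenever $1\le q<p<\infty$ and $$p\le\frac{q(2-\lambda b)}{q+b(2-\lambda)},\qquad b=\frac{2\beta}{1+\beta}.$$
   Context: A domain is an open connected set. A bounded domain $G\subset\mathbb{R}^n$ satisfies the $(q,p)$-Poincaré inequality if there is a finite constant $c$ such that $\left(\int_G|u-u_G|^q\,dx\right)^{1/q}\le c\left(\int_G|\nabla u|^p\,dx\right)^{1/p}$ for all $u$ in the Sobolev space $W^{1,p}(G)$, where $u_G$ is the integral average of $u$ over $G$. Quasihyperbolic distance: for $x,y\in G$, $k_G(x,y)=\inf_\gamma\int_\gamma\frac{ds}{\operatorname{dist}(z,\partial G)}$, the infimum being over all rectifiable curves $\gamma$ joining $x$ to $y$ in $G$. A bounded domain $G$ satisfies a $\beta$-quasihyperbolic boundary condition, $\beta\in(0,1]$, if there exist a point $x_0\in G$ and a constant $c<\infty$ such that $k_G(x,x_0)\le\frac1\beta\log\frac{1}{\operatorname{dist}(x,\partial G)}+c$ for every $x\in G$. Upper Minkowski dimension of $E\subset\mathbb{R}^n$: $\dim_{\mathcal{M}}(E)=\sup\{\lambda\ge0:\limsup_{r\to0+}\mathcal{M}_\lambda(E,r)=\infty\}$,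 where $\mathcal{M}_\lambda(E,r)=\left|\bigcup_{x\in E}B^n(x,r)\right|/r^{n-\lambda}$ and $|\cdot|$ is Lebesgue $n$-measure. *)

theory Defs
  imports "HOL-Analysis.Analysis"
begin

definition bounded_domain :: "'a::euclidean_space set \<Rightarrow> bool" where
  "bounded_domain G \<longleftrightarrow> open G \<and> connected G \<and> G \<noteq> {} \<and> bounded G"


subsection \<open>Sobolev functions and the Poincar\'e inequality\<close>

text \<open>\<open>Ck k f\<close>: all iterated partial derivatives of order at most \<open>k\<close> exist and are continuous.\<close>

primrec Ck :: "nat \<Rightarrow> ('a::euclidean_space \<Rightarrow> real) \<Rightarrow> bool" where
  "Ck 0 f \<longleftrightarrow> continuous_on UNIV f"
| "Ck (Suc k) f \<longleftrightarrow> (\<forall>x. f differentiable at x) \<and>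
     (\<forall>i\<in>Basis. Ck k (\<lambda>x. frechet_derivative f (at x) i))"

definition test_function :: "'a::euclidean_space set \<Rightarrow> ('a \<Rightarrow> real) \<Rightarrow> bool" where
  "test_function G \<phi> \<longleftrightarrow> (\<forall>k. Ck k \<phi>) \<and>
     compact (closure {x. \<phi> x \<noteq> 0}) \<and> closure {x. \<phi> x \<noteq> 0} \<subseteq> G"

definition locally_integrable ::
    "'a::euclidean_space set \<Rightarrow> ('a \<Rightarrow> 'b::euclidean_space) \<Rightarrow> bool" where
  "locally_integrable G f \<longleftrightarrow> (\<forall>K. compact K \<and> K \<subseteq> G \<longrightarrow> f absolutely_integrable_on K)"

definition weak_gradient ::
    "'a::euclidean_space set \<Rightarrow> ('a \<Rightarrow> real) \<Rightarrow> ('a \<Rightarrow> 'a) \<Rightarrow> bool" where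
  "weak_gradient G u v \<longleftrightarrow> locally_integrable G u \<and> locally_integrable G v \<and>
     (\<forall>\<phi>. test_function G \<phi> \<longrightarrow> (\<forall>i\<in>Basis.
        (LINT x|lebesgue_on G. u x * frechet_derivative \<phi> (at x) i) =
        - (LINT x|lebesgue_on G. (v x \<bullet> i) * \<phi> x)))"

definition Lp :: "real \<Rightarrow> 'a::euclidean_space set \<Rightarrow> ('a \<Rightarrow> 'b::euclidean_space) set" where
  "Lp p G = {f \<in> borel_measurable (lebesgue_on G).
     integrable (lebesgue_on G) (\<lambda>x. norm (f x) powr p)}"

definition W1p :: "real \<Rightarrow> 'a::euclidean_space set \<Rightarrow> ('a \<Rightarrow> real) set" where
  "W1p p G = {u \<in> Lp p G. \<exists>v. weak_gradient G u v \<and> v \<in> Lp p G}"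

definition average :: "'a::euclidean_space set \<Rightarrow> ('a \<Rightarrow> real) \<Rightarrow> real" where
  "average G u = (LINT x|lebesgue_on G. u x) / measure lebesgue G"

text \<open>The membership in \<open>Lp q G\<close> says that the left-hand side is finite; without it the Bochner
  integral would silently be \<open>0\<close>. The weak gradient is unique almost everywhere, so the quantifier
  over \<open>v\<close> only ranges over versions of the gradient of \<open>u\<close>.\<close>

definition poincare_inequality :: "real \<Rightarrow> real \<Rightarrow> 'a::euclidean_space set \<Rightarrow> bool" where
  "poincare_inequality q p G \<longleftrightarrow> (\<exists>c. \<forall>u\<in>W1p p G. \<forall>v. weak_gradient G u v \<longrightarrow>
     (\<lambda>x. u x - average G u) \<in> Lp q G \<and>
     (LINT x|lebesgue_on G. \<bar>u x - average G u\<bar> powr q) powr (1 / q)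
       \<le> c * (LINT x|lebesgue_on G. norm (v x) powr p) powr (1 / p))"


subsection \<open>Quasihyperbolic distance\<close>

definition inscribed_lengths :: "(real \<Rightarrow> 'a::euclidean_space) \<Rightarrow> real \<Rightarrow> real \<Rightarrow> real set" where
  "inscribed_lengths g a b =
     {\<Sum>i<n. dist (g (t i)) (g (t (Suc i))) | (n::nat) t. mono t \<and> range t \<subseteq> {a..b}}"

definition rectifiable_path :: "(real \<Rightarrow> 'a::euclidean_space) \<Rightarrow> bool" where
  "rectifiable_path g \<longleftrightarrow> path g \<and> bdd_above (inscribed_lengths g 0 1)"

text \<open>The length of \<open>g\<close> restricted to \<open>{0..t}\<close>, extended constantly outside \<open>{0..1}\<close>. For a rectifiable
  path it is continuous and nondecreasing, so that \<^const>\<open>interval_measure\<close> turns it into the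
  arc length measure \<open>ds\<close>.\<close>

definition arc_length :: "(real \<Rightarrow> 'a::euclidean_space) \<Rightarrow> real \<Rightarrow> real" where
  "arc_length g t = Sup (inscribed_lengths g 0 (max 0 (min 1 t)))"

definition line_integral :: "(real \<Rightarrow> 'a::euclidean_space) \<Rightarrow> ('a \<Rightarrow> real) \<Rightarrow> real" where
  "line_integral g \<rho> = (LINT t:{0..1}|interval_measure (arc_length g). \<rho> (g t))"

definition quasihyperbolic_dist :: "'a::euclidean_space set \<Rightarrow> 'a \<Rightarrow> 'a \<Rightarrow> real" where
  "quasihyperbolic_dist G x y =
     (INF g\<in>{g. rectifiable_path g \<and> path_image g \<subseteq> G \<and> pathstart g = x \<and> pathfinish g = y}.
        line_integral g (\<lambda>z. 1 / infdist z (frontier G)))"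

definition quasihyperbolic_boundary_condition :: "real \<Rightarrow> 'a::euclidean_space set \<Rightarrow> bool" where
  "quasihyperbolic_boundary_condition \<beta> G \<longleftrightarrow> (\<exists>x0\<in>G. \<exists>c. \<forall>x\<in>G.
     quasihyperbolic_dist G x x0 \<le> 1 / \<beta> * ln (1 / infdist x (frontier G)) + c)"


subsection \<open>Upper Minkowski dimension\<close>

definition minkowski_content :: "real \<Rightarrow> 'a::euclidean_space set \<Rightarrow> real \<Rightarrow> ennreal" where
  "minkowski_content l E r =
     emeasure lebesgue (\<Union>x\<in>E. ball x r) / ennreal (r powr (real DIM('a) - l))"

text \<open>Values in \<^typ>\<open>ennreal\<close> give the supremum of the empty set the value \<open>0\<close>, as needed e.g. for
  singletons.\<close>

definition upper_minkowski_dim :: "'a::euclidean_space set \<Rightarrow> ennreal" where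
  "upper_minkowski_dim E =
     Sup (ennreal ` {l. 0 \<le> l \<and> Limsup (at_right 0) (minkowski_content l E) = \<infinity>})"

end

theory Submission
  imports Defs
begin

text \<open>Take \<open>\<rho> = 2 powr (- 2 / \<lambda>)\<close>, so that the product \<open>K\<close> of two Cantor sets of ratio \<open>\<rho>\<close> has dimension
  \<open>\<lambda>\<close>, and remove \<open>K\<close> from the unit square. To the top side attach one room of size \<open>r\<close> for each
  \<open>r = r\<^sub>0 / 2 ^ j\<close>, through a square neck of side \<open>r powr (1 / \<beta>)\<close>. The rooms contribute dimension \<open>1\<close> to the
  boundary.

  Quasihyperbolic distance: a path out of a cell of stage \<open>n\<close> of the Cantor construction into the
  next larger one costs \<open>O(1 / (1 - 2\<rho>))\<close>, which is \<open>O(1 / (2 - \<lambda>))\<close>; a point of the cell is within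
  \<open>2 \<rho> ^ n\<close> of the boundary, so these costs add up to \<open>O(1 / (2 - \<lambda>))\<close> times the logarithm of the inverse
  distance. This is where \<open>\<beta>\<close> has to be small compared with \<open>2 - \<lambda>\<close>. Passing a neck from a
  room costs about \<open>(2 / \<beta>) log (1 / r)\<close>.

  Poincare inequality: test with the function that is \<open>1\<close> in a single room, \<open>0\<close> outside the room and
  its neck, and linear in the neck. The left-hand side is comparable to \<open>r powr (2 / q)\<close>, the gradient norm
  equals \<open>r powr ((2 / p - 1) / \<beta>)\<close>, and the second exponent is strictly larger in the given range of
  \<open>p\<close> and \<open>q\<close>.\<close>

subsection \<open>Arc length of Lipschitz paths\<close>

text \<open>The dust fixes the dimension and the rooms break the inequality. The two do not
  interfere: the rooms accumulate at the midpoint of the top side, above the strip of width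
  \<open>\<sigma> = 1 - 2 * \<rho>\<close> that the first Cantor stage empties, and the route from a
  room to the centre of the square stays in that strip. The obstacle is a common growth rate. With
  \<open>\<alpha> = 1 / \<beta>\<close>, every chain may cost at most
  \<open>2 * \<alpha> * log 2 (1 / \<delta>)\<close> up to a constant. A room spends this on the two
  cones that open from the ends of its neck. In the square the rate is \<open>10 / \<sigma>\<close>,
  whence the requirement \<open>5 / \<sigma> \<le> \<alpha>\<close>; since
  \<open>(2 - \<lambda>) / 4 \<le> \<sigma>\<close>, it follows from
  \<open>\<lambda> \<le> 2 - 20 * \<beta>\<close>. The 4 in \<beta> / 4 is the 2 of the two cones
  times a second 2 that covers the change from base 2 to natural logarithms. Geometric room sizes
  leave only O(log (1 / h)) rooms visible at scale h, hence an area O(h log (1 / h)), negligible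
  against \<open>h powr (2 - l)\<close> for l > 1.\<close>

lemma inscribed_lengthsI:
  "mono t \<Longrightarrow> range t \<subseteq> {a..b} \<Longrightarrow>
    (\<Sum>i<n. dist (g (t i)) (g (t (Suc i)))) \<in> inscribed_lengths g a b"
  unfolding inscribed_lengths_def by blast

text \<open>Truncating a partition by \<open>min\<close> and \<open>max\<close> at \<open>s\<close>
  gives partitions of both halves; a chord that straddles \<open>s\<close> is split by the triangle
  inequality through \<open>g s\<close>.\<close>

lemma inscribed_lengths_split:
  assumes "X \<in> inscribed_lengths g a t" "a \<le> s" "s \<le> t"
  obtains Y Z where "Y \<in> inscribed_lengths g a s" "Z \<in> inscribed_lengths g s t" "X \<le> Y + Z"
proof -
  obtain n \<tau> where X: "X = (\<Sum>i<n. dist (g (\<tau> i)) (g (\<tau> (Suc i))))"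
    and \<tau>: "mono \<tau>" "range \<tau> \<subseteq> {a..t}"
    using assms(1) unfolding inscribed_lengths_def by blast
  define Y where "Y = (\<Sum>i<n. dist (g (min (\<tau> i) s)) (g (min (\<tau> (Suc i)) s)))"
  define Z where "Z = (\<Sum>i<n. dist (g (max (\<tau> i) s)) (g (max (\<tau> (Suc i)) s)))"
  have "mono (\<lambda>i. min (\<tau> i) s)" "mono (\<lambda>i. max (\<tau> i) s)"
    using \<tau>(1) unfolding mono_def by (meson max.mono min.mono order_refl)+
  moreover have "range (\<lambda>i. min (\<tau> i) s) \<subseteq> {a..s}" "range (\<lambda>i. max (\<tau> i) s) \<subseteq> {s..t}"
    using \<tau>(2) assms(2,3) by (auto simp: image_subset_iff)
  ultimately have "Y \<in> inscribed_lengths g a s" "Z \<in> inscribed_lengths g s t"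
    unfolding Y_def Z_def
    using inscribed_lengthsI[of "\<lambda>i. min (\<tau> i) s" a s g n]
      inscribed_lengthsI[of "\<lambda>i. max (\<tau> i) s" s t g n] by simp_all
  moreover have "X \<le> Y + Z"
    unfolding X Y_def Z_def sum.distrib[symmetric]
  proof (rule sum_mono)
    fix i
    have le: "\<tau> i \<le> \<tau> (Suc i)"
      using \<tau>(1) by (simp add: mono_def)
    consider "\<tau> (Suc i) \<le> s" | "s \<le> \<tau> i" | "\<tau> i \<le> s" "s \<le> \<tau> (Suc i)"
      by linarith
    then show "dist (g (\<tau> i)) (g (\<tau> (Suc i))) \<le>
        dist (g (min (\<tau> i) s)) (g (min (\<tau> (Suc i)) s)) +
        dist (g (max (\<tau> i) s)) (g (max (\<tau> (Suc i)) s))"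
    proof cases
      case 1
      then show ?thesis
        using le by (simp add: min_def)
    next
      case 2
      then show ?thesis
        using le by (simp add: max.absorb1 add_increasing)
    next
      case 3
      then show ?thesis
        by (simp add: min_def max_def dist_triangle)
    qed
  qed
  ultimately show thesis
    using that by blast
qed

lemma inscribed_lengths_lipschitz:
  assumes "Z \<in> inscribed_lengths g s t" "M-lipschitz_on {s..t} g"
  shows "Z \<le> M * (t - s)"
proof -
  obtain n \<tau> where Z: "Z = (\<Sum>i<n. dist (g (\<tau> i)) (g (\<tau> (Suc i))))"
    and \<tau>: "mono \<tau>" "range \<tau> \<subseteq> {s..t}"
    using assms(1) unfolding inscribed_lengths_def by blast
  have M: "M \<ge> 0"
    using assms(2) by (rule lipschitz_on_nonneg)
  have "Z \<le> (\<Sum>i<n. M * (\<tau> (Suc i) - \<tau> i))"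
    unfolding Z
  proof (rule sum_mono)
    fix i
    have "\<tau> i \<le> \<tau> (Suc i)"
      using \<tau>(1) by (simp add: mono_def)
    then show "dist (g (\<tau> i)) (g (\<tau> (Suc i))) \<le> M * (\<tau> (Suc i) - \<tau> i)"
      using lipschitz_onD[OF assms(2), of "\<tau> i" "\<tau> (Suc i)"] \<tau>(2)
      by (auto simp: dist_real_def image_subset_iff)
  qed
  also have "\<dots> = M * (\<tau> n - \<tau> 0)"
    by (simp add: sum_distrib_left[symmetric] sum_lessThan_telescope)
  also have "\<dots> \<le> M * (t - s)"
  proof -
    have "\<tau> n \<in> {s..t}" "\<tau> 0 \<in> {s..t}"
      using \<tau>(2) by blast+
    then show ?thesis
      using M by (intro mult_left_mono) auto
  qed
  finally show ?thesis .
qed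

lemma inscribed_lengths_mono:
  "s \<le> t \<Longrightarrow> inscribed_lengths g a s \<subseteq> inscribed_lengths g a t"
  unfolding inscribed_lengths_def by fastforce

lemma zero_in_inscribed_lengths: "a \<le> b \<Longrightarrow> 0 \<in> inscribed_lengths g a b"
  unfolding inscribed_lengths_def
  by (rule CollectI, rule exI[of _ 0], rule exI[of _ "\<lambda>_. a"]) (auto simp: mono_def)

lemma lipschitz_rectifiable_path:
  assumes "L-lipschitz_on {0..1} g"
  shows "rectifiable_path g"
  unfolding rectifiable_path_def path_def
  using inscribed_lengths_lipschitz[OF _ assms] lipschitz_on_continuous_on[OF assms]
  by (auto simp: bdd_above_def)

lemma bdd_above_inscribed_lengths:
  assumes "L-lipschitz_on {0..1} g" "t \<le> 1"
  shows "bdd_above (inscribed_lengths g 0 t)"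
proof (rule bdd_above_mono[OF _ inscribed_lengths_mono[OF assms(2)]])
  show "bdd_above (inscribed_lengths g 0 1)"
    using lipschitz_rectifiable_path[OF assms(1)] by (simp add: rectifiable_path_def)
qed

lemma mono_arc_length:
  assumes "L-lipschitz_on {0..1} g" "s \<le> t"
  shows "arc_length g s \<le> arc_length g t"
  unfolding arc_length_def
proof (rule cSup_subset_mono)
  show "inscribed_lengths g 0 (max 0 (min 1 s)) \<noteq> {}"
    using zero_in_inscribed_lengths[of 0 "max 0 (min 1 s)" g] by auto
  show "bdd_above (inscribed_lengths g 0 (max 0 (min 1 t)))"
    by (rule bdd_above_inscribed_lengths[OF assms(1)]) simp
  show "inscribed_lengths g 0 (max 0 (min 1 s)) \<subseteq> inscribed_lengths g 0 (max 0 (min 1 t))"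
    using assms(2) by (intro inscribed_lengths_mono) auto
qed

text \<open>The global constant \<open>L\<close> makes the suprema finite; the bound itself uses the
  local constant \<open>M\<close>. This lets each edge of a polygon be charged its own
  length.\<close>

lemma arc_length_increment_le:
  assumes "L-lipschitz_on {0..1} g" "M-lipschitz_on {s..t} g" "0 \<le> s" "s \<le> t" "t \<le> 1"
  shows "arc_length g t - arc_length g s \<le> M * (t - s)"
proof -
  have "arc_length g t \<le> arc_length g s + M * (t - s)"
    unfolding arc_length_def
  proof (rule cSup_least)
    show "inscribed_lengths g 0 (max 0 (min 1 t)) \<noteq> {}"
      using zero_in_inscribed_lengths[of 0 "max 0 (min 1 t)" g] by auto
    fix X assume X: "X \<in> inscribed_lengths g 0 (max 0 (min 1 t))"
    have t: "max 0 (min 1 t) = t" "max 0 (min 1 s) = s"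
      using assms by auto
    obtain Y Z where YZ: "Y \<in> inscribed_lengths g 0 s" "Z \<in> inscribed_lengths g s t" "X \<le> Y + Z"
      using X assms unfolding t by (blast elim: inscribed_lengths_split)
    have "Y \<le> Sup (inscribed_lengths g 0 s)"
      using assms by (intro cSup_upper YZ bdd_above_inscribed_lengths[OF assms(1)]) auto
    then show "X \<le> Sup (inscribed_lengths g 0 (max 0 (min 1 s))) + M * (t - s)"
      using YZ inscribed_lengths_lipschitz[OF YZ(2) assms(2)] unfolding t by linarith
  qed
  then show ?thesis by simp
qed

text \<open>Continuity excludes atoms of the arc length measure, so that a closed interval has
  measure equal to the increment of \<open>arc_length\<close> over it.\<close>

lemma continuous_arc_length:
  assumes "L-lipschitz_on {0..1} g"
  shows "continuous_on UNIV (arc_length g)"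
proof -
  have eq: "arc_length g t = arc_length g (max 0 (min 1 t))" for t
    unfolding arc_length_def by (rule arg_cong[where f="\<lambda>t. Sup (inscribed_lengths g 0 t)"]) auto
  have incr: "\<bar>arc_length g t - arc_length g s\<bar> \<le> L * \<bar>t - s\<bar>" if "s \<le> t" for s t
  proof -
    let ?s = "max 0 (min 1 s)" and ?t = "max 0 (min 1 t)"
    have "arc_length g ?t - arc_length g ?s \<le> L * (?t - ?s)"
      using that by (intro arc_length_increment_le[OF assms lipschitz_on_subset[OF assms]]) auto
    also have "\<dots> \<le> L * (t - s)"
      using that lipschitz_on_nonneg[OF assms] by (intro mult_left_mono) auto
    finally show ?thesis
      using mono_arc_length[OF assms that] eq[of s] eq[of t] that by auto
  qed
  have "L-lipschitz_on UNIV (arc_length g)"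
  proof (rule lipschitz_onI)
    fix s t :: real
    show "dist (arc_length g s) (arc_length g t) \<le> L * dist s t"
      using incr[of s t] incr[of t s] by (cases "s \<le> t") (auto simp: dist_real_def abs_minus_commute)
  qed (rule lipschitz_on_nonneg[OF assms])
  then show ?thesis by (rule lipschitz_on_continuous_on)
qed

section \<open>Upper bounds for line integrals\<close>

lemma unit_interval_cover:
  assumes n: "n > 0"
  shows "{0..1::real} \<subseteq> (\<Union>i\<in>{..<n}. {real i / n..real (Suc i) / n})"
proof
  fix t :: real assume t: "t \<in> {0..1}"
  show "t \<in> (\<Union>i\<in>{..<n}. {real i / n..real (Suc i) / n})"
  proof (cases "t = 1")
    case True
    have "n - 1 < n" "t \<in> {real (n - 1) / n..real (Suc (n - 1)) / n}"
      using n True by (auto simp: field_simps of_nat_diff)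
    then show ?thesis by blast
  next
    case False
    define i where "i = nat \<lfloor>t * n\<rfloor>"
    have fl: "real i = of_int \<lfloor>t * n\<rfloor>"
      unfolding i_def using t by auto
    have "real i \<le> t * n" "t * n < real i + 1"
      unfolding fl by (auto simp: floor_correct)
    moreover have "t * n < 1 * real n"
      using False t n by (intro mult_strict_right_mono) auto
    ultimately have "real i < real n" "real i \<le> t * n" "t * n < real i + 1"
      by linarith+
    then have "i < n" "t \<in> {real i / n..real (Suc i) / n}"
      using n by (auto simp: pos_divide_le_eq pos_le_divide_eq)
    then show ?thesis by blast
  qed
qed

text \<open>The integrand is compared with a step function. Neighbouring closed pieces share an
  endpoint, which only increases the step function because \<open>m\<close> is nonnegative.\<close>

lemma line_integral_le_sum:
  assumes L: "L-lipschitz_on {0..1} g" and n: "n > 0"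
    and M: "\<And>i. i < n \<Longrightarrow> (M i)-lipschitz_on {real i / n..real (Suc i) / n} g"
    and m: "\<And>i t. i < n \<Longrightarrow> t \<in> {real i / n..real (Suc i) / n} \<Longrightarrow> \<rho> (g t) \<le> m i"
    and m0: "\<And>i. i < n \<Longrightarrow> 0 \<le> m i"
  shows "line_integral g \<rho> \<le> (\<Sum>i<n. m i * (M i / n))"
proof -
  let ?\<mu> = "interval_measure (arc_length g)"
  let ?I = "\<lambda>i::nat. {real i / n..real (Suc i) / n}"
  define h where "h t = (\<Sum>i<n. m i * indicator (?I i) t)" for t :: real
  have em: "emeasure ?\<mu> (?I i) = arc_length g (real (Suc i) / n) - arc_length g (real i / n)" for i
    by (rule emeasure_interval_measure_Icc)
      (auto simp: divide_right_mono mono_arc_length[OF L] continuous_arc_length[OF L])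
  have int: "integrable ?\<mu> (indicator (?I i) :: real \<Rightarrow> real)" for i
    by (rule integrable_real_indicator) (auto simp: em simp del: of_nat_Suc)
  have inth: "integrable ?\<mu> h"
    unfolding h_def by (intro Bochner_Integration.integrable_sum integrable_mult_right int)
  have h0: "0 \<le> h t" for t
    unfolding h_def by (intro sum_nonneg mult_nonneg_nonneg) (auto simp: m0)
  have le: "indicator {0..1} t *\<^sub>R \<rho> (g t) \<le> h t" for t
  proof (cases "t \<in> {0..1}")
    case True
    obtain i where i: "i < n" "t \<in> ?I i"
      using unit_interval_cover[OF n] True by blast
    have "\<rho> (g t) \<le> m i * indicator (?I i) t"
      using m[OF i] i by simp
    also have "\<dots> \<le> h t"
      unfolding h_def using i by (intro member_le_sum) (auto simp: m0)
    finally show ?thesis using True by simp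
  qed (use h0 in auto)
  \<comment> \<open>A non-integrable left-hand side would have the default integral
    \<open>0\<close>; \<open>integral_mono'\<close> covers that case through
    \<open>0 \<le> h t\<close>.\<close>
  have "line_integral g \<rho> \<le> (LINT t|?\<mu>. h t)"
    unfolding line_integral_def set_lebesgue_integral_def
    by (rule integral_mono'[OF inth]) (use le h0 in auto)
  also have "\<dots> = (\<Sum>i<n. m i * measure ?\<mu> (?I i))"
    unfolding h_def
    by (subst Bochner_Integration.integral_sum) (auto intro!: integrable_mult_right int simp del: of_nat_Suc)
  also have "\<dots> \<le> (\<Sum>i<n. m i * (M i / n))"
  proof (intro sum_mono mult_left_mono)
    fix i assume "i \<in> {..<n}"
    then have i: "i < n" by simp
    have "measure ?\<mu> (?I i) = arc_length g (real (Suc i) / n) - arc_length g (real i / n)"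
      unfolding measure_def em
      by (intro enn2real_ennreal) (simp add: mono_arc_length[OF L] divide_right_mono)
    also have "\<dots> \<le> M i * (real (Suc i) / n - real i / n)"
      by (rule arc_length_increment_le[OF L M[OF i]])
        (use i n in \<open>auto simp: divide_right_mono divide_le_eq\<close>)
    also have "\<dots> = M i / n"
      by (simp add: field_simps diff_divide_distrib[symmetric])
    finally show "measure ?\<mu> (?I i) \<le> M i / n" .
  qed (use m0 in auto)
  finally show ?thesis .
qed


subsection \<open>Polygonal chains\<close>

text \<open>\<open>K\<close> bounds the quasihyperbolic length of a polygon from \<open>x\<close> to \<open>y\<close>: a segment whose points have
  distance at least \<open>\<delta>\<close> to the boundary contributes its length divided by \<open>\<delta>\<close>.\<close>

inductive qh_chain :: "'a::euclidean_space set \<Rightarrow> 'a \<Rightarrow> 'a \<Rightarrow> real \<Rightarrow> bool" for G where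
  qh_refl: "0 \<le> K \<Longrightarrow> qh_chain G x x K"
| qh_step: "\<delta> > 0 \<Longrightarrow> (\<And>z. z \<in> closed_segment x y \<Longrightarrow> ball z \<delta> \<subseteq> G) \<Longrightarrow> qh_chain G y z K \<Longrightarrow>
    dist x y / \<delta> + K \<le> K' \<Longrightarrow> qh_chain G x z K'"

lemma qh_chain_mono:
  assumes "qh_chain G x y K" "K \<le> K'"
  shows "qh_chain G x y K'"
  using assms
proof (cases rule: qh_chain.cases)
  case qh_refl
  then show ?thesis
    using assms(2) by (auto intro: qh_chain.qh_refl)
next
  case (qh_step \<delta> z L)
  show ?thesis
    by (rule qh_chain.qh_step[OF qh_step(1,2,3)]) (use qh_step assms(2) in auto)
qed

lemma qh_chain_trans:
  assumes "qh_chain G x y K" "qh_chain G y z K'"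
  shows "qh_chain G x z (K + K')"
  using assms
proof (induction arbitrary: z rule: qh_chain.induct)
  case (qh_refl K x)
  then show ?case by (auto intro: qh_chain_mono)
next
  case (qh_step \<delta> x y y' K K'')
  show ?case
    by (rule qh_chain.qh_step[OF qh_step.hyps(1,2) qh_step.IH[OF qh_step.prems]]) (use qh_step in auto)
qed

lemma qh_chain_segment:
  assumes "\<delta> > 0" "\<And>z. z \<in> closed_segment x y \<Longrightarrow> ball z \<delta> \<subseteq> G" "dist x y / \<delta> \<le> K"
  shows "qh_chain G x y K"
  by (rule qh_chain.qh_step[OF assms(1,2) qh_chain.qh_refl[of 0]]) (use assms in auto)

lemma qh_chain_sym:
  assumes "qh_chain G x y K" shows "qh_chain G y x K"
  using assms
proof (induction rule: qh_chain.induct)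
  case (qh_step \<delta> x y z K K')
  have "qh_chain G y x (dist x y / \<delta>)"
    by (rule qh_chain_segment[OF qh_step.hyps(1)])
      (use qh_step.hyps(2) in \<open>auto simp: closed_segment_commute dist_commute\<close>)
  from qh_chain_trans[OF qh_step.IH this] show ?case
    by (rule qh_chain_mono) (use qh_step in auto)
qed (auto intro: qh_chain.intros)

text \<open>The end point has to be assumed in \<open>G\<close>, because an empty chain does not
  constrain its point. Connectedness of the domain will follow from the same chains as the distance
  estimates.\<close>

lemma qh_chain_path_component:
  assumes "qh_chain G x y K" "y \<in> G" shows "path_component G x y"
  using assms
proof (induction rule: qh_chain.induct)
  case (qh_step \<delta> x y z K K')
  have "closed_segment x y \<subseteq> G"
    using qh_step.hyps(1,2) by (meson centre_in_ball subset_eq)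
  then have "path_component G x y"
    by (auto simp: path_component_def intro!: exI[of _ "linepath x y"])
  then show ?case
    using qh_step path_component_trans by metis
qed (simp add: path_component_refl)

text \<open>The indexed form, in which a chain can be traversed by a single parametrised
  path.\<close>

lemma qh_chain_vertices:
  assumes "qh_chain G x y K"
  shows "\<exists>n p \<delta>. p 0 = x \<and> p n = y \<and>
    (\<forall>i<n. \<delta> i > 0 \<and> (\<forall>z\<in>closed_segment (p i) (p (Suc i)). ball z (\<delta> i) \<subseteq> G)) \<and>
    (\<Sum>i<n. dist (p i) (p (Suc i)) / \<delta> i) \<le> K"
  using assms
proof (induction rule: qh_chain.induct)
  case (qh_refl K x)
  show ?case
    by (intro exI[of _ 0] exI[of _ "\<lambda>_. x"] exI[of _ "\<lambda>_. 1"]) (use qh_refl in auto)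
next
  case (qh_step d x y z K K')
  obtain p n \<delta> where p: "p 0 = y" "p n = z"
    "\<forall>i<n. \<delta> i > 0 \<and> (\<forall>z\<in>closed_segment (p i) (p (Suc i)). ball z (\<delta> i) \<subseteq> G)"
    "(\<Sum>i<n. dist (p i) (p (Suc i)) / \<delta> i) \<le> K"
    using qh_step.IH by blast
  have "case_nat d \<delta> i > 0 \<and>
      (\<forall>w\<in>closed_segment (case_nat x p i) (case_nat x p (Suc i)). ball w (case_nat d \<delta> i) \<subseteq> G)"
    if "i < Suc n" for i
    using that p qh_step.hyps by (cases i) auto
  moreover have "(\<Sum>i<Suc n. dist (case_nat x p i) (case_nat x p (Suc i)) / case_nat d \<delta> i) \<le> K'"
    unfolding sum.lessThan_Suc_shift using p qh_step.hyps by simp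
  ultimately show ?case
    using p by (intro exI[of _ "Suc n"] exI[of _ "case_nat x p"] exI[of _ "case_nat d \<delta>"]) auto
qed

section \<open>From chains to quasihyperbolic distance\<close>

lemma infdist_frontier_ge:
  assumes "open G" "frontier G \<noteq> {}" "ball z \<delta> \<subseteq> G"
  shows "\<delta> \<le> infdist z (frontier G)"
  \<comment> \<open>\<open>infdist\<close> to the empty set is \<open>0\<close>, hence the
    assumption that the frontier is nonempty.\<close>
  unfolding infdist_notempty[OF assms(2)]
proof (rule cINF_greatest[OF assms(2)])
  fix y assume "y \<in> frontier G"
  then have "y \<notin> G"
    using assms(1) by (simp add: frontier_def interior_open)
  then show "\<delta> \<le> dist z y"
    using assms(3) by (meson mem_ball not_le subsetD)
qed

lemma frontier_nonempty:
  fixes G :: "'a::euclidean_space set"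
  assumes "bounded G" "G \<noteq> {}"
  shows "frontier G \<noteq> {}"
  using assms frontier_eq_empty[of G] not_bounded_UNIV[where 'a='a] by auto

lemma line_integral_nonneg: "(\<And>z. 0 \<le> \<rho> z) \<Longrightarrow> 0 \<le> line_integral g \<rho>"
  unfolding line_integral_def set_lebesgue_integral_def
  by (rule Bochner_Integration.integral_nonneg) auto

definition polygon :: "(nat \<Rightarrow> 'a::real_vector) \<Rightarrow> real \<Rightarrow> 'a" where
  "polygon p s = p (nat \<lfloor>s\<rfloor>) + (s - real (nat \<lfloor>s\<rfloor>)) *\<^sub>R (p (Suc (nat \<lfloor>s\<rfloor>)) - p (nat \<lfloor>s\<rfloor>))"

lemma polygon_eq:
  assumes "s \<in> {real i..real (Suc i)}"
  shows "polygon p s = p i + (s - real i) *\<^sub>R (p (Suc i) - p i)"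
\<comment> \<open>At the right end the floor already selects the next edge, whose initial vertex is
  the same point.\<close>
proof (cases "s = real (Suc i)")
  case True
  have "nat \<lfloor>s\<rfloor> = Suc i"
    unfolding True floor_of_nat by simp
  then show ?thesis
    unfolding polygon_def using True by simp
next
  case False
  then have "\<lfloor>s\<rfloor> = int i"
    using assms by (intro floor_unique) auto
  then show ?thesis
    unfolding polygon_def by simp
qed

text \<open>The polygon is traversed in unit time, with time \<open>1 / n\<close> per edge. Edge
  \<open>i\<close> then has Lipschitz constant \<open>n\<close> times its length, and the density is
  at most \<open>1 / \<delta> i\<close> on it, so \<open>line_integral_le_sum\<close> reproduces the
  cost of the chain.\<close>

lemma quasihyperbolic_dist_le_chain:
  fixes G :: "'a::euclidean_space set"
  assumes G: "open G" "bounded G" and x: "x \<in> G" and ch: "qh_chain G x y K"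
  shows "quasihyperbolic_dist G x y \<le> K"
proof -
  obtain \<epsilon> where \<epsilon>: "\<epsilon> > 0" "ball x \<epsilon> \<subseteq> G"
    using G x open_contains_ball by blast
  obtain n p \<delta> where p0: "p 0 = x" "p n = y"
    "\<forall>i<n. \<delta> i > 0 \<and> (\<forall>z\<in>closed_segment (p i) (p (Suc i)). ball z (\<delta> i) \<subseteq> G)"
    "(\<Sum>i<n. dist (p i) (p (Suc i)) / \<delta> i) \<le> K" and n: "n > 0"
  proof -
    obtain n p \<delta> where p: "p 0 = x" "p n = y"
      "\<forall>i<n. \<delta> i > 0 \<and> (\<forall>z\<in>closed_segment (p i) (p (Suc i)). ball z (\<delta> i) \<subseteq> G)"
      "(\<Sum>i<n. dist (p i) (p (Suc i)) / \<delta> i) \<le> K"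
      using qh_chain_vertices[OF ch] by blast
    show thesis
    \<comment> \<open>A chain without edges is replaced by one constant edge, since the time
      rescaling divides by \<open>n\<close>; openness of \<open>G\<close> supplies its
      radius.\<close>
    proof (cases "n = 0")
      case True
      show thesis
        by (rule that[of "\<lambda>_. x" 1 "\<lambda>_. \<epsilon>"]) (use True p \<epsilon> in auto)
    next
      case False
      show thesis
        by (rule that[of p n \<delta>]) (use False p in auto)
    qed
  qed
  have p: "p 0 = x" "p n = y" "\<And>i. i < n \<Longrightarrow> \<delta> i > 0"
    "\<And>i z. i < n \<Longrightarrow> z \<in> closed_segment (p i) (p (Suc i)) \<Longrightarrow> ball z (\<delta> i) \<subseteq> G"
    "(\<Sum>i<n. dist (p i) (p (Suc i)) / \<delta> i) \<le> K"
    using p0 by auto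
  define g where "g t = polygon p (n * t)" for t :: real
  define M where "M i = n * dist (p i) (p (Suc i))" for i
  let ?I = "\<lambda>i::nat. {real i / n..real (Suc i) / n}"
  have rescale: "real i \<le> n * t" "n * t \<le> real (Suc i)" if "t \<in> ?I i" for t :: real and i
    using that n
    by (auto simp: pos_divide_le_eq pos_le_divide_eq mult.commute simp del: of_nat_Suc)
  have g_eq: "g t = p i + (n * t - real i) *\<^sub>R (p (Suc i) - p i)" if "t \<in> ?I i" for t :: real and i
    unfolding g_def by (rule polygon_eq) (use rescale[OF that] in auto)
  have lip: "(M i)-lipschitz_on (?I i) g" for i
  proof (rule lipschitz_onI)
    fix s t assume st: "s \<in> ?I i" "t \<in> ?I i"
    have "g s - g t = (n * (s - t)) *\<^sub>R (p (Suc i) - p i)"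
      using scaleR_left_diff_distrib[of "n * s - i" "n * t - i" "p (Suc i) - p i"]
      by (simp add: g_eq[OF st(1)] g_eq[OF st(2)] right_diff_distrib)
    then have "dist (g s) (g t) = \<bar>n * (s - t)\<bar> * dist (p i) (p (Suc i))"
      unfolding dist_norm norm_minus_commute[of "p i"] by (metis norm_scaleR)
    then show "dist (g s) (g t) \<le> M i * dist s t"
      by (simp add: M_def dist_real_def abs_mult)
  qed (auto simp: M_def)
  have cover: "{0..1} \<subseteq> (\<Union>i\<in>{..<n}. ?I i)"
    by (rule unit_interval_cover[OF n])
  define L where "L = (\<Sum>i<n. M i)"
  have M_le: "M i \<le> L" if "i < n" for i
    unfolding L_def using that by (intro member_le_sum) (auto simp: M_def)
  have L: "L-lipschitz_on {0..1} g"
  proof (rule lipschitz_on_closed_Union[OF _ _ _ _ cover])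
    show "L-lipschitz_on (?I i) g" if "i \<in> {..<n}" for i
      using that by (intro lipschitz_on_le[OF lip M_le]) auto
  qed (auto intro: sum_nonneg simp: L_def M_def)
  have seg: "g t \<in> closed_segment (p i) (p (Suc i))" if "t \<in> ?I i" for t :: real and i
  proof -
    have "n * t - real i \<in> {0..1}"
      using rescale[OF that] by auto
    moreover have "g t = (1 - (n * t - real i)) *\<^sub>R p i + (n * t - real i) *\<^sub>R p (Suc i)"
      unfolding g_eq[OF that] by (simp add: algebra_simps)
    ultimately show ?thesis
      unfolding in_segment by (intro exI[of _ "n * t - real i"]) auto
  qed
  have ball: "ball (g t) (\<delta> i) \<subseteq> G" if "i < n" "t \<in> ?I i" for t i
    using p(4)[OF that(1) seg[OF that(2)]] .
  have img: "path_image g \<subseteq> G"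
  proof -
    have "g t \<in> G" if t: "t \<in> {0..1}" for t
    proof -
      obtain i where "i < n" "t \<in> ?I i"
        using cover t by blast
      then show ?thesis
        using ball[of i t] p(3)[of i] by (meson centre_in_ball subset_eq)
    qed
    then show ?thesis by (auto simp: path_image_def)
  qed
  have ends: "pathstart g = x" "pathfinish g = y"
  proof -
    have "g 0 = p 0"
      by (subst g_eq[of 0 0]) auto
    moreover have "g 1 = p (n - 1) + (n - real (n - 1)) *\<^sub>R (p (Suc (n - 1)) - p (n - 1))"
      using n by (subst g_eq[of 1 "n - 1"]) (auto simp: field_simps)
    ultimately show "pathstart g = x" "pathfinish g = y"
      using p(1,2) n by (auto simp: pathstart_def pathfinish_def of_nat_diff)
  qed
  have fr: "frontier G \<noteq> {}"
    using G(2) x by (intro frontier_nonempty) auto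
  let ?\<rho> = "\<lambda>z. 1 / infdist z (frontier G)"
  have "quasihyperbolic_dist G x y \<le> line_integral g ?\<rho>"
    unfolding quasihyperbolic_dist_def
  proof (rule cINF_lower)
    show "bdd_below ((\<lambda>g. line_integral g ?\<rho>) ` {g. rectifiable_path g \<and> path_image g \<subseteq> G \<and>
        pathstart g = x \<and> pathfinish g = y})"
      by (rule bdd_belowI[of _ 0]) (auto intro!: line_integral_nonneg infdist_nonneg)
    show "g \<in> {g. rectifiable_path g \<and> path_image g \<subseteq> G \<and> pathstart g = x \<and> pathfinish g = y}"
      using lipschitz_rectifiable_path[OF L] img ends by auto
  qed
  also have "\<dots> \<le> (\<Sum>i<n. 1 / \<delta> i * (M i / n))"
  proof (rule line_integral_le_sum[OF L n lip])
    fix i t assume i: "i < n" "t \<in> ?I i"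
    have "\<delta> i \<le> infdist (g t) (frontier G)"
      by (rule infdist_frontier_ge[OF G(1) fr ball[OF i]])
    then show "1 / infdist (g t) (frontier G) \<le> 1 / \<delta> i"
      using p(3)[OF i(1)] by (intro divide_left_mono) auto
  qed (use p(3) in \<open>auto intro: less_imp_le\<close>)
  also have "\<dots> \<le> K"
    using p(5) n by (simp add: M_def)
  finally show ?thesis .
qed

text \<open>Halve the segment repeatedly: each dyadic piece costs \<open>1 / \<kappa>\<close>, and the last one lies in
  \<open>ball x \<delta>\<close>.\<close>

lemma qh_chain_cone_dyadic:
  assumes "0 < \<kappa>" "\<kappa> \<le> 1" "0 < \<delta>" "ball x \<delta> \<subseteq> G"
    and "\<And>s. 0 \<le> s \<Longrightarrow> s \<le> 1 \<Longrightarrow> ball (x + s *\<^sub>R (c - x)) (\<kappa> * (s * dist x c)) \<subseteq> G"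
    and "dist x c \<le> 2 ^ m * (\<delta> / 2)"
  shows "qh_chain G x c (1 + m / \<kappa>)"
  using assms(5,6)
proof (induction m arbitrary: c)
  case 0
  show ?case
  proof (rule qh_chain_segment[of "\<delta> / 2"])
    fix z assume "z \<in> closed_segment x c"
    then have "dist x z \<le> dist x c"
      by (metis dist_commute segment_bound(1) dist_norm)
    then have "ball z (\<delta> / 2) \<subseteq> ball x \<delta>"
      using 0 by (auto simp: subset_eq) (smt (verit, best) dist_triangle field_sum_of_halves)
    then show "ball z (\<delta> / 2) \<subseteq> G"
      using assms(4) by blast
  qed (use 0 \<open>0 < \<delta>\<close> in \<open>auto simp: field_simps\<close>)
next
  case (Suc m)
  define c' where "c' = x + (1/2) *\<^sub>R (c - x)"
  have d': "dist x c' = dist x c / 2"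
    by (simp add: c'_def dist_norm norm_minus_commute)
  have eq: "x + s *\<^sub>R (c' - x) = x + (s / 2) *\<^sub>R (c - x)" for s
    by (simp add: c'_def)
  have 1: "qh_chain G x c' (1 + m / \<kappa>)"
  proof (rule Suc.IH)
    fix s :: real assume "0 \<le> s" "s \<le> 1"
    then show "ball (x + s *\<^sub>R (c' - x)) (\<kappa> * (s * dist x c')) \<subseteq> G"
      unfolding eq d' using Suc.prems(1)[of "s / 2"] by simp
  qed (use Suc.prems d' in auto)
  show ?case
  proof (cases "x = c")
    case True
    then show ?thesis using assms(1) by (auto intro!: qh_chain.qh_refl)
  next
    case False
    then have D: "dist x c > 0" by simp
    have "qh_chain G c' c (1 / \<kappa>)"
    proof (rule qh_chain_segment[of "\<kappa> * (dist x c / 2)"])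
      fix z assume "z \<in> closed_segment c' c"
      then obtain s where s: "0 \<le> s" "s \<le> 1" "z = (1 - s) *\<^sub>R c' + s *\<^sub>R c"
        by (auto simp: in_segment)
      have z: "z = x + ((1 + s) / 2) *\<^sub>R (c - x)"
        unfolding s(3) c'_def by (rule euclidean_eqI) (simp add: inner_simps field_simps)
      have "ball z (\<kappa> * (dist x c / 2)) \<subseteq> ball z (\<kappa> * ((1 + s) / 2 * dist x c))"
        using s D assms(1) by (intro subset_ball mult_left_mono) auto
      also have "\<dots> \<subseteq> G"
        unfolding z using s by (intro Suc.prems(1)) auto
      finally show "ball z (\<kappa> * (dist x c / 2)) \<subseteq> G" .
    next
      have "dist c' c = dist x c / 2"
      proof -
        have "c' - c = (1/2) *\<^sub>R (x - c)"
          unfolding c'_def by (rule euclidean_eqI) (simp add: inner_simps field_simps)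
        then show ?thesis by (simp add: dist_norm)
      qed
      then show "dist c' c / (\<kappa> * (dist x c / 2)) \<le> 1 / \<kappa>"
        using D assms(1) by (simp add: field_simps)
    qed (use D assms(1) in auto)
    from qh_chain_trans[OF 1 this] show ?thesis
      by (rule qh_chain_mono) (simp add: add_divide_distrib)
  qed
qed

text \<open>\<open>m\<close> halvings bring \<open>D\<close> down to at most
  \<open>\<delta> / 2\<close>, so the cost is logarithmic in \<open>D / \<delta>\<close>. Allowing
  any bound \<open>D\<close> for the distance makes room for \<open>x = c\<close>;
  \<open>\<delta> \<le> 2 * D\<close> keeps the logarithm nonnegative, so that \<open>nat\<close> of
  its ceiling loses nothing.\<close>

lemma qh_chain_cone:
  assumes "0 < \<kappa>" "\<kappa> \<le> 1" "0 < \<delta>" "ball x \<delta> \<subseteq> G"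
    and "\<And>s. 0 \<le> s \<Longrightarrow> s \<le> 1 \<Longrightarrow> ball (x + s *\<^sub>R (c - x)) (\<kappa> * (s * dist x c)) \<subseteq> G"
    and "dist x c \<le> D" "\<delta> \<le> 2 * D"
  shows "qh_chain G x c (1 + (log 2 (D / \<delta>) + 2) / \<kappa>)"
proof -
  have D: "D > 0" using assms by linarith
  define m where "m = nat \<lceil>log 2 (2 * D / \<delta>)\<rceil>"
  have l0: "log 2 (2 * D / \<delta>) \<ge> 0"
    using assms(3,7) D by (subst zero_le_log_cancel_iff) (auto simp: field_simps)
  have leq: "log 2 (2 * D / \<delta>) = 1 + log 2 (D / \<delta>)"
    using assms(3) D log_mult[of 2 "D / \<delta>" 2] by (simp add: mult.commute)
  have m: "real m = of_int \<lceil>log 2 (2 * D / \<delta>)\<rceil>"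
    unfolding m_def using l0 by simp
  have "2 * D / \<delta> = 2 powr log 2 (2 * D / \<delta>)"
    using assms(3) D by simp
  also have "\<dots> \<le> 2 powr real m"
    unfolding m by (intro powr_mono) auto
  finally have "2 * D / \<delta> \<le> 2 ^ m"
    by (simp add: powr_realpow)
  then have "D \<le> 2 ^ m * (\<delta> / 2)"
    using assms(3) by (simp add: field_simps)
  then have "qh_chain G x c (1 + m / \<kappa>)"
    using assms by (intro qh_chain_cone_dyadic[OF assms(1-5)]) auto
  moreover have "real m \<le> log 2 (D / \<delta>) + 2"
    unfolding m using leq by linarith
  ultimately show ?thesis
    using assms(1) by (elim qh_chain_mono) (auto intro: divide_right_mono)
qed


subsection \<open>Weak gradients of Lipschitz functions\<close>

lemma bounded_borel_absolutely_integrable_on: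
  fixes f :: "'a::euclidean_space \<Rightarrow> 'b::euclidean_space"
  assumes [measurable]: "f \<in> borel_measurable borel" and M: "\<And>x. norm (f x) \<le> M"
    and K: "K \<in> lmeasurable"
  shows "f absolutely_integrable_on K"
  unfolding set_integrable_def
proof (rule Bochner_Integration.integrable_bound)
  show "integrable lebesgue (\<lambda>x. M * indicat_real K x)"
    using K by (intro integrable_mult_right integrable_real_indicator) (auto simp: fmeasurable_def)
  show "(\<lambda>x. indicat_real K x *\<^sub>R f x) \<in> borel_measurable lebesgue"
    using K by (intro borel_measurable_scaleR borel_measurable_indicator measurable_completion) auto
  show "AE x in lebesgue. norm (indicat_real K x *\<^sub>R f x) \<le> norm (M * indicat_real K x)"
    using M by (auto simp: indicator_def intro: order_trans[OF _ abs_ge_self])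
qed

lemma lborel_translate:
  fixes f :: "'a::euclidean_space \<Rightarrow> real"
  assumes [measurable]: "f \<in> borel_measurable borel" and "integrable lborel f"
  shows "integrable lborel (\<lambda>x. f (x + c))" "(LINT x|lborel. f (x + c)) = (LINT x|lborel. f x)"
proof -
  show "integrable lborel (\<lambda>x. f (x + c))"
    using assms integrable_distr_eq[of "(+) c" lborel borel f]
    by (simp add: lborel_distr_plus add.commute)
  show "(LINT x|lborel. f (x + c)) = (LINT x|lborel. f x)"
    using integral_distr[of "(+) c" lborel borel f] by (simp add: lborel_distr_plus add.commute)
qed

lemma has_derivative_imp_line_derivative:
  fixes \<psi> :: "'a::euclidean_space \<Rightarrow> real"
  assumes "(\<psi> has_derivative D) (at (x + t *\<^sub>R i))"
  shows "((\<lambda>t. \<psi> (x + t *\<^sub>R i)) has_real_derivative D i) (at t)"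
proof -
  have "((\<lambda>t. x + t *\<^sub>R i) has_derivative (\<lambda>t. t *\<^sub>R i)) (at t)"
    by (auto intro!: derivative_eq_intros)
  from diff_chain_at[OF this, of \<psi> D] assms
  have "((\<lambda>t. \<psi> (x + t *\<^sub>R i)) has_derivative (\<lambda>t. D (t *\<^sub>R i))) (at t)"
    by (simp add: o_def)
  moreover have "(\<lambda>t. D (t *\<^sub>R i)) = (*) (D i)"
    using linear_scale[OF has_derivative_linear[OF assms]] by (auto simp: mult.commute)
  ultimately show ?thesis
    by (simp add: has_field_derivative_def)
qed

lemma zero_has_derivative_outside_support:
  fixes \<psi> :: "'a::euclidean_space \<Rightarrow> real"
  assumes "x \<notin> S" "closed S" "\<And>x. x \<notin> S \<Longrightarrow> \<psi> x = 0"
  shows "(\<psi> has_derivative (\<lambda>h. 0)) (at x)"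
  by (rule has_derivative_transform_within_open[of "\<lambda>_. 0" _ x UNIV "- S"]) (use assms in auto)

lemma test_functionD:
  fixes \<phi> :: "'a::euclidean_space \<Rightarrow> real"
  assumes "test_function G \<phi>" "i \<in> Basis"
  obtains S B where "compact S" "S \<subseteq> G" "\<And>x. x \<notin> S \<Longrightarrow> \<phi> x = 0"
    "\<And>x. x \<notin> S \<Longrightarrow> frechet_derivative \<phi> (at x) i = 0"
    "continuous_on UNIV \<phi>" "continuous_on UNIV (\<lambda>x. frechet_derivative \<phi> (at x) i)"
    "\<And>x. (\<phi> has_derivative frechet_derivative \<phi> (at x)) (at x)"
    "\<And>x. \<bar>\<phi> x\<bar> \<le> B" "\<And>x. \<bar>frechet_derivative \<phi> (at x) i\<bar> \<le> B"
    "\<And>x t. 0 \<le> t \<Longrightarrow> \<bar>\<phi> (x + t *\<^sub>R i) - \<phi> x\<bar> \<le> B * t"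
proof -
  define S where "S = closure {x. \<phi> x \<noteq> 0}"
  define d where "d x = frechet_derivative \<phi> (at x) i" for x
  have S: "compact S" "S \<subseteq> G" and Ck: "\<And>k. Ck k \<phi>"
    using assms(1) by (auto simp: test_function_def S_def)
  have out: "\<phi> x = 0" if "x \<notin> S" for x
    using that closure_subset[of "{x. \<phi> x \<noteq> 0}"] by (auto simp: S_def)
  have cont: "continuous_on UNIV \<phi>" "continuous_on UNIV d"
    using Ck[of 0] Ck[of "Suc 0"] assms(2) by (auto simp: d_def)
  have der: "(\<phi> has_derivative frechet_derivative \<phi> (at x)) (at x)" for x
    using Ck[of "Suc 0"] frechet_derivative_works by auto
  have dout: "d x = 0" if "x \<notin> S" for x
    using frechet_derivative_at[OF zero_has_derivative_outside_support[OF that]]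
      compact_imp_closed[OF S(1)] out unfolding d_def by metis
  have "compact (\<phi> ` S)" "compact (d ` S)"
    using S cont by (auto intro!: compact_continuous_image intro: continuous_on_subset)
  then obtain B1 B2 where B12: "\<And>x. x \<in> S \<Longrightarrow> \<bar>\<phi> x\<bar> \<le> B1" "\<And>x. x \<in> S \<Longrightarrow> \<bar>d x\<bar> \<le> B2"
    using compact_imp_bounded bounded_iff by (metis image_eqI real_norm_def)
  define B where "B = max 0 (max B1 B2)"
  have B: "\<bar>\<phi> x\<bar> \<le> B" "\<bar>d x\<bar> \<le> B" for x
    using B12[of x] out[of x] dout[of x] by (cases "x \<in> S"; force simp: B_def)+
  have lip: "\<bar>\<phi> (x + t *\<^sub>R i) - \<phi> x\<bar> \<le> B * t" if "0 \<le> t" for x t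
  proof (cases "t = 0")
    case False
    then have "0 < t" using that by simp
    from MVT2[OF this, of "\<lambda>t. \<phi> (x + t *\<^sub>R i)" "\<lambda>t. d (x + t *\<^sub>R i)"]
    obtain z where "\<phi> (x + t *\<^sub>R i) - \<phi> x = t * d (x + z *\<^sub>R i)"
      using has_derivative_imp_line_derivative[OF der] by (auto simp: d_def)
    then show ?thesis
      using mult_left_mono[OF B(2)[of "x + z *\<^sub>R i"] that] that by (simp add: abs_mult mult.commute)
  qed simp
  show thesis
    using that[OF S out _ cont(1) _ der B(1) _ lip] cont(2) B(2) dout unfolding d_def by blast
qed

text \<open>Difference quotients of \<open>u * \<phi>\<close> in direction \<open>i\<close> have
  integral \<open>0\<close> by translation invariance. They are uniformly bounded, since both
  factors are bounded and Lipschitz in that direction, and they vanish off a fixed ball. Dominated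
  convergence then gives a vanishing integral of the almost everywhere derivative
  \<open>u * d + (v \<bullet> i) * \<phi>\<close>, which is integration by parts.\<close>

lemma weak_gradient_lipschitz:
  fixes u :: "'a::euclidean_space \<Rightarrow> real" and v :: "'a \<Rightarrow> 'a"
  assumes G: "open G" and L: "L-lipschitz_on UNIV u"
    and M: "\<And>x. \<bar>u x\<bar> \<le> M" "\<And>x. norm (v x) \<le> M"
    and v [measurable]: "v \<in> borel_measurable borel"
    and N: "negligible N"
    and deriv: "\<And>x. x \<in> G - N \<Longrightarrow> (u has_derivative (\<lambda>h. v x \<bullet> h)) (at x)"
  shows "weak_gradient G u v"
  unfolding weak_gradient_def
proof (intro conjI allI impI ballI)
  have cu: "continuous_on UNIV u"
    using L by (rule lipschitz_on_continuous_on)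
  have [measurable]: "u \<in> borel_measurable borel"
    using cu by (rule borel_measurable_continuous_onI)
  show "locally_integrable G u" "locally_integrable G v"
    using M by (auto simp: locally_integrable_def lmeasurable_compact
        intro!: bounded_borel_absolutely_integrable_on)
  fix \<phi> and i :: 'a assume "test_function G \<phi>" and i: "i \<in> Basis"
  then obtain S B where S: "compact S" "S \<subseteq> G" and out: "\<And>x. x \<notin> S \<Longrightarrow> \<phi> x = 0"
    "\<And>x. x \<notin> S \<Longrightarrow> frechet_derivative \<phi> (at x) i = 0"
    and cont: "continuous_on UNIV \<phi>" "continuous_on UNIV (\<lambda>x. frechet_derivative \<phi> (at x) i)"
    and der: "\<And>x. (\<phi> has_derivative frechet_derivative \<phi> (at x)) (at x)"
    and B: "\<And>x. \<bar>\<phi> x\<bar> \<le> B" "\<And>x. \<bar>frechet_derivative \<phi> (at x) i\<bar> \<le> B"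
    and lip: "\<And>x t. 0 \<le> t \<Longrightarrow> \<bar>\<phi> (x + t *\<^sub>R i) - \<phi> x\<bar> \<le> B * t"
    by (rule test_functionD) blast
  define d where "d x = frechet_derivative \<phi> (at x) i" for x
  have [measurable]: "\<phi> \<in> borel_measurable borel" "d \<in> borel_measurable borel"
    unfolding d_def using cont by (auto intro: borel_measurable_continuous_onI)
  have B0: "0 \<le> B" and M0: "0 \<le> M"
    using B(1)[of 0] M(1)[of 0] by linarith+
  have L0: "0 \<le> L"
    using L by (rule lipschitz_on_nonneg)
  have clS: "closed S"
    using S by (simp add: compact_imp_closed)
  define \<psi> where "\<psi> x = u x * \<phi> x" for x
  define f where "f x = u x * d x + (v x \<bullet> i) * \<phi> x" for x
  define h where "h n = inverse (real (Suc n))" for n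
  have h: "0 < h n" "h n \<le> 1" for n
    by (auto simp: h_def inverse_le_1_iff)
  define s where "s n x = (\<psi> (x + h n *\<^sub>R i) - \<psi> x) / h n" for n x
  have [measurable]: "\<psi> \<in> borel_measurable borel" "f \<in> borel_measurable borel"
    unfolding \<psi>_def f_def by measurable
  have [measurable]: "s n \<in> borel_measurable borel" for n
    unfolding s_def by measurable
  obtain R where R: "\<And>x. x \<in> S \<Longrightarrow> norm x \<le> R"
    using S compact_imp_bounded bounded_iff by metis
  \<comment> \<open>The step \<open>h n\<close> is at most \<open>1\<close>, so the radius
    \<open>R + 1\<close> accommodates the support of the shifted function.\<close>
  define w where "w x = (M * B + B * L) * indicat_real (cball 0 (R + 1)) x" for x :: 'a
  have "integrable lebesgue w"
    unfolding w_def using emeasure_lborel_cball_finite[of "0::'a" "R + 1"]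
    by (intro integrable_mult_right integrable_real_indicator) auto
  moreover have "norm (s n x) \<le> w x" for n x
  proof (cases "x \<in> cball 0 (R + 1)")
    case True
    have "\<psi> (x + h n *\<^sub>R i) - \<psi> x =
        u (x + h n *\<^sub>R i) * (\<phi> (x + h n *\<^sub>R i) - \<phi> x) + \<phi> x * (u (x + h n *\<^sub>R i) - u x)"
      by (simp add: \<psi>_def algebra_simps)
    also have "\<bar>\<dots>\<bar> \<le> M * (B * h n) + B * (L * h n)"
    proof (rule order_trans[OF abs_triangle_ineq add_mono])
      show "\<bar>u (x + h n *\<^sub>R i) * (\<phi> (x + h n *\<^sub>R i) - \<phi> x)\<bar> \<le> M * (B * h n)"
        unfolding abs_mult using M(1) lip[OF less_imp_le[OF h(1)]] M0 by (intro mult_mono) auto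
      have "\<bar>u (x + h n *\<^sub>R i) - u x\<bar> \<le> L * h n"
        using lipschitz_onD[OF L, of "x + h n *\<^sub>R i" x] i h[of n]
        by (simp add: dist_norm)
      then show "\<bar>\<phi> x * (u (x + h n *\<^sub>R i) - u x)\<bar> \<le> B * (L * h n)"
        unfolding abs_mult using B B0 by (intro mult_mono) auto
    qed
    also have "\<dots> = (M * B + B * L) * h n"
      by (simp add: algebra_simps)
    finally show ?thesis
      using h[of n] True by (simp add: s_def w_def pos_divide_le_eq)
  next
    case False
    then have nx: "norm x > R + 1" by simp
    have "norm (x + h n *\<^sub>R i) \<ge> norm x - norm (h n *\<^sub>R i)"
      by (rule norm_diff_ineq)
    moreover have "norm (h n *\<^sub>R i) \<le> 1"
      using h[of n] i by simp
    ultimately have "norm (x + h n *\<^sub>R i) > R"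
      using nx by linarith
    then have "x + h n *\<^sub>R i \<notin> S" "x \<notin> S"
      using R[of "x + h n *\<^sub>R i"] R[of x] nx by auto
    then show ?thesis
      using out False by (simp add: s_def \<psi>_def w_def)
  qed
  moreover have "AE x in lebesgue. (\<lambda>n. s n x) \<longlonglongrightarrow> f x"
  proof -
    have "AE x in lebesgue. x \<notin> N"
      using N by (simp add: negligible_iff_null_sets AE_not_in)
    then show ?thesis
    proof (rule AE_mp, intro AE_I2 impI)
      fix x :: 'a assume xN: "x \<notin> N"
      have "((\<lambda>t. \<psi> (x + t *\<^sub>R i)) has_real_derivative f x) (at 0)"
      \<comment> \<open>\<open>deriv\<close> speaks only of points of \<open>G\<close>; off the
        support of \<phi> the product is locally \<open>0\<close> whatever \<open>u\<close>
        does.\<close>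
      proof (cases "x \<in> S")
        case True
        have "(\<psi> has_derivative (\<lambda>h. u x * frechet_derivative \<phi> (at x) h + (v x \<bullet> h) * \<phi> x)) (at x)"
          unfolding \<psi>_def using True S xN by (intro has_derivative_mult deriv der) auto
        then show ?thesis
          using has_derivative_imp_line_derivative[of \<psi> _ x 0 i] by (simp add: f_def d_def)
      next
        case False
        then have "(\<psi> has_derivative (\<lambda>h. 0)) (at x)"
          using clS out by (intro zero_has_derivative_outside_support) (auto simp: \<psi>_def)
        then show ?thesis
          using has_derivative_imp_line_derivative[of \<psi> _ x 0 i] False out
          by (simp add: f_def d_def)
      qed
      then have "((\<lambda>h. (\<psi> (x + h *\<^sub>R i) - \<psi> x) / h) \<longlongrightarrow> f x) (at 0)"
        using DERIV_D by fastforce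
      moreover have "filterlim h (at 0) sequentially"
        using LIMSEQ_inverse_real_of_nat h
        by (auto simp: filterlim_at h_def[abs_def] intro!: always_eventually)
      ultimately show "(\<lambda>n. s n x) \<longlonglongrightarrow> f x"
        unfolding s_def by (rule filterlim_compose)
    qed
  qed
  ultimately have lim: "(\<lambda>n. LINT x|lebesgue. s n x) \<longlonglongrightarrow> (LINT x|lebesgue. f x)"
    by (intro integral_dominated_convergence[where w=w]) (auto intro!: measurable_completion)
  have supp_int: "integrable lborel g" "integrable lebesgue g"
    if [measurable]: "g \<in> borel_measurable borel" and "\<And>x. x \<notin> S \<Longrightarrow> g x = 0" "\<And>x. \<bar>g x\<bar> \<le> C"
    for g :: "'a \<Rightarrow> real" and C
  proof -
    have "g absolutely_integrable_on S"
      using that S by (intro bounded_borel_absolutely_integrable_on[of g C] lmeasurable_compact) auto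
    moreover have "(\<lambda>x. indicat_real S x *\<^sub>R g x) = g"
      using that(2) by (auto simp: indicator_def fun_eq_iff)
    ultimately show "integrable lebesgue g"
      by (simp add: set_integrable_def)
    then show "integrable lborel g"
      by (simp add: integrable_completion)
  qed
  have int\<psi>: "integrable lborel \<psi>"
    using M(1) B(1) M0 out by (intro supp_int(1)[of _ "M * B"]) (auto simp: \<psi>_def abs_mult intro!: mult_mono)
  have "(LINT x|lebesgue. s n x) = 0" for n
  proof -
    have "(LINT x|lebesgue. s n x) = (LINT x|lborel. s n x)"
      by (rule integral_completion) simp
    also have "\<dots> = 0"
      unfolding s_def using lborel_translate[OF _ int\<psi>, of "h n *\<^sub>R i"] int\<psi> by simp
    finally show ?thesis .
  qed
  then have f0: "(LINT x|lebesgue. f x) = 0"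
    using lim by (simp add: LIMSEQ_const_iff)
  have i1: "integrable lebesgue (\<lambda>x. u x * d x)"
  proof (rule supp_int(2)[of _ "M * B"])
    show "\<bar>u x * d x\<bar> \<le> M * B" for x
      unfolding abs_mult d_def using M(1) B(2) M0 by (intro mult_mono) auto
    show "(\<lambda>x. u x * d x) \<in> borel_measurable borel"
      by measurable
  qed (use out in \<open>auto simp: d_def\<close>)
  have i2: "integrable lebesgue (\<lambda>x. (v x \<bullet> i) * \<phi> x)"
  proof (rule supp_int(2)[of _ "M * B"])
    fix x
    have "\<bar>v x \<bullet> i\<bar> \<le> M"
      using Basis_le_norm[OF i, of "v x"] M(2)[of x] by linarith
    then show "\<bar>(v x \<bullet> i) * \<phi> x\<bar> \<le> M * B"
      unfolding abs_mult using B(1) M0 by (intro mult_mono) auto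
  qed (use out in auto)
  have restr: "(LINT x|lebesgue_on G. g x) = (LINT x|lebesgue. g x)"
    if "\<And>x. x \<notin> S \<Longrightarrow> g x = 0" for g :: "'a \<Rightarrow> real"
  proof -
    have "(LINT x|lebesgue_on G. g x) = (LINT x:G|lebesgue. g x)"
      using G by (simp add: integral_restrict_space set_lebesgue_integral_def)
    also have "\<dots> = (LINT x|lebesgue. g x)"
      unfolding set_lebesgue_integral_def using that S
      by (intro Bochner_Integration.integral_cong) (auto simp: indicator_def)
    finally show ?thesis .
  qed
  have "(LINT x|lebesgue. u x * d x) + (LINT x|lebesgue. (v x \<bullet> i) * \<phi> x) = 0"
    using f0 Bochner_Integration.integral_add[OF i1 i2] by (simp add: f_def)
  then show "(LINT x|lebesgue_on G. u x * frechet_derivative \<phi> (at x) i) =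
      - (LINT x|lebesgue_on G. (v x \<bullet> i) * \<phi> x)"
    using restr[of "\<lambda>x. u x * d x"] restr[of "\<lambda>x. (v x \<bullet> i) * \<phi> x"] out by (simp add: d_def)
qed


subsection \<open>A Cantor set\<close>

text \<open>\<open>cantor_left \<rho> n\<close> are the left endpoints of the \<open>2 ^ n\<close> intervals of length \<open>\<rho> ^ n\<close>
  at stage \<open>n\<close>.\<close>

primrec cantor_left :: "real \<Rightarrow> nat \<Rightarrow> real set" where
  "cantor_left \<rho> 0 = {0}"
| "cantor_left \<rho> (Suc n) = cantor_left \<rho> n \<union> (\<lambda>a. a + (1 - \<rho>) * \<rho> ^ n) ` cantor_left \<rho> n"

definition cantor_level :: "real \<Rightarrow> nat \<Rightarrow> real set" where
  "cantor_level \<rho> n = (\<Union>a\<in>cantor_left \<rho> n. {a..a + \<rho> ^ n})"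

definition cantor_set :: "real \<Rightarrow> real set" where
  "cantor_set \<rho> = (\<Inter>n. cantor_level \<rho> n)"

text \<open>For a planar dust of dimension \<lambda>, where
  \<open>\<rho> powr \<lambda> = 1 / 4\<close>, the bounds mean \<open>1 \<le> \<lambda>\<close> and
  \<open>\<lambda> < 2\<close>.\<close>

locale cantor_ratio =
  fixes \<rho> :: real
  assumes ratio: "1 / 4 \<le> \<rho>" "\<rho> < 1 / 2"
begin

lemma ratio_pos: "0 < \<rho>" "0 < \<rho> ^ n" "\<rho> ^ n \<le> 1"
  using ratio by (auto intro: power_le_one)

lemma finite_cantor_left: "finite (cantor_left \<rho> n)"
  by (induction n) auto

lemma cantor_left_bounds: "a \<in> cantor_left \<rho> n \<Longrightarrow> 0 \<le> a \<and> a + \<rho> ^ n \<le> 1"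
proof (induction n arbitrary: a)
  case (Suc n)
  have eq: "(1 - \<rho>) * \<rho> ^ n = \<rho> ^ n - \<rho> ^ Suc n" and le: "\<rho> ^ Suc n \<le> \<rho> ^ n"
    using ratio by (auto simp: algebra_simps)
  obtain b where "b \<in> cantor_left \<rho> n" "a = b \<or> a = b + (\<rho> ^ n - \<rho> ^ Suc n)"
    using Suc.prems by (auto simp: eq simp del: power_Suc)
  then show ?case
    using Suc.IH[of b] le by auto
qed auto

text \<open>Siblings differ by \<open>(1 - \<rho>) * \<rho> ^ n\<close>, which is at least
  \<open>\<rho> ^ Suc n\<close> because \<open>\<rho> < 1 / 2\<close>. Otherwise the parents are at
  least \<open>\<rho> ^ n\<close> apart, and the offsets of the children reduce this by at most
  \<open>(1 - \<rho>) * \<rho> ^ n\<close>.\<close>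

lemma cantor_left_separated:
  "a \<in> cantor_left \<rho> n \<Longrightarrow> b \<in> cantor_left \<rho> n \<Longrightarrow> a \<noteq> b \<Longrightarrow> \<rho> ^ n \<le> \<bar>a - b\<bar>"
proof (induction n arbitrary: a b)
  case (Suc n)
  obtain a' b' s t where ab: "a' \<in> cantor_left \<rho> n" "b' \<in> cantor_left \<rho> n"
    "a = a' + s * ((1 - \<rho>) * \<rho> ^ n)" "b = b' + t * ((1 - \<rho>) * \<rho> ^ n)"
    and st: "s \<in> {0, 1}" "t \<in> {0, 1}"
  proof -
    have "\<exists>a'\<in>cantor_left \<rho> n. \<exists>s\<in>{0, 1}. a = a' + s * ((1 - \<rho>) * \<rho> ^ n)"
      using Suc.prems(1) by force
    moreover have "\<exists>b'\<in>cantor_left \<rho> n. \<exists>t\<in>{0, 1}. b = b' + t * ((1 - \<rho>) * \<rho> ^ n)"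
      using Suc.prems(2) by force
    ultimately show thesis using that by blast
  qed
  define e where "e = \<rho> ^ n"
  have e: "0 < e" using ratio_pos by (simp add: e_def)
  have r: "\<rho> * e \<le> (1 - \<rho>) * e"
    using ratio e by (intro mult_right_mono) auto
  have eq: "(1 - \<rho>) * e = e - \<rho> * e" "\<rho> ^ Suc n = \<rho> * e"
    by (auto simp: algebra_simps e_def)
  show ?case
  proof (cases "a' = b'")
    case True
    then show ?thesis
      using Suc.prems(3) ab st r unfolding eq(2) e_def[symmetric] by auto
  next
    case False
    then have "e \<le> \<bar>a' - b'\<bar>"
      using Suc.IH ab by (simp add: e_def)
    moreover have "\<bar>s * ((1 - \<rho>) * e) - t * ((1 - \<rho>) * e)\<bar> \<le> (1 - \<rho>) * e"
      using st e ratio by auto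
    ultimately show ?thesis
      unfolding ab eq(2) e_def[symmetric] using eq(1) by linarith
  qed
qed auto

lemma card_cantor_left: "card (cantor_left \<rho> n) = 2 ^ n"
proof (induction n)
  case (Suc n)
  \<comment> \<open>The shift lies strictly between \<open>0\<close> and \<open>\<rho> ^ n\<close>,
    the separation at stage \<open>n\<close>, so no shifted endpoint is an old one.\<close>
  have "a \<noteq> b + (1 - \<rho>) * \<rho> ^ n" if "a \<in> cantor_left \<rho> n" "b \<in> cantor_left \<rho> n" for a b
  proof
    assume eq: "a = b + (1 - \<rho>) * \<rho> ^ n"
    have "(1 - \<rho>) * \<rho> ^ n > 0" "(1 - \<rho>) * \<rho> ^ n < \<rho> ^ n"
      using ratio ratio_pos(2,3)[of n] by auto
    moreover from this have "\<rho> ^ n \<le> \<bar>a - b\<bar>"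
      using eq by (intro cantor_left_separated[OF that]) linarith
    ultimately show False
      using eq by linarith
  qed
  then have "cantor_left \<rho> n \<inter> (\<lambda>a. a + (1 - \<rho>) * \<rho> ^ n) ` cantor_left \<rho> n = {}"
    by blast
  then show ?case
    using Suc by (simp add: card_Un_disjoint finite_cantor_left card_image)
qed simp

lemma cantor_level_Suc_subset: "cantor_level \<rho> (Suc n) \<subseteq> cantor_level \<rho> n"
proof
  fix t assume "t \<in> cantor_level \<rho> (Suc n)"
  then obtain a where a: "a \<in> cantor_left \<rho> n"
    "t \<in> {a..a + \<rho> ^ Suc n} \<or> t \<in> {a + (1 - \<rho>) * \<rho> ^ n..a + (1 - \<rho>) * \<rho> ^ n + \<rho> ^ Suc n}"
    by (auto simp: cantor_level_def)
  have "(1 - \<rho>) * \<rho> ^ n = \<rho> ^ n - \<rho> ^ Suc n" "\<rho> ^ Suc n \<le> \<rho> ^ n"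
    using ratio by (auto simp: algebra_simps)
  then have "t \<in> {a..a + \<rho> ^ n}"
    using a(2) by auto
  then show "t \<in> cantor_level \<rho> n"
    using a(1) by (auto simp: cantor_level_def)
qed

lemma cantor_left_mono: "m \<le> n \<Longrightarrow> cantor_left \<rho> m \<subseteq> cantor_left \<rho> n"
  by (rule lift_Suc_mono_le[of "cantor_left \<rho>"]) auto

lemma cantor_left_in_level: "a \<in> cantor_left \<rho> n \<Longrightarrow> a \<in> cantor_level \<rho> n"
  using ratio_pos by (force simp: cantor_level_def)

lemma cantor_left_in_set:
  assumes "a \<in> cantor_left \<rho> n" shows "a \<in> cantor_set \<rho>"
  unfolding cantor_set_def
proof
  fix m
  have "a \<in> cantor_level \<rho> (max m n)"
    using assms cantor_left_mono[of n "max m n"] cantor_left_in_level by auto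
  moreover have "cantor_level \<rho> (max m n) \<subseteq> cantor_level \<rho> m"
    by (rule lift_Suc_antimono_le[of "cantor_level \<rho>"]) (auto simp: cantor_level_Suc_subset)
  ultimately show "a \<in> cantor_level \<rho> m" by blast
qed

lemma cantor_set_level: "t \<in> cantor_set \<rho> \<Longrightarrow> t \<in> cantor_level \<rho> n"
  by (auto simp: cantor_set_def)

lemma closed_cantor_set: "closed (cantor_set \<rho>)"
  unfolding cantor_set_def cantor_level_def using finite_cantor_left by auto

lemma cantor_level_0: "cantor_level \<rho> 0 = {0..1}"
  by (simp add: cantor_level_def)

text \<open>The proportion of an interval that each stage removes. It tends to \<open>0\<close> as
  the dimension approaches \<open>2\<close>, and the costs in the square grow like its
  inverse.\<close>

definition \<sigma> :: real where "\<sigma> = 1 - 2 * \<rho>"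
definition gap :: "nat \<Rightarrow> real" where "gap n = \<sigma> * \<rho> ^ n"

lemma gap_pos: "0 < gap n" "gap n \<le> \<rho> ^ n" "gap (Suc n) = \<rho> * gap n"
  using ratio ratio_pos(2,3)[of n] by (auto simp: gap_def \<sigma>_def mult_le_cancel_right1)

text \<open>The midpoint of a stage \<open>n\<close> interval is the centre of the gap that stage
  \<open>Suc n\<close> opens there, so points of the Cantor set in this interval are at least half a
  gap away. Those in other intervals are even further away, by separation.\<close>

lemma cantor_midpoint_far:
  assumes b: "b \<in> cantor_left \<rho> n" and c: "c \<in> cantor_set \<rho>"
  shows "gap n / 2 \<le> \<bar>(b + \<rho> ^ n / 2) - c\<bar>"
proof -
  obtain a where a: "a \<in> cantor_left \<rho> n"
    "c \<in> {a..a + \<rho> ^ Suc n} \<or> c \<in> {a + (1 - \<rho>) * \<rho> ^ n..a + (1 - \<rho>) * \<rho> ^ n + \<rho> ^ Suc n}"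
    using cantor_set_level[OF c, of "Suc n"] by (auto simp: cantor_level_def)
  define e where "e = \<rho> ^ n"
  have e: "0 < e" "\<rho> * e > 0" "\<rho> * e < e / 2"
    using ratio_pos ratio by (auto simp: e_def)
  have g: "gap n = e - 2 * (\<rho> * e)" "(1 - \<rho>) * \<rho> ^ n = e - \<rho> * e" "\<rho> ^ Suc n = \<rho> * e"
    by (auto simp: gap_def \<sigma>_def e_def algebra_simps)
  note a' = a(2)[unfolded g, simplified]
  show ?thesis
  proof (cases "a = b")
    case True
    then show ?thesis
      unfolding g(1) e_def[symmetric] using a' e by (auto simp: abs_if)
  next
    case False
    then have "e \<le> \<bar>a - b\<bar>"
      using cantor_left_separated[OF a(1) b] by (simp add: e_def)
    then show ?thesis
      unfolding g(1) e_def[symmetric] using a' e by (auto simp: abs_if split: if_splits)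
  qed
qed

lemma cantor_level_gap:
  assumes "t \<in> cantor_level \<rho> n" "t \<notin> cantor_level \<rho> (Suc n)"
    and b: "b \<in> cantor_left \<rho> n" "t \<in> {b..b + \<rho> ^ n}"
  shows "\<bar>t - (b + \<rho> ^ n / 2)\<bar> < gap n / 2"
proof -
  have "t \<notin> {b..b + \<rho> ^ Suc n}" "t \<notin> {b + (1 - \<rho>) * \<rho> ^ n..b + (1 - \<rho>) * \<rho> ^ n + \<rho> ^ Suc n}"
    using assms by (auto simp: cantor_level_def)
  moreover define e where "e = \<rho> ^ n"
  have g: "gap n = e - 2 * (\<rho> * e)" "(1 - \<rho>) * \<rho> ^ n = e - \<rho> * e" "\<rho> ^ Suc n = \<rho> * e"
    by (auto simp: gap_def \<sigma>_def e_def algebra_simps)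
  ultimately show ?thesis
    using b(2) unfolding g e_def[symmetric] by (auto simp: abs_if)
qed

end


subsection \<open>The domain\<close>

abbreviation pt :: "real \<Rightarrow> real \<Rightarrow> real ^ 2" where
  "pt s t \<equiv> vector [s, t]"

lemma ball_component: "y \<in> ball z \<delta> \<Longrightarrow> \<bar>y $ k - z $ k\<bar> < \<delta>"
  using dist_vec_nth_le[of y k z] by (simp add: dist_real_def dist_commute)

lemma dist_le_l1: "dist x y \<le> \<bar>x $ 1 - y $ 1\<bar> + \<bar>x $ 2 - y $ 2\<bar>" for x y :: "real ^ 2"
  using norm_le_l1_cart[of "x - y"] by (simp add: dist_norm sum_2)

lemma dist_pt_vertical: "dist (pt a s) (pt a t) = \<bar>s - t\<bar>"
  by (simp add: dist_norm norm_vec_def L2_set_def sum_2)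

lemma dist_pt_horizontal: "dist (pt s a) (pt t a) = \<bar>s - t\<bar>"
  by (simp add: dist_norm norm_vec_def L2_set_def sum_2)

lemma closed_segment_component:
  fixes z :: "real ^ 'n"
  assumes "z \<in> closed_segment p q" "p $ k \<in> {lo..hi}" "q $ k \<in> {lo..hi}"
  shows "z $ k \<in> {lo..hi}"
proof -
  obtain u where u: "0 \<le> u" "u \<le> 1" "z = (1 - u) *\<^sub>R p + u *\<^sub>R q"
    using assms(1) by (auto simp: in_segment)
  have "(1 - u) *\<^sub>R (p $ k) + u *\<^sub>R (q $ k) \<in> {lo..hi}"
    using u assms by (intro convexD convex_real_interval) auto
  then show ?thesis
    by (simp add: u(3))
qed

text \<open>\<alpha> stands for \<open>1 / \<beta>\<close>. Chains in the square cost
  \<open>10 / \<sigma>\<close> times the logarithm; the assumption keeps this within the rate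
  \<open>2 * \<alpha>\<close> spent by the rooms.\<close>

locale rooms = cantor_ratio +
  fixes \<alpha> :: real
  assumes exponent: "5 / \<sigma> \<le> \<alpha>"
begin

text \<open>The factor \<open>\<sigma> / 16\<close> keeps every column inside the empty middle strip
  \<open>\<bar>t - 1 / 2\<bar> < \<sigma> / 2\<close>. Centres at distance \<open>4 * r j\<close>
  from the middle and sizes that halve keep the columns apart, even when one of them is widened to
  twice the width of its room.\<close>

definition r :: "nat \<Rightarrow> real" where "r j = \<sigma> / 16 * (1 / 2) ^ j"
definition xc :: "nat \<Rightarrow> real" where "xc j = 1 / 2 + 4 * r j"
definition w :: "nat \<Rightarrow> real" where "w j = r j powr \<alpha>"

definition Q :: "(real ^ 2) set" where "Q = {x. \<forall>k. 0 < x $ k \<and> x $ k < 1}"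
definition K :: "(real ^ 2) set" where "K = {x. \<forall>k. x $ k \<in> cantor_set \<rho>}"
text \<open>The shaft reaches \<open>r j\<close> down into the square and up to the ceiling of the
  room. These overlaps make the union open across both ends of the neck.\<close>

definition S :: "nat \<Rightarrow> (real ^ 2) set" where
  "S j = {x. \<bar>x $ 1 - xc j\<bar> < w j / 2 \<and> 1 - r j < x $ 2 \<and> x $ 2 < 1 + w j + r j}"
definition R :: "nat \<Rightarrow> (real ^ 2) set" where
  "R j = {x. \<bar>x $ 1 - xc j\<bar> < r j / 2 \<and> 1 + w j < x $ 2 \<and> x $ 2 < 1 + w j + r j}"

text \<open>A square without a Cantor dust, with a room \<open>R j\<close> of size \<open>r j\<close> attached to its top side through
  a neck of width \<open>w j\<close>, for each \<open>j\<close>. The neck is the part of the shaft \<open>S j\<close> outside the square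
  and the room.\<close>

definition G :: "(real ^ 2) set" where "G = (Q - K) \<union> (\<Union>j. S j \<union> R j)"

lemma \<sigma>: "0 < \<sigma>" "\<sigma> \<le> 1 / 2" "10 \<le> \<alpha>" "10 / \<sigma> \<le> 2 * \<alpha>"
proof -
  show s: "0 < \<sigma>" "\<sigma> \<le> 1 / 2"
    using ratio by (auto simp: \<sigma>_def)
  have "10 \<le> 5 / \<sigma>"
    using s by (simp add: pos_le_divide_eq)
  then show "10 \<le> \<alpha>" "10 / \<sigma> \<le> 2 * \<alpha>"
    using exponent by auto
qed

lemma r: "0 < r j" "r j \<le> \<sigma> / 16" "r j \<le> 1 / 32" "r (Suc j) = r j / 2"
proof -
  show *: "0 < r j" "r (Suc j) = r j / 2"
    using \<sigma> by (auto simp: r_def)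
  have "(1 / 2 :: real) ^ j \<le> 1"
    by (intro power_le_one) auto
  then show "r j \<le> \<sigma> / 16"
    using \<sigma> mult_left_mono[of "(1 / 2) ^ j" 1 "\<sigma> / 16"] by (auto simp: r_def)
  then show "r j \<le> 1 / 32"
    using \<sigma>(2) by linarith
qed

lemma w: "0 < w j" "w j \<le> r j / 32"
proof -
  show "0 < w j"
    using r[of j] by (simp add: w_def)
  have "w j \<le> r j powr 2"
    unfolding w_def using \<sigma> r[of j] by (intro powr_mono') auto
  also have "\<dots> = r j * r j"
    using r[of j] by (simp add: power2_eq_square)
  also have "\<dots> \<le> r j * (1 / 32)"
    using r[of j] by (intro mult_left_mono) auto
  finally show "w j \<le> r j / 32" by simp
qed

lemma r_decreasing: "i < j \<Longrightarrow> r j \<le> r i / 2"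
proof (induction j)
  case (Suc j)
  then show ?case
    using r[of j] r[of i] by (cases "i = j") auto
qed simp

lemma log_w: "log 2 (1 / w j) = \<alpha> * log 2 (1 / r j)"
  using r[of j] by (simp add: w_def log_divide log_powr)

text \<open>The conclusion has \<open>r j\<close> in place of \<open>r j / 2\<close> because the
  cutoff in the test function \<open>u j\<close> vanishes only from distance \<open>r j\<close>
  on.\<close>

lemma columns_disjoint:
  assumes "i \<noteq> j" "\<bar>t - xc i\<bar> < r i / 2"
  shows "r j < \<bar>t - xc j\<bar>"
proof (cases "i < j")
  case True
  then show ?thesis
    using r_decreasing[of i j] r[of i] r[of j] assms(2) unfolding xc_def by linarith
next
  case False
  then show ?thesis
    using r_decreasing[of j i] r[of i] r[of j] assms unfolding xc_def by linarith
qed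

lemma near_half_not_cantor: "\<bar>t - 1 / 2\<bar> < \<sigma> / 2 \<Longrightarrow> t \<notin> cantor_set \<rho>"
  using cantor_midpoint_far[of 0 0 t] abs_minus_commute[of t "1 / 2"] by (auto simp: gap_def)

lemma column_near_half: "\<bar>t - xc j\<bar> \<le> r j \<Longrightarrow> \<bar>t - 1 / 2\<bar> < \<sigma> / 2"
  using r[of j] \<sigma> unfolding xc_def by linarith

lemma in_column:
  assumes "x \<in> S j \<union> R j"
  shows "\<bar>x $ 1 - xc j\<bar> < r j / 2" "1 - r j < x $ 2" "x $ 2 < 1 + 2 * r j"
  using assms w[of j] r[of j] by (auto simp: S_def R_def)

lemma K_disjoint_G: "x \<in> K \<Longrightarrow> x \<notin> G"
proof
  assume x: "x \<in> K" "x \<in> G"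
  then obtain j where "x \<in> S j \<union> R j"
    by (auto simp: G_def)
  then have "\<bar>x $ 1 - xc j\<bar> \<le> r j"
    using in_column(1)[of x j] r[of j] by simp
  then show False
    using near_half_not_cantor[OF column_near_half] x by (auto simp: K_def)
qed

lemma closed_K: "closed K"
proof -
  have "closed ((\<lambda>x. x $ k) -` cantor_set \<rho>)" for k :: 2
    by (intro continuous_closed_vimage closed_cantor_set continuous_intros)
  moreover have "K = (\<Inter>k. (\<lambda>x. x $ k) -` cantor_set \<rho>)"
    by (auto simp: K_def)
  ultimately show ?thesis by auto
qed

lemma open_parts: "open Q" "open (S j)" "open (R j)"
proof -
  have *: "Q = {x. 0 < x $ 1} \<inter> {x. x $ 1 < 1} \<inter> {x. 0 < x $ 2} \<inter> {x. x $ 2 < 1}"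
    "S j = {x. \<bar>x $ 1 - xc j\<bar> < w j / 2} \<inter> {x. 1 - r j < x $ 2} \<inter> {x. x $ 2 < 1 + w j + r j}"
    "R j = {x. \<bar>x $ 1 - xc j\<bar> < r j / 2} \<inter> {x. 1 + w j < x $ 2} \<inter> {x. x $ 2 < 1 + w j + r j}"
    by (auto simp: Q_def S_def R_def forall_2)
  show "open Q" "open (S j)" "open (R j)"
    unfolding * by (intro open_Int open_Collect_less continuous_intros)+
qed

lemma open_G: "open G"
  unfolding G_def using open_parts closed_K by (auto intro!: open_Un open_Diff open_UN)

lemma G_bounds: "x \<in> G \<Longrightarrow> 0 < x $ 1 \<and> x $ 1 < 1 \<and> 0 < x $ 2 \<and> x $ 2 < 2"
proof -
  assume "x \<in> G"
  then consider "x \<in> Q" | j where "x \<in> S j \<union> R j"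
    by (auto simp: G_def)
  then show ?thesis
  proof cases
    case 1
    then have "x $ 1 < 1" "x $ 2 < 1" "0 < x $ 1" "0 < x $ 2"
      by (auto simp: Q_def)
    then show ?thesis by linarith
  next
    case 2
    then show ?thesis
      using in_column[OF 2] r(1,3)[of j] unfolding xc_def by linarith
  qed
qed

lemma bounded_G: "bounded G"
proof (rule bounded_subset[OF bounded_cbox])
  show "G \<subseteq> cbox (pt 0 0) (pt 1 2)"
    using G_bounds by (auto simp: mem_box_cart forall_2 less_imp_le)
qed

lemma above_G: "x \<in> G \<Longrightarrow> 1 \<le> x $ 2 \<Longrightarrow> \<exists>j. x \<in> S j \<union> R j"
  by (auto simp: G_def Q_def forall_2)

text \<open>The walls beside a neck or a room. They bound the radius of a ball in \<open>G\<close>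
  by the local width, which makes the logarithms of \<open>r j / \<delta>\<close> and
  \<open>w j / \<delta>\<close> nonnegative.\<close>

lemma not_in_G:
  assumes "1 \<le> t" "\<bar>s - xc j\<bar> \<le> r j" "w j / 2 \<le> \<bar>s - xc j\<bar>" "t \<le> 1 + w j \<or> r j / 2 \<le> \<bar>s - xc j\<bar>"
  shows "pt s t \<notin> G"
proof
  assume "pt s t \<in> G"
  then obtain i where i: "pt s t \<in> S i \<union> R i"
    using above_G[of "pt s t"] assms by auto
  have "i = j"
    using columns_disjoint[of i j s] in_column(1)[OF i] assms by (cases "i = j") auto
  then show False
    using i assms(3,4) by (auto simp: S_def R_def)
qed

lemma ball_radius_le:
  assumes "ball x \<delta> \<subseteq> G" "y \<notin> G"
  shows "\<delta> \<le> \<bar>x $ 1 - y $ 1\<bar> + \<bar>x $ 2 - y $ 2\<bar>"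
proof -
  have "y \<notin> ball x \<delta>"
    using assms by blast
  then show ?thesis
    using dist_le_l1[of x y] by simp
qed

text \<open>Hence \<open>log 2 (1 / \<delta>) \<ge> - 1\<close>, which bounds the loss when the
  coefficient of this logarithm is enlarged.\<close>

lemma G_radius_le:
  assumes "x \<in> G" "ball x \<delta> \<subseteq> G"
  shows "\<delta> \<le> 2"
proof -
  have "pt (x $ 1) 2 \<notin> G"
    using G_bounds[of "pt (x $ 1) 2"] by auto
  from ball_radius_le[OF assms(2) this] show ?thesis
    using G_bounds[OF assms(1)] by simp
qed


subsection \<open>Chains in the square\<close>

text \<open>Since \<open>K\<close> is a product set, a single coordinate in the middle of a gap
  keeps the whole ball off the dust.\<close>

lemma ball_subset_square:
  assumes "b \<in> cantor_left \<rho> l" "z $ k = b + \<rho> ^ l / 2" "\<delta> \<le> gap l / 2"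
    "\<And>k. z $ k \<in> {\<delta>..1 - \<delta>}"
  shows "ball z \<delta> \<subseteq> G"
proof
  fix y assume y: "y \<in> ball z \<delta>"
  have "0 < y $ m \<and> y $ m < 1" for m
    using ball_component[OF y, of m] assms(4)[of m] by auto
  then have "y \<in> Q" by (auto simp: Q_def)
  moreover have "y $ k \<notin> cantor_set \<rho>"
    using cantor_midpoint_far[OF assms(1), of "y $ k"] ball_component[OF y, of k] assms(2,3)
    by (auto simp: abs_minus_commute)
  ultimately show "y \<in> G" by (auto simp: G_def K_def)
qed

text \<open>An L-shaped route: horizontally along the central gap of the child, then vertically
  along the central gap of the parent. Each leg has length at most \<open>\<rho> ^ n / 2\<close> and
  clearance \<open>\<sigma> * \<rho> ^ Suc n / 2\<close>, so it costs at most
  \<open>1 / (\<sigma> * \<rho>) \<le> 4 / \<sigma>\<close>; \<open>\<rho> \<ge> 1 / 4\<close>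
  enters here.\<close>

lemma qh_chain_parent:
  assumes "a \<in> cantor_left \<rho> (Suc n)" "b \<in> cantor_left \<rho> (Suc n)"
  obtains a' b' where "a' \<in> cantor_left \<rho> n" "b' \<in> cantor_left \<rho> n"
    "qh_chain G (pt (a + \<rho> ^ Suc n / 2) (b + \<rho> ^ Suc n / 2)) (pt (a' + \<rho> ^ n / 2) (b' + \<rho> ^ n / 2)) (8 / \<sigma>)"
proof -
  define e where "e = \<rho> ^ n"
  have e: "0 < e" "\<rho> ^ Suc n = \<rho> * e" "\<rho> * e \<le> e" "0 < \<rho> * e"
    using ratio ratio_pos by (auto simp: e_def)
  have eq: "(1 - \<rho>) * \<rho> ^ n = e - \<rho> * e"
    by (simp add: e_def algebra_simps)
  obtain a' where a': "a' \<in> cantor_left \<rho> n" "a = a' \<or> a = a' + (e - \<rho> * e)"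
    using assms(1) by (auto simp: eq)
  obtain b' where b': "b' \<in> cantor_left \<rho> n" "b = b' \<or> b = b' + (e - \<rho> * e)"
    using assms(2) by (auto simp: eq)
  define s t s' t' where st: "s = a + \<rho> * e / 2" "t = b + \<rho> * e / 2" "s' = a' + e / 2" "t' = b' + e / 2"
  have d: "\<bar>s - s'\<bar> \<le> e / 2" "\<bar>t - t'\<bar> \<le> e / 2"
    using a'(2) b'(2) e by (auto simp: st)
  define \<delta> where "\<delta> = gap (Suc n) / 2"
  have \<delta>: "0 < \<delta>" "\<delta> \<le> \<rho> * e / 2" "\<delta> \<le> gap n / 2"
    using gap_pos[of "Suc n"] gap_pos[of n] e ratio mult_right_mono[of \<rho> 1 "gap n"]
    by (auto simp: \<delta>_def)
  have mem: "s \<in> {\<delta>..1 - \<delta>}" "t \<in> {\<delta>..1 - \<delta>}" "s' \<in> {\<delta>..1 - \<delta>}" "t' \<in> {\<delta>..1 - \<delta>}"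
    using cantor_left_bounds[OF assms(1)] cantor_left_bounds[OF assms(2)]
      cantor_left_bounds[OF a'(1)] cantor_left_bounds[OF b'(1)] e \<delta>
    by (auto simp: st e_def[symmetric])
  have cost: "e / 2 / \<delta> \<le> 4 / \<sigma>"
  proof -
    have "\<delta> = (\<sigma> * \<rho>) * (e / 2)"
      by (simp add: \<delta>_def gap_def e_def)
    then have "e / 2 / \<delta> = e / 2 / ((\<sigma> * \<rho>) * (e / 2))"
      by (simp only:)
    also have "\<dots> = 1 / (\<sigma> * \<rho>)"
      using e(1) by (intro nonzero_divide_mult_cancel_right) simp
    also have "\<dots> \<le> 1 / (\<sigma> * (1 / 4))"
      using ratio \<sigma>(1) by (intro divide_left_mono mult_left_mono) auto
    finally show ?thesis by simp
  qed
  have 1: "qh_chain G (pt s t) (pt s' t) (4 / \<sigma>)"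
  proof (rule qh_chain_segment[OF \<delta>(1)])
    fix z assume z: "z \<in> closed_segment (pt s t) (pt s' t)"
    show "ball z \<delta> \<subseteq> G"
    proof (rule ball_subset_square[OF assms(2), of z 2])
      show "z $ 2 = b + \<rho> ^ Suc n / 2"
        using closed_segment_component[OF z, of 2 t t] by (simp add: st e_def)
      fix k :: 2
      show "z $ k \<in> {\<delta>..1 - \<delta>}"
        using exhaust_2[of k] mem by (intro closed_segment_component[OF z]) auto
    qed (simp add: \<delta>_def)
  next
    show "dist (pt s t) (pt s' t) / \<delta> \<le> 4 / \<sigma>"
      using d \<delta> by (intro order_trans[OF _ cost] divide_right_mono) (auto simp: dist_pt_horizontal)
  qed
  have 2: "qh_chain G (pt s' t) (pt s' t') (4 / \<sigma>)"
  proof (rule qh_chain_segment[OF \<delta>(1)])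
    fix z assume z: "z \<in> closed_segment (pt s' t) (pt s' t')"
    show "ball z \<delta> \<subseteq> G"
    proof (rule ball_subset_square[OF a'(1), of z 1])
      show "z $ 1 = a' + \<rho> ^ n / 2"
        using closed_segment_component[OF z, of 1 s' s'] by (simp add: st e_def)
      fix k :: 2
      show "z $ k \<in> {\<delta>..1 - \<delta>}"
        using exhaust_2[of k] mem by (intro closed_segment_component[OF z]) auto
    qed (use \<delta> in auto)
  next
    show "dist (pt s' t) (pt s' t') / \<delta> \<le> 4 / \<sigma>"
      using d \<delta> by (intro order_trans[OF _ cost] divide_right_mono) (auto simp: dist_pt_vertical)
  qed
  show thesis
    using that[OF a'(1) b'(1)] qh_chain_trans[OF 1 2] unfolding st e(2)[symmetric] e_def by simp
qed

abbreviation x0 :: "real ^ 2" where "x0 \<equiv> pt (1 / 2) (1 / 2)"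

lemma qh_chain_cell_centre:
  assumes "a \<in> cantor_left \<rho> n" "b \<in> cantor_left \<rho> n"
  shows "qh_chain G (pt (a + \<rho> ^ n / 2) (b + \<rho> ^ n / 2)) x0 (n * (8 / \<sigma>))"
  using assms
proof (induction n arbitrary: a b)
  case 0
  then show ?case by (auto intro: qh_chain.qh_refl)
next
  case (Suc n)
  obtain a' b' where a': "a' \<in> cantor_left \<rho> n" "b' \<in> cantor_left \<rho> n"
    "qh_chain G (pt (a + \<rho> ^ Suc n / 2) (b + \<rho> ^ Suc n / 2)) (pt (a' + \<rho> ^ n / 2) (b' + \<rho> ^ n / 2)) (8 / \<sigma>)"
    by (rule qh_chain_parent[OF Suc.prems])
  show ?case
    using qh_chain_trans[OF a'(3) Suc.IH[OF a'(1,2)]]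
    by (rule qh_chain_mono) (simp only: of_nat_Suc distrib_right mult_1 order_refl)
qed

text \<open>In the coordinate \<open>k\<close> that lies in a gap, the segment to the centre moves
  linearly away from the ends of the gap: at parameter \<open>s\<close> the clearance is at least
  \<open>s * gap n / 2\<close>, while \<open>dist x c \<le> \<rho> ^ n\<close>. This is a cone of
  opening \<open>\<sigma> / 2\<close>.\<close>

lemma qh_chain_to_cell_centre:
  assumes ab: "a \<in> cantor_left \<rho> n" "b \<in> cantor_left \<rho> n"
    and c: "c = pt (a + \<rho> ^ n / 2) (b + \<rho> ^ n / 2)"
    and x: "\<And>k. \<bar>x $ k - c $ k\<bar> \<le> \<rho> ^ n / 2" and gapk: "\<bar>x $ k - c $ k\<bar> < gap n / 2"
    and \<delta>: "0 < \<delta>" "ball x \<delta> \<subseteq> G"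
  shows "qh_chain G x c (1 + (log 2 (\<rho> ^ n / \<delta>) + 2) / (\<sigma> / 2))" "\<delta> \<le> 2 * \<rho> ^ n"
proof -
  define e where "e = \<rho> ^ n"
  have e: "0 < e" and g: "gap n = \<sigma> * e"
    using ratio_pos by (auto simp: e_def gap_def)
  have c12: "c $ 1 = a + e / 2" "c $ 2 = b + e / 2"
    by (simp_all add: c e_def)
  have x1: "\<bar>x $ 1 - (a + e / 2)\<bar> \<le> e / 2" "\<bar>x $ 2 - (b + e / 2)\<bar> \<le> e / 2"
    using x[of 1] x[of 2] by (auto simp: c e_def)
  \<comment> \<open>A corner of the cell belongs to the dust, so it bounds the radius of a ball
    around \<open>x\<close>.\<close>
  have "pt a b \<in> K"
    using ab cantor_left_in_set by (auto simp: K_def forall_2)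
  from ball_radius_le[OF \<delta>(2) K_disjoint_G[OF this]]
  have "\<delta> \<le> \<bar>x $ 1 - a\<bar> + \<bar>x $ 2 - b\<bar>"
    by simp
  then show de: "\<delta> \<le> 2 * \<rho> ^ n"
    unfolding e_def[symmetric] using x1 e by linarith
  have D: "dist x c \<le> e"
    using dist_le_l1[of x c] x[of 1] x[of 2] by (simp add: e_def)
  show "qh_chain G x c (1 + (log 2 (\<rho> ^ n / \<delta>) + 2) / (\<sigma> / 2))"
  proof (rule qh_chain_cone)
    fix s :: real assume s: "0 \<le> s" "s \<le> 1"
    have conv: "(1 - s) * t + s * t = t" for t
      by (simp flip: distrib_right)
    define z where "z = x + s *\<^sub>R (c - x)"
    have z: "\<bar>z $ m - c $ m\<bar> = (1 - s) * \<bar>x $ m - c $ m\<bar>" for m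
    proof -
      have "z $ m - c $ m = (1 - s) * (x $ m - c $ m)"
        by (simp add: z_def algebra_simps)
      then show ?thesis
        using s by (simp add: abs_mult)
    qed
    have rad: "\<sigma> / 2 * (s * dist x c) \<le> s * (gap n / 2)"
      using s D \<sigma> mult_left_mono[OF D, of "\<sigma> / 2 * s"] unfolding g by (simp add: mult_ac)
    also have "\<dots> \<le> s * (e / 2)"
      using s gap_pos(2)[of n] by (intro mult_left_mono) (auto simp: e_def)
    finally have rad2: "\<sigma> / 2 * (s * dist x c) \<le> s * (e / 2)" .
    show "ball (x + s *\<^sub>R (c - x)) (\<sigma> / 2 * (s * dist x c)) \<subseteq> G"
      unfolding z_def[symmetric]
    proof
      fix y assume y: "y \<in> ball z (\<sigma> / 2 * (s * dist x c))"
      have yc: "\<bar>y $ m - c $ m\<bar> < e / 2" for m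
      proof -
        have "(1 - s) * \<bar>x $ m - c $ m\<bar> \<le> (1 - s) * (e / 2)"
          using x[of m] s by (intro mult_left_mono) (auto simp: e_def)
        then have "\<bar>y $ m - c $ m\<bar> < (1 - s) * (e / 2) + s * (e / 2)"
          using ball_component[OF y, of m] z[of m] rad2 by linarith
        then show ?thesis by (simp only: conv)
      qed
      have "0 < y $ 1" "y $ 1 < 1" "0 < y $ 2" "y $ 2 < 1"
        using yc[of 1] yc[of 2] cantor_left_bounds[OF ab(1)] cantor_left_bounds[OF ab(2)]
        unfolding c12 e_def[symmetric] by linarith+
      then have "y \<in> Q"
        by (auto simp: Q_def forall_2)
      moreover have "y $ k \<notin> cantor_set \<rho>"
      proof
        assume "y $ k \<in> cantor_set \<rho>"
        then have "gap n / 2 \<le> \<bar>c $ k - y $ k\<bar>"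
          using exhaust_2[of k] cantor_midpoint_far ab by (auto simp: c)
        moreover have "(1 - s) * \<bar>x $ k - c $ k\<bar> \<le> (1 - s) * (gap n / 2)"
          using gapk s by (intro mult_left_mono) auto
        then have "\<bar>y $ k - c $ k\<bar> < (1 - s) * (gap n / 2) + s * (gap n / 2)"
          using ball_component[OF y, of k] z[of k] rad by linarith
        then have "\<bar>y $ k - c $ k\<bar> < gap n / 2"
          by (simp only: conv)
        ultimately show False by linarith
      qed
      ultimately show "y \<in> G" by (auto simp: G_def K_def)
    qed
  qed (use \<sigma> \<delta> D de in \<open>auto simp: e_def\<close>)
qed

text \<open>\<open>n\<close> is the last stage with a cell that contains \<open>x\<close>. One cone
  leads to the centre of that cell and \<open>n\<close> moves to parents lead to \<open>x0\<close>;
  \<open>\<delta> \<le> 2 * \<rho> ^ n\<close> bounds \<open>n\<close> by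
  \<open>1 + log 2 (1 / \<delta>)\<close>. The rate \<open>10 / \<sigma>\<close> is
  \<open>2 / \<sigma>\<close> from the cone plus \<open>8 / \<sigma>\<close> from the moves.\<close>

lemma qh_chain_square:
  assumes x: "x \<in> Q - K" and \<delta>: "0 < \<delta>" "ball x \<delta> \<subseteq> G"
  shows "qh_chain G x x0 (10 / \<sigma> * log 2 (1 / \<delta>) + (1 + 12 / \<sigma>))"
proof -
  define N where "N = (LEAST n. \<exists>k. x $ k \<notin> cantor_level \<rho> n)"
  have "\<exists>n. \<exists>k. x $ k \<notin> cantor_level \<rho> n"
    using x by (auto simp: K_def cantor_set_def)
  then have N: "\<exists>k. x $ k \<notin> cantor_level \<rho> N"
    unfolding N_def by (rule LeastI_ex)
  have minimal: "x $ m \<in> cantor_level \<rho> n" if "n < N" for m n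
    using not_less_Least[OF that[unfolded N_def]] by blast
  have "N \<noteq> 0"
    using N x by (auto simp: Q_def cantor_level_0 less_imp_le intro: gr0I)
  then obtain n where n: "N = Suc n"
    using not0_implies_Suc by blast
  obtain k where k: "x $ k \<notin> cantor_level \<rho> (Suc n)"
    using N n by auto
  have lev: "x $ m \<in> cantor_level \<rho> n" for m
    using minimal n by simp
  obtain a where a: "a \<in> cantor_left \<rho> n" "x $ 1 \<in> {a..a + \<rho> ^ n}"
    using lev[of 1] by (auto simp: cantor_level_def)
  obtain b where b: "b \<in> cantor_left \<rho> n" "x $ 2 \<in> {b..b + \<rho> ^ n}"
    using lev[of 2] by (auto simp: cantor_level_def)
  define c where "c = pt (a + \<rho> ^ n / 2) (b + \<rho> ^ n / 2)"
  have xc: "\<bar>x $ m - c $ m\<bar> \<le> \<rho> ^ n / 2" for m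
  proof -
    have "\<bar>x $ 1 - (a + \<rho> ^ n / 2)\<bar> \<le> \<rho> ^ n / 2" "\<bar>x $ 2 - (b + \<rho> ^ n / 2)\<bar> \<le> \<rho> ^ n / 2"
      using a(2) b(2) unfolding atLeastAtMost_iff by linarith+
    then show ?thesis
      using exhaust_2[of m] by (auto simp: c_def)
  qed
  have gk: "\<bar>x $ k - c $ k\<bar> < gap n / 2"
    using exhaust_2[of k] cantor_level_gap[OF lev k] a b by (auto simp: c_def)
  note cone = qh_chain_to_cell_centre[OF a(1) b(1) c_def xc gk \<delta>]
  have "qh_chain G x x0 (1 + (log 2 (\<rho> ^ n / \<delta>) + 2) / (\<sigma> / 2) + n * (8 / \<sigma>))"
    using qh_chain_trans[OF cone(1)] qh_chain_cell_centre[OF a(1) b(1)] by (simp add: c_def)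
  moreover have l1: "log 2 (\<rho> ^ n / \<delta>) \<le> log 2 (1 / \<delta>)"
    using \<delta> ratio_pos(2,3)[of n] by (subst log_le_cancel_iff) (auto intro: divide_right_mono)
  moreover have l2: "n \<le> 1 + log 2 (1 / \<delta>)"
  proof -
    have "\<rho> ^ n \<le> (1 / 2) ^ n"
      using ratio by (intro power_mono) auto
    then have "\<delta> \<le> 2 * (1 / 2) ^ n"
      using cone(2) by linarith
    then have "2 powr n \<le> 2 / \<delta>"
      using \<delta> by (simp add: powr_realpow field_simps)
    then have "n \<le> log 2 (2 / \<delta>)"
      using \<delta> by (simp add: le_log_iff)
    also have "\<dots> = 1 + log 2 (1 / \<delta>)"
      using \<delta> log_mult[of 2 "1 / \<delta>" 2] by simp
    finally show ?thesis .
  qed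
  ultimately show ?thesis
  proof (elim qh_chain_mono)
    define l where "l = log 2 (1 / \<delta>)"
    have "(log 2 (\<rho> ^ n / \<delta>) + 2) / (\<sigma> / 2) \<le> (l + 2) / (\<sigma> / 2)"
      using l1 \<sigma> by (intro divide_right_mono) (auto simp: l_def)
    moreover have "n * (8 / \<sigma>) \<le> (1 + l) * (8 / \<sigma>)"
      using l2 \<sigma> by (intro mult_right_mono) (auto simp: l_def)
    moreover have "(l + 2) / (\<sigma> / 2) + (1 + l) * (8 / \<sigma>) = 10 / \<sigma> * l + 12 / \<sigma>"
      using \<sigma>(1) by (simp add: field_simps)
    ultimately show "1 + (log 2 (\<rho> ^ n / \<delta>) + 2) / (\<sigma> / 2) + n * (8 / \<sigma>) \<le>
        10 / \<sigma> * log 2 (1 / \<delta>) + (1 + 12 / \<sigma>)"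
      unfolding l_def[symmetric] by linarith
  qed
qed

end


subsection \<open>Chains in the rooms and the quasihyperbolic boundary condition\<close>

context rooms
begin

text \<open>The descent is a cone of opening \<open>1\<close>, available because the strip below the
  rooms contains no dust. It stops at depth \<open>\<sigma> / 8\<close>, from where a segment with
  that clearance reaches \<open>x0\<close> at cost \<open>8 / \<sigma>\<close>.\<close>

lemma qh_chain_below_neck: "qh_chain G (pt (xc j) 1) x0 (3 + log 2 (1 / w j) + 8 / \<sigma>)"
proof -
  define f where "f = pt (xc j) (1 - \<sigma> / 8)"
  have xc: "1 / 2 \<le> xc j" "xc j \<le> 1 / 2 + \<sigma> / 4"
    using r[of j] by (auto simp: xc_def)
  have free: "y \<in> G" if "\<bar>y $ 1 - 1 / 2\<bar> < \<sigma> / 2" "0 < y $ 2" "y $ 2 < 1" for y :: "real ^ 2"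
  proof -
    have "0 < y $ 1" "y $ 1 < 1"
      using that(1) \<sigma>(2) by linarith+
    then show ?thesis
      using that near_half_not_cantor[OF that(1)] by (auto simp: G_def Q_def K_def forall_2)
  qed
  have df: "dist (pt (xc j) 1) f = \<sigma> / 8"
    using \<sigma>(1) by (simp add: f_def dist_pt_vertical)
  have "qh_chain G (pt (xc j) 1) f (1 + (log 2 ((\<sigma> / 8) / (w j / 2)) + 2) / 1)"
  proof (rule qh_chain_cone)
    have "y \<in> S j" if y: "y \<in> ball (pt (xc j) 1) (w j / 2)" for y
      using ball_component[OF y, of 1] ball_component[OF y, of 2] w[of j] r(1)[of j]
      unfolding vector_2 S_def mem_Collect_eq by linarith
    then show "ball (pt (xc j) 1) (w j / 2) \<subseteq> G"
      unfolding G_def by blast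
  next
    fix s :: real assume s: "0 \<le> s" "s \<le> 1"
    define e where "e = s * (\<sigma> / 8)"
    have e: "e \<le> \<sigma> / 8"
      using s \<sigma> by (auto simp: e_def intro: mult_left_le_one_le)
    have z: "(pt (xc j) 1 + s *\<^sub>R (f - pt (xc j) 1)) $ 1 = xc j"
      "(pt (xc j) 1 + s *\<^sub>R (f - pt (xc j) 1)) $ 2 = 1 - e"
      by (auto simp: f_def e_def)
    show "ball (pt (xc j) 1 + s *\<^sub>R (f - pt (xc j) 1)) (1 * (s * dist (pt (xc j) 1) f)) \<subseteq> G"
      unfolding df mult_1 e_def[symmetric]
    proof
      fix y assume y: "y \<in> ball (pt (xc j) 1 + s *\<^sub>R (f - pt (xc j) 1)) e"
      have y12: "\<bar>y $ 1 - xc j\<bar> < e" "\<bar>y $ 2 - (1 - e)\<bar> < e"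
        using ball_component[OF y, of 1] ball_component[OF y, of 2] unfolding z by auto
      show "y \<in> G"
        by (rule free) (use y12 e xc \<sigma>(1,2) in linarith)+
    qed
  qed (use df w[of j] r[of j] \<sigma> in auto)
  moreover have "qh_chain G f x0 (8 / \<sigma>)"
  proof (rule qh_chain_segment)
    show "0 < \<sigma> / 8" using \<sigma> by simp
    fix z assume z: "z \<in> closed_segment f x0"
    have "z $ 1 \<in> {1 / 2..1 / 2 + \<sigma> / 4}" "z $ 2 \<in> {1 / 2..1 - \<sigma> / 8}"
      using xc \<sigma>(1,2) by (intro closed_segment_component[OF z]; simp add: f_def)+
    then have zb: "1 / 2 \<le> z $ 1" "z $ 1 \<le> 1 / 2 + \<sigma> / 4" "1 / 2 \<le> z $ 2" "z $ 2 \<le> 1 - \<sigma> / 8"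
      by auto
    show "ball z (\<sigma> / 8) \<subseteq> G"
    proof
      fix y assume y: "y \<in> ball z (\<sigma> / 8)"
      show "y \<in> G"
        by (rule free)
          (use ball_component[OF y, of 1] ball_component[OF y, of 2] zb \<sigma>(1,2) in linarith)+
    qed
  next
    have "\<bar>f $ 1 - x0 $ 1\<bar> + \<bar>f $ 2 - x0 $ 2\<bar> \<le> 1"
      using xc \<sigma>(1,2) unfolding f_def vector_2 by linarith
    then have "dist f x0 \<le> 1"
      using dist_le_l1[of f x0] by linarith
    then have "dist f x0 / (\<sigma> / 8) \<le> 1 / (\<sigma> / 8)"
      using \<sigma> by (intro divide_right_mono) auto
    then show "dist f x0 / (\<sigma> / 8) \<le> 8 / \<sigma>" by simp
  qed
  ultimately have "qh_chain G (pt (xc j) 1) x0 (1 + (log 2 ((\<sigma> / 8) / (w j / 2)) + 2) / 1 + 8 / \<sigma>)"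
    by (rule qh_chain_trans)
  then show ?thesis
  proof (rule qh_chain_mono)
    have "log 2 ((\<sigma> / 8) / (w j / 2)) \<le> log 2 (1 / w j)"
      using \<sigma> w[of j] by (subst log_le_cancel_iff) (auto simp: field_simps)
    then show "1 + (log 2 ((\<sigma> / 8) / (w j / 2)) + 2) / 1 + 8 / \<sigma> \<le> 3 + log 2 (1 / w j) + 8 / \<sigma>"
      by simp
  qed
qed

lemma ball_subset_shaft:
  assumes "1 \<le> t" "t \<le> 1 + w j" "\<delta> \<le> w j / 2" "z $ 1 = xc j" "z $ 2 = t"
  shows "ball z \<delta> \<subseteq> G"
proof
  fix y assume y: "y \<in> ball z \<delta>"
  have "\<bar>y $ 1 - xc j\<bar> < \<delta>" "\<bar>y $ 2 - t\<bar> < \<delta>"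
    using ball_component[OF y, of 1] ball_component[OF y, of 2] assms by auto
  then have "\<bar>y $ 1 - xc j\<bar> < w j / 2" "1 - r j < y $ 2" "y $ 2 < 1 + w j + r j"
    using assms w[of j] r(1)[of j] by linarith+
  then show "y \<in> G"
    by (auto simp: G_def S_def)
qed

text \<open>Crossing costs only the constant \<open>2\<close> because the neck is a square: length
  at most \<open>w j\<close>, clearance \<open>w j / 2\<close>. The logarithm comes from the descent
  below.\<close>

lemma qh_chain_through_neck:
  assumes "1 \<le> t" "t \<le> 1 + w j"
  shows "qh_chain G (pt (xc j) t) x0 (5 + log 2 (1 / w j) + 8 / \<sigma>)"
proof -
  have "qh_chain G (pt (xc j) t) (pt (xc j) 1) 2"
  proof (rule qh_chain_segment)
    show "0 < w j / 2" using w by simp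
    fix z assume z: "z \<in> closed_segment (pt (xc j) t) (pt (xc j) 1)"
    have "z $ 1 \<in> {xc j..xc j}" "z $ 2 \<in> {1..1 + w j}"
      using assms w[of j] by (intro closed_segment_component[OF z]; simp)+
    then show "ball z (w j / 2) \<subseteq> G"
      by (intro ball_subset_shaft[of "z $ 2" j]) auto
  next
    have "\<bar>t - 1\<bar> / (w j / 2) \<le> w j / (w j / 2)"
      using assms w[of j] by (intro divide_right_mono) auto
    then show "dist (pt (xc j) t) (pt (xc j) 1) / (w j / 2) \<le> 2"
      using w[of j] by (simp add: dist_pt_vertical)
  qed
  from qh_chain_trans[OF this qh_chain_below_neck] show ?thesis
    by (rule qh_chain_mono) simp
qed

text \<open>A second cone opens from the upper end of the neck into the room. Up to constants, each
  of the two cones costs at most \<open>log 2 (1 / w j)\<close>, which is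
  \<open>\<alpha> * log 2 (1 / r j)\<close>.\<close>

lemma qh_chain_room_centre:
  "qh_chain G (pt (xc j) (1 + w j + r j / 2)) x0 (8 + 2 * log 2 (1 / w j) + 8 / \<sigma>)"
proof -
  define p where "p = pt (xc j) (1 + w j)"
  define c where "c = pt (xc j) (1 + w j + r j / 2)"
  have dc: "dist p c = r j / 2"
    using r(1)[of j] by (simp add: p_def c_def dist_pt_vertical)
  have "qh_chain G p c (1 + (log 2 ((r j / 2) / (w j / 2)) + 2) / 1)"
  proof (rule qh_chain_cone)
    show "ball p (w j / 2) \<subseteq> G"
      using w[of j] by (intro ball_subset_shaft[of "1 + w j" j]) (auto simp: p_def)
  next
    fix s :: real assume s: "0 \<le> s" "s \<le> 1"
    define e where "e = s * (r j / 2)"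
    have e: "e \<le> r j / 2"
      unfolding e_def using s r(1)[of j] by (intro mult_left_le_one_le) auto
    have z: "(p + s *\<^sub>R (c - p)) $ 1 = xc j" "(p + s *\<^sub>R (c - p)) $ 2 = 1 + w j + e"
      by (auto simp: p_def c_def e_def)
    show "ball (p + s *\<^sub>R (c - p)) (1 * (s * dist p c)) \<subseteq> G"
      unfolding dc mult_1 e_def[symmetric]
    proof
      fix y assume y: "y \<in> ball (p + s *\<^sub>R (c - p)) e"
      have "\<bar>y $ 1 - xc j\<bar> < e" "\<bar>y $ 2 - (1 + w j + e)\<bar> < e"
        using ball_component[OF y, of 1] ball_component[OF y, of 2] unfolding z by auto
      then have "\<bar>y $ 1 - xc j\<bar> < r j / 2" "1 + w j < y $ 2" "y $ 2 < 1 + w j + r j"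
        using e by linarith+
      then show "y \<in> G" by (auto simp: G_def R_def)
    qed
  qed (use dc w[of j] r[of j] in auto)
  moreover have "log 2 ((r j / 2) / (w j / 2)) \<le> log 2 (1 / w j)"
    using r[of j] w[of j] by (subst log_le_cancel_iff) (auto simp: field_simps)
  ultimately have "qh_chain G p c (3 + log 2 (1 / w j))"
    by (elim qh_chain_mono) simp
  moreover have "qh_chain G p x0 (5 + log 2 (1 / w j) + 8 / \<sigma>)"
    unfolding p_def using w[of j] by (intro qh_chain_through_neck) auto
  ultimately have "qh_chain G c x0 (3 + log 2 (1 / w j) + (5 + log 2 (1 / w j) + 8 / \<sigma>))"
    by (rule qh_chain_trans[OF qh_chain_sym])
  then show ?thesis
    unfolding c_def by (rule qh_chain_mono) simp
qed

text \<open>With \<open>l1 = log 2 (r j / \<delta>)\<close> and \<open>l2 = log 2 (1 / r j)\<close>,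
  and up to constants, the way to the centre costs \<open>2 * l1\<close> and the way out
  \<open>2 * \<alpha> * l2\<close>, while \<open>l1 + l2 = log 2 (1 / \<delta>)\<close>.\<close>

lemma qh_chain_room:
  assumes x: "x \<in> R j" and \<delta>: "0 < \<delta>" "ball x \<delta> \<subseteq> G"
  shows "qh_chain G x x0 (2 * \<alpha> * log 2 (1 / \<delta>) + (13 + 8 / \<sigma>))"
proof -
  define c where "c = pt (xc j) (1 + w j + r j / 2)"
  have x12: "\<bar>x $ 1 - xc j\<bar> < r j / 2" "\<bar>x $ 2 - (1 + w j + r j / 2)\<bar> < r j / 2"
    using x unfolding R_def mem_Collect_eq by linarith+
  have xc: "\<bar>x $ m - c $ m\<bar> < r j / 2" for m
    using exhaust_2[of m] x12 by (auto simp: c_def)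
  have D: "dist x c \<le> r j"
    using dist_le_l1[of x c] xc[of 1] xc[of 2] by linarith
  have "pt (xc j + r j / 2) (x $ 2) \<notin> G"
    using x w[of j] r(1)[of j] by (intro not_in_G[of _ _ j]) (auto simp: R_def)
  from ball_radius_le[OF \<delta>(2) this] have \<delta>r: "\<delta> \<le> r j"
    using x12 unfolding vector_2 by linarith
  have "qh_chain G x c (1 + (log 2 (r j / \<delta>) + 2) / (1 / 2))"
  proof (rule qh_chain_cone)
    fix s :: real assume s: "0 \<le> s" "s \<le> 1"
    have conv: "(1 - s) * t + s * t = t" for t
      by (simp flip: distrib_right)
    define z where "z = x + s *\<^sub>R (c - x)"
    have rad: "1 / 2 * (s * dist x c) \<le> s * (r j / 2)"
      using s D mult_left_mono[OF D, of "1 / 2 * s"] by (simp add: mult_ac)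
    show "ball (x + s *\<^sub>R (c - x)) (1 / 2 * (s * dist x c)) \<subseteq> G"
      unfolding z_def[symmetric]
    proof
      fix y assume y: "y \<in> ball z (1 / 2 * (s * dist x c))"
      have yc: "\<bar>y $ m - c $ m\<bar> < r j / 2" for m
      proof -
        have "z $ m - c $ m = (1 - s) * (x $ m - c $ m)"
          by (simp add: z_def algebra_simps)
        then have "\<bar>z $ m - c $ m\<bar> = (1 - s) * \<bar>x $ m - c $ m\<bar>"
          using s by (simp add: abs_mult)
        moreover have "(1 - s) * \<bar>x $ m - c $ m\<bar> \<le> (1 - s) * (r j / 2)"
          using xc[of m] s by (intro mult_left_mono) auto
        ultimately have "\<bar>y $ m - c $ m\<bar> < (1 - s) * (r j / 2) + s * (r j / 2)"
          using ball_component[OF y, of m] rad by linarith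
        then show ?thesis by (simp only: conv)
      qed
      have "\<bar>y $ 1 - xc j\<bar> < r j / 2" "\<bar>y $ 2 - (1 + w j + r j / 2)\<bar> < r j / 2"
        using yc[of 1] yc[of 2] by (auto simp: c_def)
      then have "\<bar>y $ 1 - xc j\<bar> < r j / 2" "1 + w j < y $ 2" "y $ 2 < 1 + w j + r j"
        by linarith+
      then show "y \<in> G" by (auto simp: G_def R_def)
    qed
  qed (use \<delta> D \<delta>r in auto)
  from qh_chain_trans[OF this[unfolded c_def] qh_chain_room_centre] show ?thesis
  proof (rule qh_chain_mono)
    define l1 l2 where l: "l1 = log 2 (r j / \<delta>)" "l2 = log 2 (1 / r j)"
    have pos: "0 \<le> l1" "0 \<le> l2"
      using \<delta> \<delta>r r[of j] by (auto simp: l)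
    have eq: "log 2 (1 / \<delta>) = l1 + l2"
      using \<delta> r[of j] log_mult[of 2 "r j / \<delta>" "1 / r j"] by (simp add: l)
    have "2 * l1 \<le> 2 * \<alpha> * l1"
      using \<sigma>(3) pos by (intro mult_right_mono) auto
    then show "1 + (log 2 (r j / \<delta>) + 2) / (1 / 2) + (8 + 2 * log 2 (1 / w j) + 8 / \<sigma>) \<le>
        2 * \<alpha> * log 2 (1 / \<delta>) + (13 + 8 / \<sigma>)"
      unfolding eq log_w l[symmetric] by (simp add: distrib_left)
  qed
qed

text \<open>A horizontal cone leads to the axis of the neck. Its logarithm
  \<open>log 2 (w j / \<delta>)\<close> and the \<open>log 2 (1 / w j)\<close> of the way down add
  up to \<open>log 2 (1 / \<delta>)\<close> with coefficient \<open>1\<close>, well within the rate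
  \<open>2 * \<alpha>\<close>.\<close>

lemma qh_chain_neck:
  assumes x: "x \<in> S j" "1 \<le> x $ 2" "x $ 2 \<le> 1 + w j" and \<delta>: "0 < \<delta>" "ball x \<delta> \<subseteq> G"
  shows "qh_chain G x x0 (2 * \<alpha> * log 2 (1 / \<delta>) + (8 + 8 / \<sigma>))"
proof -
  define c where "c = pt (xc j) (x $ 2)"
  have x1: "\<bar>x $ 1 - xc j\<bar> < w j / 2"
    using x by (auto simp: S_def)
  have xc: "x = pt (x $ 1) (x $ 2)"
    by (simp add: vec_eq_iff forall_2)
  have dc: "dist x c = \<bar>x $ 1 - xc j\<bar>"
    unfolding c_def by (subst xc) (rule dist_pt_horizontal)
  have "pt (xc j + w j / 2) (x $ 2) \<notin> G"
    using x w[of j] r(1)[of j] by (intro not_in_G[of _ _ j]) auto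
  from ball_radius_le[OF \<delta>(2) this] have \<delta>w: "\<delta> \<le> w j"
    using x1 unfolding vector_2 by linarith
  have "qh_chain G x c (1 + (log 2 ((w j / 2) / \<delta>) + 2) / 1)"
  proof (rule qh_chain_cone)
    fix s :: real assume s: "0 \<le> s" "s \<le> 1"
    have conv: "(1 - s) * t + s * t = t" for t
      by (simp flip: distrib_right)
    define d where "d = \<bar>x $ 1 - xc j\<bar>"
    define z where "z = x + s *\<^sub>R (c - x)"
    have "z $ 1 - xc j = (1 - s) * (x $ 1 - xc j)"
      by (simp add: z_def c_def algebra_simps)
    then have z: "\<bar>z $ 1 - xc j\<bar> = (1 - s) * d" "z $ 2 = x $ 2"
      using s by (simp_all add: abs_mult d_def z_def c_def)
    have sd: "s * d \<le> d"
      using s by (intro mult_left_le_one_le) (auto simp: d_def)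
    show "ball (x + s *\<^sub>R (c - x)) (1 * (s * dist x c)) \<subseteq> G"
      unfolding z_def[symmetric] dc d_def[symmetric] mult_1
    proof
      fix y assume y: "y \<in> ball z (s * d)"
      have "\<bar>y $ 1 - xc j\<bar> < (1 - s) * d + s * d"
        using ball_component[OF y, of 1] z(1) by linarith
      then have "\<bar>y $ 1 - xc j\<bar> < w j / 2"
        unfolding conv using x1 by (simp add: d_def)
      moreover have "1 - r j < y $ 2" "y $ 2 < 1 + w j + r j"
        using ball_component[OF y, of 2] z(2) sd x1[folded d_def] x(2,3) w[of j] r(1)[of j] by linarith+
      ultimately show "y \<in> G" by (auto simp: G_def S_def)
    qed
  qed (use \<delta> dc x1 \<delta>w in auto)
  from qh_chain_trans[OF this[unfolded c_def] qh_chain_through_neck[OF x(2,3)]] show ?thesis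
  proof (rule qh_chain_mono)
    define l1 l2 where l: "l1 = log 2 (w j / \<delta>)" "l2 = log 2 (1 / w j)"
    have w1: "w j \<le> 1" "0 < w j"
      using w[of j] r[of j] by linarith+
    have pos: "0 \<le> l1" "0 \<le> l2"
      using \<delta> \<delta>w w1 by (auto simp: l)
    have eq: "log 2 (1 / \<delta>) = l1 + l2"
      using \<delta> w1 log_mult[of 2 "w j / \<delta>" "1 / w j"] by (simp add: l)
    have half: "log 2 ((w j / 2) / \<delta>) \<le> l1"
      unfolding l using \<delta> w1 by (subst log_le_cancel_iff) (auto simp: field_simps)
    have "1 * (l1 + l2) \<le> 2 * \<alpha> * (l1 + l2)"
      using \<sigma>(3) pos by (intro mult_right_mono) auto
    then show "1 + (log 2 ((w j / 2) / \<delta>) + 2) / 1 + (5 + log 2 (1 / w j) + 8 / \<sigma>) \<le>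
        2 * \<alpha> * log 2 (1 / \<delta>) + (8 + 8 / \<sigma>)"
      unfolding eq l(2)[symmetric] using half by simp
  qed
qed

lemma qh_chain_to_base:
  assumes x: "x \<in> G" and \<delta>: "0 < \<delta>" "ball x \<delta> \<subseteq> G"
  shows "qh_chain G x x0 (2 * \<alpha> * log 2 (1 / \<delta>) + (13 + 12 / \<sigma> + 2 * \<alpha>))"
proof -
  have s: "8 / \<sigma> \<le> 12 / \<sigma>"
    using \<sigma> by (intro divide_right_mono) auto
  have a: "0 \<le> \<alpha>"
    using \<sigma>(3) by linarith
  consider "x \<in> Q - K" | j where "x \<in> R j" | j where "x \<in> S j" "1 \<le> x $ 2" "x $ 2 \<le> 1 + w j"
  proof -
    {
      fix j assume j: "x \<in> S j"
      have nK: "x \<notin> K" using K_disjoint_G x by blast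
      have "x \<in> Q" if "x $ 2 < 1"
      proof -
        have "0 < x $ 1" "x $ 1 < 1" "0 < x $ 2"
          using G_bounds[OF x] by auto
        then show ?thesis using that by (auto simp: Q_def forall_2)
      qed
      moreover have "x \<in> R j" if "x $ 2 > 1 + w j"
        using that j w[of j] r(1)[of j] by (auto simp: S_def R_def)
      ultimately have "x \<in> Q - K \<or> x \<in> R j \<or> x \<in> S j \<and> 1 \<le> x $ 2 \<and> x $ 2 \<le> 1 + w j"
        using j nK by (meson DiffI not_le)
    }
    then show thesis
      using x that unfolding G_def by blast
  qed
  then show ?thesis
  proof cases
    case 1
    \<comment> \<open>The rate \<open>10 / \<sigma>\<close> is raised to
      \<open>2 * \<alpha>\<close>. For \<open>\<delta> > 1\<close> the logarithm is negative, but at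
      least \<open>- 1\<close>; the summand \<open>2 * \<alpha>\<close> in the constant
      compensates.\<close>
    have "(2 * \<alpha> - 10 / \<sigma>) * (log 2 (1 / \<delta>) + 1) \<ge> 0"
    proof (rule mult_nonneg_nonneg)
      have "\<delta> \<le> 2"
        using G_radius_le[OF x \<delta>(2)] .
      then have "log 2 (1 / 2) \<le> log 2 (1 / \<delta>)"
        using \<delta> by (subst log_le_cancel_iff) (auto simp: field_simps)
      then show "0 \<le> log 2 (1 / \<delta>) + 1"
        by (simp add: log_divide)
    qed (use \<sigma>(4) in simp)
    moreover have "(2 * \<alpha> - 10 / \<sigma>) * (log 2 (1 / \<delta>) + 1) =
        2 * \<alpha> * log 2 (1 / \<delta>) - 10 / \<sigma> * log 2 (1 / \<delta>) + 2 * \<alpha> - 10 / \<sigma>"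
      by (simp add: algebra_simps)
    moreover have "0 < 10 / \<sigma>"
      using \<sigma> by simp
    ultimately have "10 / \<sigma> * log 2 (1 / \<delta>) + (1 + 12 / \<sigma>) \<le>
        2 * \<alpha> * log 2 (1 / \<delta>) + (13 + 12 / \<sigma> + 2 * \<alpha>)"
      by linarith
    then show ?thesis
      by (rule qh_chain_mono[OF qh_chain_square[OF 1 \<delta>]])
  next
    case 2
    show ?thesis
      by (rule qh_chain_mono[OF qh_chain_room[OF 2 \<delta>]]) (use s a in simp)
  next
    case 3
    show ?thesis
      by (rule qh_chain_mono[OF qh_chain_neck[OF 3 \<delta>]]) (use s a in simp)
  qed
qed

section \<open>Connectedness and the boundary condition\<close>

lemma x0_in_G: "x0 \<in> G"
  using near_half_not_cantor[of "1 / 2"] \<sigma> by (auto simp: G_def Q_def K_def forall_2)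

lemma connected_G: "connected G"
proof -
  have "path_component G x x0" if x: "x \<in> G" for x
  proof -
    obtain \<delta> where "0 < \<delta>" "ball x \<delta> \<subseteq> G"
      using open_G x open_contains_ball by blast
    from qh_chain_path_component[OF qh_chain_to_base[OF x this] x0_in_G] show ?thesis .
  qed
  then have "path_connected G"
    unfolding path_connected_component by (meson path_component_sym path_component_trans)
  then show ?thesis
    by (rule path_connected_imp_connected)
qed

lemma bounded_domain_G: "bounded_domain G"
  unfolding bounded_domain_def using open_G connected_G bounded_G x0_in_G by blast

text \<open>Natural logarithms replace base 2 at the price of the factor
  \<open>1 / ln 2 \<le> 2\<close>. This turns \<open>2 * \<alpha>\<close> into at most
  \<open>4 * \<alpha>\<close>, the inverse of the parameter in the statement;
  \<open>(4 * \<alpha> - A) * ln 2\<close> again covers negative logarithms.\<close>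

lemma quasihyperbolic_boundary_condition_G: "quasihyperbolic_boundary_condition (1 / \<alpha> / 4) G"
proof -
  have a: "0 < \<alpha>"
    using \<sigma>(3) by linarith
  define B where "B = 13 + 12 / \<sigma> + 2 * \<alpha>"
  have fr: "frontier G \<noteq> {}"
    using bounded_G x0_in_G by (intro frontier_nonempty) auto
  have l2: "1 / 2 \<le> ln (2::real)"
    using ln2_ge_two_thirds by linarith
  define A where "A = 2 * \<alpha> / ln 2"
  have A: "A \<le> 4 * \<alpha>"
    using a l2 by (simp add: A_def pos_divide_le_eq)
  have "quasihyperbolic_dist G x x0 \<le>
      1 / (1 / \<alpha> / 4) * ln (1 / infdist x (frontier G)) + (B + (4 * \<alpha> - A) * ln 2)" if x: "x \<in> G" for x
  proof -
    define \<delta> where "\<delta> = infdist x (frontier G)"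
    have "x \<notin> frontier G"
      using open_G x by (simp add: frontier_def interior_open)
    then have \<delta>: "0 < \<delta>"
      unfolding \<delta>_def using fr by (intro infdist_pos_not_in_closed) auto
    have ball: "ball x \<delta> \<subseteq> G"
    proof (rule ccontr)
      assume "\<not> ball x \<delta> \<subseteq> G"
      then have "ball x \<delta> \<inter> frontier G \<noteq> {}"
        using \<delta> x centre_in_ball[of x \<delta>] by (intro connected_Int_frontier) blast+
      then obtain y where "y \<in> frontier G" "dist x y < \<delta>"
        by auto
      then show False
        using infdist_le[of y "frontier G" x] by (simp add: \<delta>_def)
    qed
    have "quasihyperbolic_dist G x x0 \<le> 2 * \<alpha> * log 2 (1 / \<delta>) + B"
      unfolding B_def
      by (rule quasihyperbolic_dist_le_chain[OF open_G bounded_G x qh_chain_to_base[OF x \<delta> ball]])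
    also have "2 * \<alpha> * log 2 (1 / \<delta>) = A * ln (1 / \<delta>)"
      by (simp add: A_def log_def)
    also have "\<dots> \<le> 4 * \<alpha> * ln (1 / \<delta>) + (4 * \<alpha> - A) * ln 2"
    proof -
      have "ln (1 / 2) \<le> ln (1 / \<delta>)"
        using \<delta> G_radius_le[OF x ball] by (subst ln_le_cancel_iff) (auto simp: field_simps)
      then have "0 \<le> (4 * \<alpha> - A) * (ln (1 / \<delta>) + ln 2)"
        using A by (intro mult_nonneg_nonneg) (auto simp: ln_div)
      then show ?thesis by (simp add: algebra_simps)
    qed
    finally show ?thesis
      using a by (simp add: \<delta>_def mult.commute)
  qed
  then show ?thesis
    unfolding quasihyperbolic_boundary_condition_def using x0_in_G by blast
qed

end


subsection \<open>Neighbourhoods in the plane\<close>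

definition nbhd_measure :: "(real ^ 2) set \<Rightarrow> real \<Rightarrow> ennreal" where
  "nbhd_measure E h = emeasure lebesgue (\<Union>x\<in>E. ball x h)"

lemma sets_lebesgue_UN_ball: "(\<Union>x\<in>E. ball x h) \<in> sets lebesgue"
  by (intro sets_completionI_sets) (auto intro: borel_open open_UN)

lemma nbhd_measure_mono: "A \<subseteq> B \<Longrightarrow> nbhd_measure A h \<le> nbhd_measure B h"
  unfolding nbhd_measure_def by (intro emeasure_mono sets_lebesgue_UN_ball) auto

lemma nbhd_measure_Un: "nbhd_measure (A \<union> B) h \<le> nbhd_measure A h + nbhd_measure B h"
  unfolding nbhd_measure_def UN_Un
  by (intro emeasure_subadditive sets_lebesgue_UN_ball)

lemma nbhd_measure_UN:
  "finite I \<Longrightarrow> nbhd_measure (\<Union>i\<in>I. A i) h \<le> (\<Sum>i\<in>I. nbhd_measure (A i) h)"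
proof (induction rule: finite_induct)
  case empty
  then show ?case by (simp add: nbhd_measure_def)
next
  case (insert i I)
  have "nbhd_measure (A i \<union> (\<Union>i\<in>I. A i)) h \<le> nbhd_measure (A i) h + nbhd_measure (\<Union>i\<in>I. A i) h"
    by (rule nbhd_measure_Un)
  also have "\<dots> \<le> nbhd_measure (A i) h + (\<Sum>i\<in>I. nbhd_measure (A i) h)"
    using insert.IH by (rule add_left_mono)
  finally show ?case using insert.hyps by simp
qed

lemma nbhd_measure_UN_bounded:
  fixes c :: real
  assumes "finite I" "0 \<le> c" "\<And>i. i \<in> I \<Longrightarrow> nbhd_measure (A i) h \<le> ennreal c"
  shows "nbhd_measure (\<Union>i\<in>I. A i) h \<le> ennreal (card I * c)"
proof -
  have "nbhd_measure (\<Union>i\<in>I. A i) h \<le> (\<Sum>i\<in>I. nbhd_measure (A i) h)"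
    by (rule nbhd_measure_UN[OF assms(1)])
  also have "\<dots> \<le> (\<Sum>i\<in>I. ennreal c)"
    by (rule sum_mono) (rule assms(3))
  also have "\<dots> = ennreal (card I * c)"
    using assms(2) by (simp add: ennreal_mult ennreal_of_nat_eq_real_of_nat)
  finally show ?thesis .
qed

lemma emeasure_cbox_pt:
  assumes "a \<le> c" "b \<le> d"
  shows "emeasure lebesgue (cbox (pt a b) (pt c d)) = ennreal ((c - a) * (d - b))"
proof -
  have ne: "cbox (pt a b) (pt c d) \<noteq> {}"
    using assms by (simp add: interval_ne_empty_cart forall_2)
  have "measure lebesgue (cbox (pt a b) (pt c d)) = (c - a) * (d - b)"
    using content_cbox_cart[OF ne] by (simp add: UNIV_2 measure_completion)
  moreover have "emeasure lebesgue (cbox (pt a b) (pt c d)) = ennreal (measure lebesgue (cbox (pt a b) (pt c d)))"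
    using lmeasurable_cbox[of "pt a b" "pt c d"] by (intro emeasure_eq_ennreal_measure) (auto simp: fmeasurable_def less_top)
  ultimately show ?thesis by simp
qed

lemma nbhd_measure_cbox_le:
  assumes "E \<subseteq> cbox (pt a b) (pt c d)" "a \<le> c" "b \<le> d" "0 < h"
  shows "nbhd_measure E h \<le> ennreal ((c - a + 2 * h) * (d - b + 2 * h))"
proof -
  have "(\<Union>x\<in>E. ball x h) \<subseteq> cbox (pt (a - h) (b - h)) (pt (c + h) (d + h))"
  proof
    fix y assume "y \<in> (\<Union>x\<in>E. ball x h)"
    then obtain x where x: "x \<in> E" and y: "y \<in> ball x h" by auto
    have "a \<le> x $ 1" "x $ 1 \<le> c" "b \<le> x $ 2" "x $ 2 \<le> d"
      using x assms(1) by (auto simp: mem_box_cart forall_2)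
    then have "a - h \<le> y $ 1" "y $ 1 \<le> c + h" "b - h \<le> y $ 2" "y $ 2 \<le> d + h"
      using ball_component[OF y, of 1] ball_component[OF y, of 2] by linarith+
    then show "y \<in> cbox (pt (a - h) (b - h)) (pt (c + h) (d + h))"
      by (auto simp: mem_box_cart forall_2)
  qed
  then have "nbhd_measure E h \<le> emeasure lebesgue (cbox (pt (a - h) (b - h)) (pt (c + h) (d + h)))"
    unfolding nbhd_measure_def by (intro emeasure_mono) auto
  also have "\<dots> = ennreal ((c + h - (a - h)) * (d + h - (b - h)))"
    using assms by (intro emeasure_cbox_pt) auto
  also have "(c + h - (a - h)) * (d + h - (b - h)) = (c - a + 2 * h) * (d - b + 2 * h)"
    by (simp add: algebra_simps)
  finally show ?thesis .
qed

text \<open>Each side is a degenerate box, so \<open>nbhd_measure_cbox_le\<close> applies to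
  it.\<close>

definition rim :: "real \<Rightarrow> real \<Rightarrow> real \<Rightarrow> real \<Rightarrow> (real ^ 2) set" where
  "rim a b c d = cbox (pt a b) (pt a d) \<union> cbox (pt c b) (pt c d) \<union>
     cbox (pt a b) (pt c b) \<union> cbox (pt a d) (pt c d)"

lemma cbox_minus_rim:
  assumes "x \<in> cbox (pt a b) (pt c d)" "x \<notin> rim a b c d"
  shows "a < x $ 1" "x $ 1 < c" "b < x $ 2" "x $ 2 < d"
  using assms by (auto simp: rim_def mem_box_cart forall_2 less_le)

text \<open>A side has one zero extent and one of at most \<open>1\<close>, so its neighbourhood has
  area at most \<open>2 * h * (1 + 2 * h) \<le> 6 * h\<close>.\<close>

lemma nbhd_measure_rim_le:
  assumes "a \<le> c" "b \<le> d" "c - a \<le> 1" "d - b \<le> 1" "0 < h" "h \<le> 1"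
  shows "nbhd_measure (rim a b c d) h \<le> ennreal (24 * h)"
proof -
  have bound: "nbhd_measure (cbox (pt s t) (pt s' t')) h \<le> ennreal (6 * h)"
    if "s \<le> s'" "t \<le> t'" "s' - s \<le> 1" "t' - t \<le> 1" "s' = s \<or> t' = t" for s t s' t'
  proof -
    have "(s' - s + 2 * h) * (t' - t + 2 * h) \<le> 6 * h"
    proof (cases "s' = s")
      case True
      have "2 * h * (t' - t + 2 * h) \<le> 2 * h * 3"
        using that assms by (intro mult_left_mono) auto
      then show ?thesis using True by simp
    next
      case False
      have "(s' - s + 2 * h) * (2 * h) \<le> 3 * (2 * h)"
        using that assms by (intro mult_right_mono) auto
      then show ?thesis using False that by simp
    qed
    then show ?thesis
      using nbhd_measure_cbox_le[OF order_refl that(1,2) assms(5)]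
      by (meson ennreal_leI order_trans)
  qed
  have "nbhd_measure (rim a b c d) h \<le> ennreal (6 * h) + ennreal (6 * h) + ennreal (6 * h) + ennreal (6 * h)"
    unfolding rim_def using assms
    by (intro order_trans[OF nbhd_measure_Un] add_mono bound) auto
  also have "\<dots> = ennreal (24 * h)"
    using assms by (simp flip: ennreal_plus)
  finally show ?thesis .
qed


subsection \<open>Dimension of the boundary\<close>

context rooms
begin

lemma frontier_G_eq: "frontier G = closure G - G"
  using open_G by (simp add: frontier_def interior_open)

text \<open>The index \<open>J\<close> separates the rooms that are treated one by one from those
  covered by one small box around their point of accumulation, \<open>pt (1 / 2) 1\<close>. Finitely
  many closed boxes then cover the closure of \<open>G\<close>. A frontier point cannot be interior
  to the box of a room or shaft, and if it is interior to the square, it lies in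
  \<open>K\<close>.\<close>

lemma frontier_G_subset:
  "frontier G \<subseteq> K \<union> rim 0 0 1 1 \<union>
    (\<Union>j\<in>{..<J}. rim (xc j - w j / 2) (1 - r j) (xc j + w j / 2) (1 + w j + r j) \<union>
       rim (xc j - r j / 2) (1 + w j) (xc j + r j / 2) (1 + w j + r j)) \<union>
    cbox (pt (1 / 2 - 5 * r J) (1 - 3 * r J)) (pt (1 / 2 + 5 * r J) (1 + 3 * r J))"
    (is "_ \<subseteq> _ \<union> _ \<union> (\<Union>j\<in>_. ?rS j \<union> ?rR j) \<union> ?T")
proof
  let ?cS = "\<lambda>j. cbox (pt (xc j - w j / 2) (1 - r j)) (pt (xc j + w j / 2) (1 + w j + r j))"
  let ?cR = "\<lambda>j. cbox (pt (xc j - r j / 2) (1 + w j)) (pt (xc j + r j / 2) (1 + w j + r j))"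
  have "G \<subseteq> cbox (pt 0 0) (pt 1 1) \<union> (\<Union>j\<in>{..<J}. ?cS j \<union> ?cR j) \<union> ?T"
  proof
    fix x assume "x \<in> G"
    then consider "x \<in> Q" | j where "x \<in> S j \<union> R j" "j < J" | j where "x \<in> S j \<union> R j" "J \<le> j"
      unfolding G_def by (auto simp: not_less[symmetric])
    then show "x \<in> cbox (pt 0 0) (pt 1 1) \<union> (\<Union>j\<in>{..<J}. ?cS j \<union> ?cR j) \<union> ?T"
    proof cases
      case 1
      then show ?thesis by (auto simp: Q_def mem_box_cart forall_2 less_imp_le)
    next
      case (2 j)
      have "x \<in> ?cS j" if "x \<in> S j"
        using that unfolding S_def mem_Collect_eq mem_box_cart forall_2 vector_2 by linarith
      moreover have "x \<in> ?cR j" if "x \<in> R j"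
        using that unfolding R_def mem_Collect_eq mem_box_cart forall_2 vector_2 by linarith
      ultimately have "x \<in> ?cS j \<union> ?cR j"
        using 2(1) by blast
      then show ?thesis using 2(2) by blast
    next
      case (3 j)
      have "r j \<le> r J"
        using r_decreasing[of J j] r(1)[of J] 3(2) by (cases "j = J") auto
      then have "1 / 2 - 5 * r J \<le> x $ 1" "x $ 1 \<le> 1 / 2 + 5 * r J"
          "1 - 3 * r J \<le> x $ 2" "x $ 2 \<le> 1 + 3 * r J"
        using in_column[OF 3(1)] r(1)[of j] unfolding xc_def by linarith+
      then show ?thesis by (auto simp: mem_box_cart forall_2)
    qed
  qed
  then have cl: "closure G \<subseteq> cbox (pt 0 0) (pt 1 1) \<union> (\<Union>j\<in>{..<J}. ?cS j \<union> ?cR j) \<union> ?T"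
    by (rule closure_minimal) (intro closed_Un closed_UN ballI closed_cbox finite_lessThan)
  fix x assume "x \<in> frontier G"
  then have x: "x \<in> closure G" "x \<notin> G"
    by (auto simp: frontier_G_eq)
  from x(1) cl consider "x \<in> cbox (pt 0 0) (pt 1 1)" | j where "j < J" "x \<in> ?cS j"
    | j where "j < J" "x \<in> ?cR j" | "x \<in> ?T"
    by blast
  then show "x \<in> K \<union> rim 0 0 1 1 \<union> (\<Union>j\<in>{..<J}. ?rS j \<union> ?rR j) \<union> ?T"
  proof cases
    case 1
    have "x \<in> K" if "x \<notin> rim 0 0 1 1"
    proof -
      have "x \<in> Q"
        using cbox_minus_rim[OF 1 that] by (auto simp: Q_def forall_2)
      then show ?thesis using x(2) by (auto simp: G_def)
    qed
    then show ?thesis by blast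
  next
    case (2 j)
    have "x \<in> ?rS j"
    proof (rule ccontr)
      assume "x \<notin> ?rS j"
      from cbox_minus_rim[OF 2(2) this] have "x \<in> S j"
        unfolding S_def mem_Collect_eq by linarith
      then show False using x(2) by (auto simp: G_def)
    qed
    then show ?thesis using 2(1) by blast
  next
    case (3 j)
    have "x \<in> ?rR j"
    proof (rule ccontr)
      assume "x \<notin> ?rR j"
      from cbox_minus_rim[OF 3(2) this] have "x \<in> R j"
        unfolding R_def mem_Collect_eq by linarith
      then show False using x(2) by (auto simp: G_def)
    qed
    then show ?thesis using 3(1) by blast
  qed auto
qed

text \<open>Each of the \<open>4 ^ n\<close> cells of stage \<open>n\<close> has its neighbourhood
  in a square of side \<open>3 * \<rho> ^ n\<close>.\<close>

lemma nbhd_measure_K_le: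
  assumes "0 < h" "h \<le> \<rho> ^ n"
  shows "nbhd_measure K h \<le> ennreal (9 * (4 * \<rho>\<^sup>2) ^ n)"
proof -
  let ?c = "\<lambda>(a, b). cbox (pt a b) (pt (a + \<rho> ^ n) (b + \<rho> ^ n))"
  let ?A = "cantor_left \<rho> n \<times> cantor_left \<rho> n"
  have "K \<subseteq> (\<Union>p\<in>?A. ?c p)"
  proof
    fix x assume "x \<in> K"
    then have "x $ 1 \<in> cantor_level \<rho> n" "x $ 2 \<in> cantor_level \<rho> n"
      by (auto simp: K_def cantor_set_level)
    then obtain a b where "a \<in> cantor_left \<rho> n" "b \<in> cantor_left \<rho> n"
      "x $ 1 \<in> {a..a + \<rho> ^ n}" "x $ 2 \<in> {b..b + \<rho> ^ n}"
      unfolding cantor_level_def by blast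
    then show "x \<in> (\<Union>p\<in>?A. ?c p)"
      by (intro UN_I[of "(a, b)"]) (auto simp: mem_box_cart forall_2)
  qed
  then have "nbhd_measure K h \<le> nbhd_measure (\<Union>p\<in>?A. ?c p) h"
    by (rule nbhd_measure_mono)
  also have "\<dots> \<le> ennreal (card ?A * (3 * \<rho> ^ n)\<^sup>2)"
  proof (rule nbhd_measure_UN_bounded)
    fix p assume "p \<in> ?A"
    obtain a b where p: "p = (a, b)" by force
    have "nbhd_measure (?c p) h \<le> ennreal ((a + \<rho> ^ n - a + 2 * h) * (b + \<rho> ^ n - b + 2 * h))"
      unfolding p prod.case using ratio_pos(2)[of n] assms
      by (intro nbhd_measure_cbox_le) (auto simp: less_imp_le)
    also have "\<dots> \<le> ennreal ((3 * \<rho> ^ n)\<^sup>2)"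
      unfolding power2_eq_square using ratio_pos(2)[of n] assms
      by (intro ennreal_leI mult_mono) auto
    finally show "nbhd_measure (?c p) h \<le> ennreal ((3 * \<rho> ^ n)\<^sup>2)" .
  qed (auto simp: finite_cantor_left)
  also have "real (card ?A) * (3 * \<rho> ^ n)\<^sup>2 = 9 * (4 * \<rho>\<^sup>2) ^ n"
  proof -
    have "real (card ?A) = 4 ^ n"
      by (simp add: card_cartesian_product card_cantor_left flip: power_mult_distrib)
    then show ?thesis
      by (simp add: power_mult_distrib power_mult[symmetric] mult.commute)
  qed
  finally show ?thesis .
qed

text \<open>Rooms smaller than \<open>h\<close> are not resolved: \<open>r J \<le> h\<close> makes
  the covering box contribute at most \<open>96 * h\<close>. With \<open>24 * h\<close> for the
  outer square this gives \<open>120\<close>; each of the first \<open>J\<close> rooms has two rims,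
  hence \<open>48\<close>.\<close>

lemma nbhd_measure_frontier_le:
  assumes h: "0 < h" "h \<le> 1" "h \<le> \<rho> ^ n" and J: "r J \<le> h"
  shows "nbhd_measure (frontier G) h \<le> ennreal (9 * (4 * \<rho>\<^sup>2) ^ n + (120 + 48 * real J) * h)"
proof -
  let ?rS = "\<lambda>j. rim (xc j - w j / 2) (1 - r j) (xc j + w j / 2) (1 + w j + r j)"
  let ?rR = "\<lambda>j. rim (xc j - r j / 2) (1 + w j) (xc j + r j / 2) (1 + w j + r j)"
  let ?T = "cbox (pt (1 / 2 - 5 * r J) (1 - 3 * r J)) (pt (1 / 2 + 5 * r J) (1 + 3 * r J))"
  have rooms_le: "nbhd_measure (\<Union>j\<in>{..<J}. ?rS j \<union> ?rR j) h \<le> ennreal (card {..<J} * (48 * h))"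
  proof (rule nbhd_measure_UN_bounded)
    fix j
    have wr: "0 < w j" "w j \<le> r j" "r j \<le> 1 / 32"
      using w[of j] r[of j] by linarith+
    have "nbhd_measure (?rS j) h \<le> ennreal (24 * h)" "nbhd_measure (?rR j) h \<le> ennreal (24 * h)"
      by (rule nbhd_measure_rim_le; use wr h in linarith)+
    then have "nbhd_measure (?rS j \<union> ?rR j) h \<le> ennreal (24 * h) + ennreal (24 * h)"
      by (intro order_trans[OF nbhd_measure_Un] add_mono)
    then show "nbhd_measure (?rS j \<union> ?rR j) h \<le> ennreal (48 * h)"
      using h by (simp flip: ennreal_plus)
  qed (use h in auto)
  have T_le: "nbhd_measure ?T h \<le> ennreal (96 * h)"
  proof -
    have "nbhd_measure ?T h \<le> ennreal ((1 / 2 + 5 * r J - (1 / 2 - 5 * r J) + 2 * h) *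
        (1 + 3 * r J - (1 - 3 * r J) + 2 * h))"
      using r(1)[of J] h by (intro nbhd_measure_cbox_le) auto
    also have "\<dots> \<le> ennreal (12 * h * 8)"
      using r(1)[of J] h J by (intro ennreal_leI mult_mono) auto
    finally show ?thesis by simp
  qed
  have "nbhd_measure (frontier G) h \<le> ennreal (9 * (4 * \<rho>\<^sup>2) ^ n) + ennreal (24 * h) +
      ennreal (card {..<J} * (48 * h)) + ennreal (96 * h)"
    using h by (intro order_trans[OF nbhd_measure_mono[OF frontier_G_subset[of J]]]
        order_trans[OF nbhd_measure_Un] add_mono nbhd_measure_K_le nbhd_measure_rim_le rooms_le T_le) auto
  also have "\<dots> = ennreal (9 * (4 * \<rho>\<^sup>2) ^ n + (120 + 48 * real J) * h)"
    using h by (simp flip: ennreal_plus) (simp add: algebra_simps)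
  finally show ?thesis .
qed

text \<open>A left endpoint stays one at all later stages, so the point is also the corner of
  arbitrarily small cells, whose centres lie in \<open>G\<close>.\<close>

lemma corner_in_frontier:
  assumes "a \<in> cantor_left \<rho> n" "b \<in> cantor_left \<rho> n"
  shows "pt a b \<in> frontier G"
proof -
  have "pt a b \<in> K"
    using assms cantor_left_in_set by (auto simp: K_def forall_2)
  moreover have "pt a b \<in> closure G"
    unfolding closure_approachable
  proof (intro allI impI)
    fix e :: real assume "0 < e"
    then obtain m where m: "\<rho> ^ m < e"
      using real_arch_pow_inv[of e \<rho>] ratio by auto
    define k where "k = max m n"
    have k: "\<rho> ^ k < e"
    proof -
      have "\<rho> ^ k \<le> \<rho> ^ m"
        using ratio by (intro power_decreasing) (auto simp: k_def)
      then show ?thesis using m by linarith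
    qed
    have ab: "a \<in> cantor_left \<rho> k" "b \<in> cantor_left \<rho> k"
      using assms cantor_left_mono[of n k] by (auto simp: k_def)
    let ?c = "pt (a + \<rho> ^ k / 2) (b + \<rho> ^ k / 2)"
    have "ball ?c (gap k / 2) \<subseteq> G"
    proof (rule ball_subset_square[OF ab(1), of _ 1])
      fix i :: 2
      have "gap k / 2 \<le> \<rho> ^ k / 2"
        using gap_pos(2)[of k] by simp
      then show "?c $ i \<in> {gap k / 2..1 - gap k / 2}"
        using exhaust_2[of i] cantor_left_bounds[OF ab(1)] cantor_left_bounds[OF ab(2)] by auto
    qed auto
    then have "?c \<in> G"
      using gap_pos(1)[of k] centre_in_ball[of ?c "gap k / 2"] by auto
    moreover have "dist ?c (pt a b) < e"
      using dist_le_l1[of ?c "pt a b"] k ratio_pos(2)[of k] by simp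
    ultimately show "\<exists>y\<in>G. dist y (pt a b) < e" by blast
  qed
  ultimately show ?thesis
    using K_disjoint_G by (auto simp: frontier_G_eq)
qed

text \<open>Boxes of half-width \<open>h / 3\<close> around the \<open>4 ^ n\<close> corners are
  disjoint, since two corners are at least \<open>2 * h\<close> apart in some coordinate, and they
  lie in the balls of radius \<open>h\<close>, since their points are within
  \<open>2 * h / 3\<close> of the corner. Each has area
  \<open>\<rho> ^ n * \<rho> ^ n / 9\<close>.\<close>

lemma nbhd_measure_frontier_ge:
  assumes h: "h = \<rho> ^ n / 2"
  shows "ennreal ((4 * \<rho>\<^sup>2) ^ n / 9) \<le> nbhd_measure (frontier G) h"
proof -
  let ?A = "cantor_left \<rho> n \<times> cantor_left \<rho> n"
  define c where "c = (\<lambda>(a, b). cbox (pt (a - h / 3) (b - h / 3)) (pt (a + h / 3) (b + h / 3)))"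
  have h0: "0 < h"
    using ratio_pos(2)[of n] by (simp add: h)
  have disj: "disjoint_family_on c ?A"
    unfolding disjoint_family_on_def
  proof (intro ballI impI)
    fix p q assume pq: "p \<in> ?A" "q \<in> ?A" "p \<noteq> q"
    obtain a b a' b' where eq: "p = (a, b)" "q = (a', b')" by fastforce
    show "c p \<inter> c q = {}"
    proof (rule ccontr)
      assume "c p \<inter> c q \<noteq> {}"
      then obtain x where "x \<in> c p" "x \<in> c q" by blast
      then have "a - h / 3 \<le> x $ 1" "x $ 1 \<le> a + h / 3" "a' - h / 3 \<le> x $ 1" "x $ 1 \<le> a' + h / 3"
        "b - h / 3 \<le> x $ 2" "x $ 2 \<le> b + h / 3" "b' - h / 3 \<le> x $ 2" "x $ 2 \<le> b' + h / 3"
        by (auto simp: eq c_def mem_box_cart forall_2)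
      then have "\<bar>a - a'\<bar> \<le> 2 * h / 3" "\<bar>b - b'\<bar> \<le> 2 * h / 3"
        by linarith+
      then have "\<not> \<rho> ^ n \<le> \<bar>a - a'\<bar>" "\<not> \<rho> ^ n \<le> \<bar>b - b'\<bar>"
        using h0 unfolding h by linarith+
      then show False
        using cantor_left_separated[of a n a'] cantor_left_separated[of b n b'] pq by (auto simp: eq)
    qed
  qed
  have "ennreal ((4 * \<rho>\<^sup>2) ^ n / 9) = (\<Sum>p\<in>?A. ennreal (\<rho> ^ n * \<rho> ^ n / 9))"
  proof -
    have "real (card ?A) = 4 ^ n"
      by (simp add: card_cartesian_product card_cantor_left flip: power_mult_distrib)
    then have "(\<Sum>p\<in>?A. \<rho> ^ n * \<rho> ^ n / 9) = (4 * \<rho>\<^sup>2) ^ n / 9"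
      by (simp add: power_mult_distrib power2_eq_square)
    then show ?thesis
      using ratio_pos(2)[of n] by (subst sum_ennreal) auto
  qed
  also have "\<dots> = (\<Sum>p\<in>?A. emeasure lebesgue (c p))"
  proof (rule sum.cong[OF refl])
    fix p :: "real \<times> real"
    obtain a b where p: "p = (a, b)" by force
    show "ennreal (\<rho> ^ n * \<rho> ^ n / 9) = emeasure lebesgue (c p)"
      unfolding p c_def prod.case using h0 by (subst emeasure_cbox_pt) (auto simp: h)
  qed
  also have "\<dots> = emeasure lebesgue (\<Union>p\<in>?A. c p)"
    using disj finite_cantor_left by (intro sum_emeasure) (auto simp: c_def)
  also have "\<dots> \<le> nbhd_measure (frontier G) h"
    unfolding nbhd_measure_def
  proof (rule emeasure_mono)
    show "(\<Union>p\<in>?A. c p) \<subseteq> (\<Union>x\<in>frontier G. ball x h)"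
    proof
      fix y assume "y \<in> (\<Union>p\<in>?A. c p)"
      then obtain a b where ab: "a \<in> cantor_left \<rho> n" "b \<in> cantor_left \<rho> n"
        "y \<in> c (a, b)" by blast
      then have "a - h / 3 \<le> y $ 1" "y $ 1 \<le> a + h / 3" "b - h / 3 \<le> y $ 2" "y $ 2 \<le> b + h / 3"
        by (auto simp: c_def mem_box_cart forall_2)
      then have "\<bar>a - y $ 1\<bar> \<le> h / 3" "\<bar>b - y $ 2\<bar> \<le> h / 3"
        by linarith+
      then have "y \<in> ball (pt a b) h"
        using dist_le_l1[of "pt a b" y] h0 unfolding mem_ball vector_2 by linarith
      then show "y \<in> (\<Union>x\<in>frontier G. ball x h)"
        using corner_in_frontier[OF ab(1,2)] by blast
    qed
  qed (rule sets_lebesgue_UN_ball)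
  finally show ?thesis .
qed

section \<open>Asymptotics of the Minkowski content\<close>

lemma minkowski_content_frontier:
  "minkowski_content l (frontier G) h = nbhd_measure (frontier G) h / ennreal (h powr (2 - l))"
  by (simp add: minkowski_content_def nbhd_measure_def)

lemma power_bracket:
  assumes "0 < h" "h \<le> 1"
  obtains n where "\<rho> ^ Suc n < h" "h \<le> \<rho> ^ n"
proof -
  define N where "N = (LEAST n. \<rho> ^ n < h)"
  have "\<exists>n. \<rho> ^ n < h"
    using real_arch_pow_inv[of h \<rho>] assms ratio by auto
  then have N: "\<rho> ^ N < h"
    unfolding N_def by (rule LeastI_ex)
  then have "N \<noteq> 0"
    using assms by (cases N) auto
  then obtain n where n: "N = Suc n"
    using not0_implies_Suc by blast
  have "\<not> \<rho> ^ n < h"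
    using not_less_Least[of n "\<lambda>n. \<rho> ^ n < h"] n by (simp add: N_def)
  then show thesis
    using that N n by (simp add: not_less)
qed

text \<open>Because \<open>4 * \<rho>\<^sup>2 = \<rho> powr (2 - lam)\<close>, the dust contributes
  order \<open>h powr (2 - lam)\<close>. The rooms contribute order
  \<open>h * log 2 (1 / h)\<close>, at most a multiple of \<open>h powr (2 - l)\<close> for every
  \<open>l > 1\<close>; as \<open>lam \<ge> 1\<close>, this covers all \<open>l > lam\<close>. For
  \<open>l < lam\<close> the scales \<open>\<rho> ^ n / 2\<close> give content at least
  \<open>(4 * \<rho> powr l) ^ n / 9\<close>, which is unbounded. The supremum is the same whatever
  happens at \<open>l = lam\<close>.\<close>

lemma upper_minkowski_dim_frontier:
  assumes lam: "1 \<le> lam" "lam < 2" and eq: "\<rho> powr lam = 1 / 4"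
  shows "upper_minkowski_dim (frontier G) = ennreal lam"
proof -
  have pw: "4 * \<rho>\<^sup>2 = \<rho> powr (2 - lam)"
    using ratio_pos(1) by (simp add: powr_diff eq)
  have upper: "Limsup (at_right 0) (minkowski_content l (frontier G)) \<noteq> \<infinity>" if l: "lam < l" for l
  proof -
    \<comment> \<open>Here \<open>36\<close> is \<open>9 * 4\<close> from the dust,
      \<open>168\<close> is \<open>120 + 48\<close> with the \<open>48\<close> from rounding
      \<open>J\<close> up, and \<open>96\<close> is \<open>48 * 2\<close>, as
      \<open>log 2 (1 / h)\<close> is at most \<open>2 * ln (1 / h)\<close>. The quotient by
      \<open>l - 1\<close> comes from \<open>ln_powr_bound\<close>.\<close>
    define C where "C = 36 + 168 + 96 / (l - 1)"
    have "minkowski_content l (frontier G) h \<le> ennreal C" if h: "0 < h" "h < 1" for h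
    proof -
      obtain n where n: "\<rho> ^ Suc n < h" "h \<le> \<rho> ^ n"
        using power_bracket[of h] h by auto
      define J where "J = nat \<lceil>log 2 (1 / h)\<rceil>"
      have lg: "0 \<le> log 2 (1 / h)"
        using h by simp
      then have J: "log 2 (1 / h) \<le> J" "J \<le> log 2 (1 / h) + 1"
        unfolding J_def by linarith+
      have rJ: "r J \<le> h"
      proof -
        have "1 / h \<le> 2 powr J"
          using J(1) h by (simp add: log_le_iff)
        then have "(1 / 2) ^ J \<le> h"
          using h by (simp add: powr_realpow field_simps)
        moreover have "r J \<le> 1 * (1 / 2) ^ J"
          unfolding r_def using \<sigma> by (intro mult_right_mono) auto
        ultimately show ?thesis by linarith
      qed
      define X where "X = 9 * (4 * \<rho>\<^sup>2) ^ n + (120 + 48 * real J) * h"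
      have X0: "0 \<le> X"
        unfolding X_def using h by (intro add_nonneg_nonneg mult_nonneg_nonneg) auto
      have nb: "nbhd_measure (frontier G) h \<le> ennreal X"
        unfolding X_def using h n rJ by (intro nbhd_measure_frontier_le) auto
      have hp: "0 < h powr (2 - l)"
        using h by simp
      have first: "9 * (4 * \<rho>\<^sup>2) ^ n \<le> 36 * h powr (2 - l)"
      proof -
        have "(4 * \<rho>\<^sup>2) ^ n = (\<rho> ^ n) powr (2 - lam)"
          unfolding pw using ratio_pos(1) by (simp add: powr_realpow[symmetric] powr_powr mult.commute)
        also have "\<dots> \<le> (4 * h) powr (2 - lam)"
        proof (rule powr_mono2)
          have "1 / 4 * \<rho> ^ n \<le> \<rho> * \<rho> ^ n"
            using ratio ratio_pos(2)[of n] by (intro mult_right_mono) auto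
          then show "\<rho> ^ n \<le> 4 * h" using n(1) by simp
        qed (use lam ratio_pos in auto)
        also have "\<dots> = 4 powr (2 - lam) * h powr (2 - lam)"
          using h by (simp add: powr_mult)
        also have "\<dots> \<le> 4 powr 1 * h powr (2 - l)"
          using lam l h by (intro mult_mono powr_mono powr_mono') auto
        finally show ?thesis by simp
      qed
      have second: "(120 + 48 * real J) * h \<le> (168 + 96 / (l - 1)) * h powr (2 - l)"
      proof -
        have "ln (1 / h) \<le> ((1 / h) powr (l - 1)) / (l - 1)"
          using lam l h by (intro ln_powr_bound) auto
        moreover have "log 2 (1 / h) \<le> 2 * ln (1 / h)"
        proof -
          have "ln (1 / h) * 1 \<le> ln (1 / h) * (2 * ln 2)"
            using ln2_ge_two_thirds h by (intro mult_left_mono) auto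
          then show ?thesis
            by (simp add: log_def pos_divide_le_eq mult_ac)
        qed
        moreover have "1 \<le> (1 / h) powr (l - 1)"
          using h lam l by (intro ge_one_powr_ge_zero) auto
        ultimately have "120 + 48 * real J \<le> 168 * (1 / h) powr (l - 1) + 96 * ((1 / h) powr (l - 1) / (l - 1))"
          using J(2) by linarith
        also have "\<dots> = (168 + 96 / (l - 1)) * (1 / h) powr (l - 1)"
          by (simp add: algebra_simps)
        finally have "(120 + 48 * real J) * h \<le> (168 + 96 / (l - 1)) * (1 / h) powr (l - 1) * h"
          using h by (intro mult_right_mono) auto
        also have "\<dots> = (168 + 96 / (l - 1)) * h powr (2 - l)"
        proof -
          have "(1 / h) powr (l - 1) * h = h powr (2 - l)"
          proof -
            have "(1 / h) powr (l - 1) = h powr (1 - l)"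
              using h by (simp add: powr_divide powr_minus_divide[symmetric])
            moreover have "h powr (1 - l) * h = h powr (1 - l + 1)"
              using h by (subst powr_add) simp
            ultimately show ?thesis by simp
          qed
          then show ?thesis by (simp only: mult.assoc)
        qed
        finally show ?thesis .
      qed
      have "X \<le> C * h powr (2 - l)"
        using first second unfolding X_def C_def by (simp add: algebra_simps)
      then have XC: "X / h powr (2 - l) \<le> C"
        using hp by (simp add: pos_divide_le_eq)
      have "minkowski_content l (frontier G) h \<le> ennreal X / ennreal (h powr (2 - l))"
        unfolding minkowski_content_frontier by (intro divide_right_mono_ennreal nb)
      also have "\<dots> = ennreal (X / h powr (2 - l))"
        using X0 hp by (intro divide_ennreal)
      also have "\<dots> \<le> ennreal C"
        using XC by (rule ennreal_leI)
      finally show ?thesis .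
    qed
    then have "\<forall>\<^sub>F h in at_right 0. minkowski_content l (frontier G) h \<le> ennreal C"
      unfolding eventually_at_right_field by (intro exI[of _ 1]) auto
    then have "Limsup (at_right 0) (minkowski_content l (frontier G)) \<le> ennreal C"
      by (rule Limsup_bounded)
    then show ?thesis
      by (auto simp: top_unique)
  qed
  have lower: "Limsup (at_right 0) (minkowski_content l (frontier G)) = \<infinity>" if l: "l < lam" for l
  proof (rule ccontr)
    assume "Limsup (at_right 0) (minkowski_content l (frontier G)) \<noteq> \<infinity>"
    then obtain m where m: "Limsup (at_right 0) (minkowski_content l (frontier G)) = ennreal m" "0 \<le> m"
      by (cases "Limsup (at_right 0) (minkowski_content l (frontier G))") auto
    define M where "M = m + 1"
    have M: "Limsup (at_right 0) (minkowski_content l (frontier G)) < ennreal M" "0 \<le> M"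
      unfolding m(1) M_def using m(2) by (auto simp: ennreal_less_iff)
    have "\<forall>\<^sub>F h in at_right 0. minkowski_content l (frontier G) h < ennreal M"
      using M(1) by (rule Limsup_lessD)
    then obtain e where e: "0 < e" "\<And>h. 0 < h \<Longrightarrow> h < e \<Longrightarrow> minkowski_content l (frontier G) h < ennreal M"
      unfolding eventually_at_right_field by auto
    have "1 / 4 < \<rho> powr l"
      unfolding eq[symmetric] using l ratio by (intro powr_less_mono') auto
    then have big: "1 < 4 * \<rho> powr l" by simp
    obtain n1 where n1: "9 * M < (4 * \<rho> powr l) ^ n1"
      using real_arch_pow[OF big] by blast
    obtain n2 where n2: "\<rho> ^ n2 < e"
      using real_arch_pow_inv[of e \<rho>] e ratio by auto
    define n where "n = max n1 n2"
    define h where "h = \<rho> ^ n / 2"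
    have "\<rho> ^ n \<le> \<rho> ^ n2"
      using ratio by (intro power_decreasing) (auto simp: n_def)
    then have h: "0 < h" "h < e"
      using n2 ratio_pos(2)[of n] by (auto simp: h_def)
    have hp: "0 < h powr (2 - l)"
      using h by simp
    have "(4 * \<rho> powr l) ^ n1 \<le> (4 * \<rho> powr l) ^ n"
      using big by (intro power_increasing) (auto simp: n_def)
    then have "M \<le> (4 * \<rho> powr l) ^ n / 9"
      using n1 by simp
    also have "\<dots> = (4 * \<rho>\<^sup>2) ^ n / 9 / (\<rho> ^ n) powr (2 - l)"
    proof -
      have "(\<rho> ^ n) powr (2 - l) = (\<rho> powr (2 - l)) ^ n"
        using ratio_pos(1) by (simp add: powr_realpow[symmetric] powr_powr mult.commute)
      moreover have "4 * \<rho>\<^sup>2 / \<rho> powr (2 - l) = 4 * \<rho> powr l"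
        using ratio_pos(1) by (simp add: powr_diff)
      then have "(4 * \<rho>\<^sup>2) ^ n / (\<rho> powr (2 - l)) ^ n = (4 * \<rho> powr l) ^ n"
        by (simp only: power_divide[symmetric])
      ultimately show ?thesis
        by (metis divide_divide_eq_left mult.commute)
    qed
    also have "\<dots> \<le> (4 * \<rho>\<^sup>2) ^ n / 9 / h powr (2 - l)"
    proof (rule divide_left_mono)
      show "h powr (2 - l) \<le> (\<rho> ^ n) powr (2 - l)"
        using h l lam by (intro powr_mono2) (auto simp: h_def)
    qed (use hp ratio_pos in auto)
    finally have "ennreal M \<le> ennreal ((4 * \<rho>\<^sup>2) ^ n / 9 / h powr (2 - l))"
      by (rule ennreal_leI)
    also have "\<dots> = ennreal ((4 * \<rho>\<^sup>2) ^ n / 9) / ennreal (h powr (2 - l))"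
      using hp by (intro divide_ennreal[symmetric]) auto
    also have "\<dots> \<le> minkowski_content l (frontier G) h"
      unfolding minkowski_content_frontier
      by (intro divide_right_mono_ennreal nbhd_measure_frontier_ge) (simp add: h_def)
    finally show False
      using e(2)[OF h] by simp
  qed
  show ?thesis
    unfolding upper_minkowski_dim_def
  proof (rule antisym)
    show "Sup (ennreal ` {l. 0 \<le> l \<and> Limsup (at_right 0) (minkowski_content l (frontier G)) = \<infinity>})
        \<le> ennreal lam"
      using upper by (intro Sup_least) (force intro!: ennreal_leI simp: not_less[symmetric])
    show "ennreal lam \<le>
        Sup (ennreal ` {l. 0 \<le> l \<and> Limsup (at_right 0) (minkowski_content l (frontier G)) = \<infinity>})"
    proof (rule dense_le)
      fix y assume "y < ennreal lam"
      then obtain l where "y = ennreal l" "0 \<le> l" "l < lam"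
        by (cases y) (auto simp: ennreal_less_iff)
      then show "y \<le> Sup (ennreal ` {l. 0 \<le> l \<and> Limsup (at_right 0) (minkowski_content l (frontier G)) = \<infinity>})"
        using lower by (intro Sup_upper) auto
    qed
  qed
qed

end


subsection \<open>Failure of the Poincare inequality\<close>

lemma bounded_borel_integrable_lebesgue_on:
  fixes f :: "'a::euclidean_space \<Rightarrow> 'b::euclidean_space"
  assumes "f \<in> borel_measurable borel" "\<And>x. norm (f x) \<le> M" "K \<in> lmeasurable"
  shows "integrable (lebesgue_on K) f"
  using bounded_borel_absolutely_integrable_on[OF assms] assms(3)
  by (simp add: set_integrable_def integrable_restrict_space fmeasurableD)

lemma integral_indicator_lebesgue_on:
  assumes "A \<subseteq> G" "A \<in> sets lebesgue" "G \<in> sets lebesgue"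
  shows "(LINT x|lebesgue_on G. c * indicat_real A x) = c * measure lebesgue A"
proof -
  have "A \<in> sets (lebesgue_on G)"
    using assms by (auto simp: sets_restrict_space_iff)
  then have "(LINT x|lebesgue_on G. indicat_real A x) = measure (lebesgue_on G) A"
    using assms by (simp add: space_restrict_space Int_absorb2)
  also have "\<dots> = measure lebesgue A"
    using assms by (intro measure_restrict_space) auto
  finally show ?thesis by simp
qed

lemma clamp_lipschitz: "\<bar>max 0 (min 1 s) - max 0 (min 1 t)\<bar> \<le> \<bar>s - t\<bar>" for s t :: real
  by (auto simp: max_def min_def abs_if)

lemma measure_box_pt:
  assumes "a \<le> c" "b \<le> d"
  shows "measure lebesgue (box (pt a b) (pt c d)) = (c - a) * (d - b)"
proof -
  have "measure lebesgue (box (pt a b) (pt c d)) = measure lborel (box (pt a b) (pt c d))"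
    by (rule measure_completion) simp
  also have "\<dots> = measure lborel (cbox (pt a b) (pt c d))"
    by (simp only: measure_lborel_box_eq measure_lborel_cbox_eq)
  also have "\<dots> = measure lebesgue (cbox (pt a b) (pt c d))"
    by (rule measure_completion[symmetric]) simp
  also have "\<dots> = (c - a) * (d - b)"
    unfolding measure_def emeasure_cbox_pt[OF assms] using assms by simp
  finally show ?thesis .
qed

context rooms
begin

text \<open>On the domain, \<open>u j\<close> is \<open>1\<close> in the room \<open>R j\<close>, linear in its neck, and \<open>0\<close> elsewhere; the second factor
  only makes it Lipschitz on the whole plane.\<close>

definition u :: "nat \<Rightarrow> real ^ 2 \<Rightarrow> real" where
  "u j x = max 0 (min 1 ((x $ 2 - 1) / w j)) * max 0 (min 1 (2 - 2 * \<bar>x $ 1 - xc j\<bar> / r j))"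

definition neck :: "nat \<Rightarrow> (real ^ 2) set" where
  "neck j = box (pt (xc j - w j / 2) 1) (pt (xc j + w j / 2) (1 + w j))"

definition v :: "nat \<Rightarrow> real ^ 2 \<Rightarrow> real ^ 2" where
  "v j x = (if x \<in> neck j then (1 / w j) *\<^sub>R axis 2 1 else 0)"

lemma mem_neck: "x \<in> neck j \<longleftrightarrow> \<bar>x $ 1 - xc j\<bar> < w j / 2 \<and> 1 < x $ 2 \<and> x $ 2 < 1 + w j"
  unfolding neck_def mem_box_cart forall_2 vector_2 by linarith

lemma R_eq_box: "R j = box (pt (xc j - r j / 2) (1 + w j)) (pt (xc j + r j / 2) (1 + w j + r j))"
  by (rule set_eqI) (unfold R_def mem_Collect_eq mem_box_cart forall_2 vector_2, linarith)

lemma lmeasurable_G: "G \<in> lmeasurable"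
  using bounded_G open_G by (rule lmeasurable_open)

lemma u_bounds: "0 \<le> u j x" "u j x \<le> 1"
  unfolding u_def by (auto intro!: mult_nonneg_nonneg mult_le_one)

lemma u_lipschitz: "(1 / w j + 2 / r j)-lipschitz_on UNIV (u j)"
proof (rule lipschitz_onI)
  fix x y :: "real ^ 2"
  let ?f = "\<lambda>x :: real ^ 2. max 0 (min 1 ((x $ 2 - 1) / w j))"
  let ?g = "\<lambda>x :: real ^ 2. max 0 (min 1 (2 - 2 * \<bar>x $ 1 - xc j\<bar> / r j))"
  have comp: "\<bar>x $ k - y $ k\<bar> \<le> dist x y" for k
    using dist_vec_nth_le[of x k y] by (simp add: dist_real_def)
  have f: "\<bar>?f x - ?f y\<bar> \<le> 1 / w j * dist x y"
  proof -
    have "\<bar>?f x - ?f y\<bar> \<le> \<bar>(x $ 2 - 1) / w j - (y $ 2 - 1) / w j\<bar>"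
      by (rule clamp_lipschitz)
    also have "\<dots> = \<bar>x $ 2 - y $ 2\<bar> / w j"
      using w(1)[of j] by (simp add: diff_divide_distrib[symmetric])
    also have "\<dots> \<le> dist x y / w j"
      using comp w(1)[of j] by (intro divide_right_mono) auto
    finally show ?thesis by simp
  qed
  have g: "\<bar>?g x - ?g y\<bar> \<le> 2 / r j * dist x y"
  proof -
    have "\<bar>?g x - ?g y\<bar> \<le> \<bar>(2 - 2 * \<bar>x $ 1 - xc j\<bar> / r j) - (2 - 2 * \<bar>y $ 1 - xc j\<bar> / r j)\<bar>"
      by (rule clamp_lipschitz)
    also have "\<dots> = \<bar>2 / r j * (\<bar>y $ 1 - xc j\<bar> - \<bar>x $ 1 - xc j\<bar>)\<bar>"
      by (simp add: right_diff_distrib)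
    also have "\<dots> = 2 / r j * \<bar>\<bar>y $ 1 - xc j\<bar> - \<bar>x $ 1 - xc j\<bar>\<bar>"
      unfolding abs_mult using r(1)[of j] by simp
    also have "\<dots> \<le> 2 / r j * dist x y"
    proof (rule mult_left_mono)
      show "\<bar>\<bar>y $ 1 - xc j\<bar> - \<bar>x $ 1 - xc j\<bar>\<bar> \<le> dist x y"
        using comp[of 1] by linarith
    qed (use r(1)[of j] in simp)
    finally show ?thesis .
  qed
  have "u j x - u j y = (?f x - ?f y) * ?g x + ?f y * (?g x - ?g y)"
    unfolding u_def by (simp add: algebra_simps)
  also have "\<bar>\<dots>\<bar> \<le> \<bar>?f x - ?f y\<bar> * 1 + 1 * \<bar>?g x - ?g y\<bar>"
    by (intro order_trans[OF abs_triangle_ineq] add_mono; unfold abs_mult, intro mult_mono) auto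
  also have "\<dots> \<le> (1 / w j + 2 / r j) * dist x y"
    using f g by (simp add: distrib_right)
  finally show "dist (u j x) (u j y) \<le> (1 / w j + 2 / r j) * dist x y"
    by (simp add: dist_real_def)
qed (use w(1)[of j] r(1)[of j] in auto)

lemma u_eq_0: "x $ 2 \<le> 1 \<or> r j \<le> \<bar>x $ 1 - xc j\<bar> \<Longrightarrow> u j x = 0"
proof (elim disjE)
  assume "x $ 2 \<le> 1"
  then have "(x $ 2 - 1) / w j \<le> 0"
    using w(1)[of j] by (simp add: divide_le_0_iff)
  then show "u j x = 0" by (simp add: u_def)
next
  assume "r j \<le> \<bar>x $ 1 - xc j\<bar>"
  then have "2 \<le> 2 * \<bar>x $ 1 - xc j\<bar> / r j"
    using r(1)[of j] by (simp add: le_divide_eq)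
  then show "u j x = 0" by (simp add: u_def)
qed

lemma u_eq_clamp: "\<bar>x $ 1 - xc j\<bar> \<le> r j / 2 \<Longrightarrow> u j x = max 0 (min 1 ((x $ 2 - 1) / w j))"
proof -
  assume "\<bar>x $ 1 - xc j\<bar> \<le> r j / 2"
  then have "1 \<le> 2 - 2 * \<bar>x $ 1 - xc j\<bar> / r j"
    using r(1)[of j] by (simp add: divide_le_eq)
  then show ?thesis by (simp add: u_def min_def)
qed

text \<open>Only the heights of the two ends of the neck have to be excluded. The kinks of the
  cutoff in the first coordinate lie at distance \<open>r j / 2\<close> or \<open>r j\<close> from
  the axis of the room; above height \<open>1\<close> no point of \<open>G\<close> is there, and
  below it the first factor of \<open>u j\<close> is \<open>0\<close>. So \<open>u j\<close> is
  locally constant or linear.\<close>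

lemma u_has_derivative:
  assumes x: "x \<in> G" "x $ 2 \<noteq> 1" "x $ 2 \<noteq> 1 + w j"
  shows "(u j has_derivative (\<lambda>h. v j x \<bullet> h)) (at x)"
proof -
  have const: "(u j has_derivative (\<lambda>h. v j x \<bullet> h)) (at x)"
    if "open T" "x \<in> T" "\<And>y. y \<in> T \<Longrightarrow> u j y = c" "x \<notin> neck j" for T c
  proof -
    have "((\<lambda>_. c) has_derivative (\<lambda>h. v j x \<bullet> h)) (at x)"
      using that(4) by (simp add: v_def)
    then show ?thesis
      by (rule has_derivative_transform_within_open[OF _ that(1,2)]) (simp add: that(3))
  qed
  show ?thesis
  proof (cases "x $ 2 < 1")
    case True
    have "open {y :: real ^ 2. y $ 2 < 1}"
      by (intro open_Collect_less continuous_intros)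
    then show ?thesis
      by (rule const[of _ 0]) (use True in \<open>auto simp: u_eq_0 mem_neck\<close>)
  next
    case False
    then have x2: "1 < x $ 2" using x(2) by simp
    obtain i where i: "x \<in> S i \<union> R i"
      using above_G[OF x(1)] x2 by auto
    show ?thesis
    proof (cases "i = j")
      case False
      have "r j < \<bar>x $ 1 - xc j\<bar>"
        using columns_disjoint[OF False] in_column(1)[OF i] by blast
      moreover have "open {y :: real ^ 2. r j < \<bar>y $ 1 - xc j\<bar>}"
        by (intro open_Collect_less continuous_intros)
      ultimately show ?thesis
        using w[of j] r(1)[of j] by (intro const[of "{y. r j < \<bar>y $ 1 - xc j\<bar>}" 0]) (auto simp: u_eq_0 mem_neck)
    next
      case True
      then have x1: "\<bar>x $ 1 - xc j\<bar> < r j / 2"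
        using in_column(1)[OF i] by simp
      have o1: "open {y :: real ^ 2. \<bar>y $ 1 - xc j\<bar> < r j / 2}"
        by (intro open_Collect_less continuous_intros)
      show ?thesis
      proof (cases "x $ 2 < 1 + w j")
        case True
        then have n: "x \<in> neck j"
          using i \<open>i = j\<close> x2 by (auto simp: mem_neck S_def R_def)
        have "((\<lambda>y. (y $ 2 - 1) / w j) has_derivative (\<lambda>h. h $ 2 / w j)) (at x)"
          using w(1)[of j] by (auto intro!: derivative_eq_intros bounded_linear_imp_has_derivative bounded_linear_vec_nth)
        moreover have "(\<lambda>h. h $ 2 / w j) = (\<lambda>h. v j x \<bullet> h)"
          using n by (simp add: v_def inner_axis' fun_eq_iff)
        ultimately have "((\<lambda>y. (y $ 2 - 1) / w j) has_derivative (\<lambda>h. v j x \<bullet> h)) (at x)"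
          by simp
        then show ?thesis
        proof (rule has_derivative_transform_within_open)
          show "open (neck j)" "x \<in> neck j"
            using n by (auto simp: neck_def)
          fix y assume y: "y \<in> neck j"
          then have "\<bar>y $ 1 - xc j\<bar> \<le> r j / 2"
            using w[of j] r(1)[of j] unfolding mem_neck by linarith
          then show "(y $ 2 - 1) / w j = u j y"
            using y w(1)[of j] by (simp add: u_eq_clamp mem_neck)
        qed
      next
        case False
        then have x3: "1 + w j < x $ 2" using x(3) by simp
        have "open ({y :: real ^ 2. \<bar>y $ 1 - xc j\<bar> < r j / 2} \<inter> {y. 1 + w j < y $ 2})"
          by (intro open_Int o1 open_Collect_less continuous_intros)
        then show ?thesis
          by (rule const[of _ 1])
            (use x1 x3 w(1)[of j] in \<open>auto simp: u_eq_clamp mem_neck min_def le_divide_eq\<close>)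
      qed
    qed
  qed
qed

lemma neck_subset_G: "neck j \<subseteq> G"
proof
  fix x assume "x \<in> neck j"
  then have "x \<in> S j"
    using r(1)[of j] unfolding mem_neck S_def mem_Collect_eq by linarith
  then show "x \<in> G" by (auto simp: G_def)
qed

lemma borel_u: "u j \<in> borel_measurable borel"
  by (rule borel_measurable_continuous_onI[OF lipschitz_on_continuous_on[OF u_lipschitz]])

lemma borel_v: "v j \<in> borel_measurable borel"
  unfolding v_def[abs_def] neck_def by (intro measurable_If_set borel_measurable_const) auto

lemma norm_v: "norm (v j x) = 1 / w j * indicat_real (neck j) x"
  using w(1)[of j] by (simp add: v_def)

lemma weak_gradient_u: "weak_gradient G (u j) (v j)"
proof (rule weak_gradient_lipschitz[OF open_G u_lipschitz])
  \<comment> \<open>One constant has to bound both \<open>u j\<close> and its gradient.\<close>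
  have w1: "1 \<le> 1 / w j"
    using w[of j] r(1,3)[of j] by simp
  show "\<bar>u j x\<bar> \<le> 1 / w j" for x
    using u_bounds[of j x] w1 by linarith
  show "norm (v j x) \<le> 1 / w j" for x
    using w(1)[of j] by (simp add: norm_v indicator_def)
  show "negligible ({x. axis 2 1 \<bullet> x = 1} \<union> {x :: real ^ 2. axis 2 1 \<bullet> x = 1 + w j})"
    using w(1)[of j] by (intro negligible_Un negligible_hyperplane) auto
  show "(u j has_derivative (\<lambda>h. v j x \<bullet> h)) (at x)"
    if "x \<in> G - ({x. axis 2 1 \<bullet> x = 1} \<union> {x. axis 2 1 \<bullet> x = 1 + w j})" for x
    using that by (intro u_has_derivative) (auto simp: inner_axis')
qed (rule borel_v)

lemma u_in_W1p:
  assumes "0 < p"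
  shows "u j \<in> W1p p G"
proof -
  have meas: "f \<in> borel_measurable (lebesgue_on G)" if "f \<in> borel_measurable borel"
    for f :: "real ^ 2 \<Rightarrow> 'b::euclidean_space"
    using that by (intro measurable_restrict_space1 measurable_completion) simp
  have "integrable (lebesgue_on G) (\<lambda>x. norm (u j x) powr p)"
  proof (rule bounded_borel_integrable_lebesgue_on[OF _ _ lmeasurable_G])
    show "(\<lambda>x. norm (u j x) powr p) \<in> borel_measurable borel"
      using borel_u by measurable
    show "norm (norm (u j x) powr p) \<le> 1" for x
      using u_bounds[of j x] assms by (simp add: powr_le1)
  qed
  moreover have "integrable (lebesgue_on G) (\<lambda>x. norm (v j x) powr p)"
  proof (rule bounded_borel_integrable_lebesgue_on[OF _ _ lmeasurable_G])
    show "(\<lambda>x. norm (v j x) powr p) \<in> borel_measurable borel"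
      using borel_v by measurable
    show "norm (norm (v j x) powr p) \<le> (1 / w j) powr p" for x
      using w(1)[of j] by (simp add: norm_v indicator_def)
  qed
  ultimately have "u j \<in> Lp p G" "v j \<in> Lp p G"
    using meas[OF borel_u] meas[OF borel_v] by (auto simp: Lp_def)
  then show ?thesis
    using weak_gradient_u by (auto simp: W1p_def)
qed

lemma energy_v:
  assumes "0 < p"
  shows "(LINT x|lebesgue_on G. norm (v j x) powr p) powr (1 / p) = r j powr (\<alpha> * ((2 - p) / p))"
proof -
  have "(LINT x|lebesgue_on G. norm (v j x) powr p) =
      (LINT x|lebesgue_on G. (1 / w j) powr p * indicat_real (neck j) x)"
    by (intro Bochner_Integration.integral_cong) (auto simp: norm_v indicator_def)
  also have "\<dots> = (1 / w j) powr p * measure lebesgue (neck j)"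
    using lmeasurable_G by (intro integral_indicator_lebesgue_on neck_subset_G) (auto simp: neck_def)
  also have "measure lebesgue (neck j) = w j * w j"
    unfolding neck_def using w(1)[of j] by (subst measure_box_pt) auto
  also have "(1 / w j) powr p * (w j * w j) = w j powr (2 - p)"
  proof -
    have "w j powr (2 - p) = w j powr 2 * w j powr (- p)"
      by (simp flip: powr_add)
    then show ?thesis
      using w(1)[of j] by (simp add: powr_divide powr_minus_divide power2_eq_square)
  qed
  finally have "(LINT x|lebesgue_on G. norm (v j x) powr p) = w j powr (2 - p)" .
  then show ?thesis
    by (simp add: w_def powr_powr)
qed

lemma measure_G_pos: "0 < measure lebesgue G"
proof -
  have "0 < r 0 * r 0"
    using r(1)[of 0] by simp
  also have "\<dots> = measure lebesgue (R 0)"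
    unfolding R_eq_box using r(1)[of 0] by (subst measure_box_pt) auto
  also have "\<dots> \<le> measure lebesgue G"
    using lmeasurable_G by (intro measure_mono_fmeasurable) (auto simp: G_def R_eq_box)
  finally show ?thesis .
qed

text \<open>On \<open>G\<close>, the function lives in a strip of width \<open>2 * r j\<close> and
  height at most \<open>2\<close>. So its average tends to \<open>0\<close> with \<open>j\<close>,
  and it differs from its average by at least \<open>1 / 2\<close> on the room once \<open>j\<close>
  is large.\<close>

lemma average_u: "0 \<le> average G (u j)" "average G (u j) \<le> 4 * r j / measure lebesgue G"
proof -
  show "0 \<le> average G (u j)"
    unfolding average_def using u_bounds(1) by (intro divide_nonneg_nonneg Bochner_Integration.integral_nonneg) auto
  let ?B = "cbox (pt (xc j - r j) 0) (pt (xc j + r j) 2)"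
  have mB: "measure lebesgue ?B = 4 * r j"
    unfolding measure_def using r(1)[of j] by (subst emeasure_cbox_pt) auto
  have GB: "G \<inter> ?B \<in> lmeasurable" "G \<inter> ?B \<in> sets lebesgue"
    using lmeasurable_G by (auto intro: fmeasurable.Int fmeasurableD)
  have "(LINT x|lebesgue_on G. u j x) \<le> (LINT x|lebesgue_on G. 1 * indicat_real (G \<inter> ?B) x)"
  proof (rule integral_mono')
    show "integrable (lebesgue_on G) (\<lambda>x. 1 * indicat_real (G \<inter> ?B) x)"
      using lmeasurable_G GB
      by (subst integrable_restrict_space) (auto simp: fmeasurableD indicator_inter_arith[symmetric]
          intro!: integrable_real_indicator dest: fmeasurableD2 simp: less_top)
    fix x assume "x \<in> space (lebesgue_on G)"
    then have x: "x \<in> G" by simp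
    show "u j x \<le> 1 * indicat_real (G \<inter> ?B) x"
    proof (cases "x \<in> ?B")
      case True
      then show ?thesis using x u_bounds(2)[of j x] by simp
    next
      case False
      have "r j \<le> \<bar>x $ 1 - xc j\<bar>"
        using False G_bounds[OF x] unfolding mem_box_cart forall_2 vector_2 by linarith
      then show ?thesis by (simp add: u_eq_0)
    qed
  qed auto
  also have "\<dots> = measure lebesgue (G \<inter> ?B)"
    using GB lmeasurable_G by (subst integral_indicator_lebesgue_on) auto
  also have "\<dots> \<le> measure lebesgue ?B"
    using GB by (intro measure_mono_fmeasurable) auto
  finally show "average G (u j) \<le> 4 * r j / measure lebesgue G"
    unfolding average_def mB using measure_G_pos by (intro divide_right_mono) auto
qed

text \<open>\<open>e\<close> is the excess of the exponent on the gradient side over that on the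
  room side. Dividing by \<open>r j powr (2 / q)\<close> would leave
  \<open>1 / 2 \<le> \<bar>c\<bar> * r j powr e\<close>, which fails as \<open>r j\<close> tends to
  \<open>0\<close>.\<close>

lemma not_poincare_inequality:
  assumes q: "1 \<le> q" and p: "0 < p" and pq: "2 / q < \<alpha> * ((2 - p) / p)"
  shows "\<not> poincare_inequality q p G"
proof
  assume "poincare_inequality q p G"
  then obtain c where c: "\<And>u v. u \<in> W1p p G \<Longrightarrow> weak_gradient G u v \<Longrightarrow>
      (\<lambda>x. u x - average G u) \<in> Lp q G \<and>
      (LINT x|lebesgue_on G. \<bar>u x - average G u\<bar> powr q) powr (1 / q)
       \<le> c * (LINT x|lebesgue_on G. norm (v x) powr p) powr (1 / p)"
    unfolding poincare_inequality_def by blast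
  define e where "e = \<alpha> * ((2 - p) / p) - 2 / q"
  have e: "0 < e"
    using pq by (simp add: e_def)
  have main: "1 / 2 \<le> \<bar>c\<bar> * r j powr e" if j: "4 * r j \<le> measure lebesgue G / 2" for j
  proof -
    let ?a = "average G (u j)"
    have a: "?a \<le> 1 / 2"
    proof -
      have "4 * r j / measure lebesgue G \<le> 1 / 2"
        using j measure_G_pos by (simp add: pos_divide_le_eq)
      then show ?thesis using average_u(2)[of j] by linarith
    qed
    \<comment> \<open>This comes from the \<open>Lp q G\<close> clause of the inequality. Without it
      the integral to be bounded below could be the default \<open>0\<close>.\<close>
    have int: "integrable (lebesgue_on G) (\<lambda>x. \<bar>u j x - ?a\<bar> powr q)"
      using c[OF u_in_W1p[OF p] weak_gradient_u] by (simp add: Lp_def)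
    have RG: "R j \<subseteq> G"
      by (auto simp: G_def)
    have "(1 / 2) powr q * (r j * r j) = (LINT x|lebesgue_on G. (1 / 2) powr q * indicat_real (R j) x)"
    proof -
      have "measure lebesgue (R j) = r j * r j"
        unfolding R_eq_box using r(1)[of j] by (subst measure_box_pt) auto
      then show ?thesis
        using RG lmeasurable_G by (subst integral_indicator_lebesgue_on) (auto simp: R_eq_box)
    qed
    also have "\<dots> \<le> (LINT x|lebesgue_on G. \<bar>u j x - ?a\<bar> powr q)"
    proof (rule integral_mono'[OF int])
      fix x
      show "(1 / 2) powr q * indicat_real (R j) x \<le> \<bar>u j x - ?a\<bar> powr q"
      proof (cases "x \<in> R j")
        case True
        then have "u j x = 1"
          using w(1)[of j] by (auto simp: u_eq_clamp R_def min_def le_divide_eq)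
        then have "1 / 2 \<le> \<bar>u j x - ?a\<bar>"
          using a by simp
        then have "(1 / 2) powr q \<le> \<bar>u j x - ?a\<bar> powr q"
          using q by (intro powr_mono2) auto
        then show ?thesis using True by simp
      qed simp
    qed simp
    finally have "((1 / 2) powr q * (r j * r j)) powr (1 / q) \<le>
        (LINT x|lebesgue_on G. \<bar>u j x - ?a\<bar> powr q) powr (1 / q)"
      using q by (intro powr_mono2) auto
    also have "\<dots> \<le> c * (LINT x|lebesgue_on G. norm (v j x) powr p) powr (1 / p)"
      using c[OF u_in_W1p[OF p] weak_gradient_u] by blast
    also have "\<dots> = c * r j powr (\<alpha> * ((2 - p) / p))"
      unfolding energy_v[OF p] ..
    \<comment> \<open>The constant in \<open>poincare_inequality\<close> carries no sign.\<close>
    also have "\<dots> \<le> \<bar>c\<bar> * r j powr (\<alpha> * ((2 - p) / p))"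
      by (intro mult_right_mono) auto
    also have "r j powr (\<alpha> * ((2 - p) / p)) = r j powr e * r j powr (2 / q)"
      by (simp add: e_def flip: powr_add)
    also have "((1 / 2) powr q * (r j * r j)) powr (1 / q) = 1 / 2 * r j powr (2 / q)"
    proof -
      have "r j * r j = r j powr 2"
        using r(1)[of j] by (simp add: power2_eq_square)
      moreover have "(r j powr 2) powr (1 / q) = r j powr (2 / q)"
        by (subst powr_powr) simp
      moreover have "((1 / 2) powr q) powr (1 / q) = 1 / (2 :: real)"
        using q by (subst powr_powr) simp
      ultimately show ?thesis
        by (simp only: powr_mult)
    qed
    finally have "1 / 2 * r j powr (2 / q) \<le> (\<bar>c\<bar> * r j powr e) * r j powr (2 / q)"
      by (simp only: mult.assoc)
    then show ?thesis
      using r(1)[of j] by (simp only: mult_le_cancel_right) auto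
  qed
  have r0: "r \<longlonglongrightarrow> 0"
    unfolding r_def[abs_def] by (intro tendsto_mult_right_zero LIMSEQ_power_zero) simp
  have "(\<lambda>j. 4 * r j) \<longlonglongrightarrow> 0"
    by (rule tendsto_mult_right_zero[OF r0])
  from order_tendstoD(2)[OF this, of "measure lebesgue G / 2"]
  have ev1: "\<forall>\<^sub>F j in sequentially. 4 * r j < measure lebesgue G / 2"
    using measure_G_pos by simp
  have "(\<lambda>j. r j powr e) \<longlonglongrightarrow> 0"
    using r(1) e by (intro tendsto_zero_powrI[OF r0 tendsto_const]) (auto simp: less_imp_le)
  then have "(\<lambda>j. \<bar>c\<bar> * r j powr e) \<longlonglongrightarrow> 0"
    by (rule tendsto_mult_right_zero)
  from order_tendstoD(2)[OF this, of "1 / 2"]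
  have ev2: "\<forall>\<^sub>F j in sequentially. \<bar>c\<bar> * r j powr e < 1 / 2"
    by simp
  from eventually_conj[OF ev1 ev2] obtain j where "4 * r j < measure lebesgue G / 2" "\<bar>c\<bar> * r j powr e < 1 / 2"
    unfolding eventually_sequentially by auto
  then show False
    using main[of j] by simp
qed

end

section \<open>Numerical inequalities and the choice of the constant\<close>

lemma two_powr_neg_le:
  fixes t :: real
  assumes "0 \<le> t" "t \<le> 1"
  shows "2 powr (- t) \<le> 1 - t / 2"
proof -
  \<comment> \<open>By convexity, the graph of \<open>exp\<close> lies below its chord between
    \<open>- ln 2\<close> and \<open>0\<close>.\<close>
  have "exp ((1 - t) *\<^sub>R 0 + t *\<^sub>R (- ln 2)) \<le> (1 - t) * exp 0 + t * exp (- ln 2)"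
    using assms by (intro convex_onD[OF exp_convex]) auto
  then show ?thesis
    by (simp add: powr_def exp_minus)
qed

text \<open>The claim amounts to \<open>p * (q + 2 * \<beta>) < 2 * q\<close>. Multiplying the given
  bound by \<open>1 + \<beta>\<close> removes \<open>b\<close>. If the claim failed, subtracting its
  negation would cancel the terms free of \<beta>; dividing by \<beta> and using
  \<open>lam < 2\<close> and \<open>q < p\<close> then gives \<open>p * q + 2 * q < 2 * p\<close>,
  contrary to \<open>q \<ge> 1\<close> and \<open>p < 2\<close>.\<close>

lemma exponent_condition:
  fixes lam \<beta> q p :: real
  defines "b \<equiv> 2 * \<beta> / (1 + \<beta>)"
  assumes lam: "1 \<le> lam" "lam < 2" and \<beta>: "0 < \<beta>" "\<beta> < 1" and q: "1 \<le> q" "q < p"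
    and le: "p \<le> q * (2 - lam * b) / (q + b * (2 - lam))"
  shows "2 / q < 1 / \<beta> * ((2 - p) / p)"
proof -
  have b: "0 < b" "b * (1 + \<beta>) = 2 * \<beta>"
    using \<beta> by (auto simp: b_def)
  have b2: "0 < b * (2 - lam)" "0 < lam * b"
    using b lam by auto
  have h: "p * (q + b * (2 - lam)) \<le> q * (2 - lam * b)"
    using le b2 q by (simp add: pos_le_divide_eq)
  have p2: "p < 2"
  proof (rule ccontr)
    assume "\<not> p < 2"
    then have "2 * (q + b * (2 - lam)) \<le> p * (q + b * (2 - lam))"
      using b2 q by (intro mult_right_mono) auto
    moreover have "0 < q * (lam * b)"
      using b2 q by auto
    ultimately show False
      using h b2 by (simp add: right_diff_distrib) 
  qed
  have "p * (q + b * (2 - lam)) * (1 + \<beta>) \<le> q * (2 - lam * b) * (1 + \<beta>)"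
    using h \<beta> by (intro mult_right_mono) auto
  moreover have "p * (q + b * (2 - lam)) * (1 + \<beta>) = p * (q * (1 + \<beta>) + (b * (1 + \<beta>)) * (2 - lam))"
    by (simp add: algebra_simps)
  moreover have "q * (2 - lam * b) * (1 + \<beta>) = q * (2 * (1 + \<beta>) - lam * (b * (1 + \<beta>)))"
    by (simp add: algebra_simps)
  ultimately have h2: "p * (q * (1 + \<beta>) + 2 * \<beta> * (2 - lam)) \<le> q * (2 * (1 + \<beta>) - lam * (2 * \<beta>))"
    unfolding b(2) by simp
  have "p * (q + 2 * \<beta>) < 2 * q"
  proof (rule ccontr)
    assume "\<not> p * (q + 2 * \<beta>) < 2 * q"
    then have "\<beta> * (p * (q + 2 - 2 * lam)) \<le> \<beta> * (2 * q * (1 - lam))"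
      using h2 by (simp add: algebra_simps)
    then have "p * (q + 2 - 2 * lam) \<le> 2 * q * (1 - lam)"
      using \<beta> by simp
    then have "p * (q + 2) - 2 * q \<le> 2 * lam * (p - q)"
      by (simp add: algebra_simps)
    also have "\<dots> < 4 * (p - q)"
      using lam q by (intro mult_strict_right_mono) auto
    finally have "p * q + 2 * q < 2 * p"
      by (simp add: algebra_simps)
    moreover have "p * 1 \<le> p * q"
      using q by (intro mult_left_mono) auto
    ultimately show False
      using p2 q by linarith
  qed
  then have "2 * \<beta> * p < q * (2 - p)"
    by (simp add: algebra_simps)
  then show ?thesis
    using q \<beta> by (simp add: field_simps)
qed

theorem theorem5p1:
  shows "\<exists>c2::real. c2 > 0 \<and>
    (\<forall>lam \<beta> :: real. 1 \<le> lam \<and> lam < 2 \<and> 0 < \<beta> \<and> \<beta> < 1 \<and> lam \<le> 2 - c2 * \<beta> \<longrightarrow>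
      (\<exists>G :: (real ^ 2) set.
         bounded_domain G \<and>
         quasihyperbolic_boundary_condition (\<beta> / 4) G \<and>
         upper_minkowski_dim (frontier G) = ennreal lam \<and>
         (\<forall>q p :: real. let b = 2 * \<beta> / (1 + \<beta>) in
            1 \<le> q \<and> q < p \<and> p \<le> q * (2 - lam * b) / (q + b * (2 - lam)) \<longrightarrow>
            \<not> poincare_inequality q p G)))"
proof (intro exI[of _ 20] conjI allI impI)
  fix lam \<beta> :: real
  assume "1 \<le> lam \<and> lam < 2 \<and> 0 < \<beta> \<and> \<beta> < 1 \<and> lam \<le> 2 - 20 * \<beta>"
  then have lam: "1 \<le> lam" "lam < 2" and \<beta>: "0 < \<beta>" "\<beta> < 1" "20 * \<beta> \<le> 2 - lam"
    by auto
  define \<rho> :: real where "\<rho> = 2 powr (- (2 / lam))"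
  interpret cantor_ratio \<rho>
  proof
    have "2 powr (- 2) \<le> \<rho>"
      unfolding \<rho>_def using lam by (intro powr_mono) (auto simp: divide_le_eq)
    then show "1 / 4 \<le> \<rho>"
      by (simp add: powr_minus_divide)
    have "\<rho> < 2 powr (- 1)"
      unfolding \<rho>_def using lam by (intro powr_less_mono) (auto simp: less_divide_eq)
    then show "\<rho> < 1 / 2"
      by (simp add: powr_minus_divide)
  qed
  have eq: "\<rho> powr lam = 1 / 4"
  proof -
    have "\<rho> powr lam = 2 powr (- (2 / lam) * lam)"
      unfolding \<rho>_def by (rule powr_powr)
    also have "- (2 / lam) * lam = - 2"
      using lam by simp
    finally show ?thesis
      by (simp add: powr_minus_divide)
  qed
  have s: "(2 - lam) / 4 \<le> \<sigma>"
  proof -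
    \<comment> \<open>\<open>t\<close> is chosen so that \<open>2 * \<rho> = 2 powr (- t)\<close>.
      The chord bound gives \<open>\<sigma> \<ge> t / 2\<close>, and
      \<open>t \<ge> (2 - lam) / 2\<close> because \<open>lam < 2\<close>.\<close>
    define t where "t = (2 - lam) / lam"
    have t: "0 \<le> t" "t \<le> 1"
      using lam by (auto simp: t_def divide_le_eq)
    have "2 * \<rho> = 2 powr (1 + - (2 / lam))"
      unfolding \<rho>_def powr_add by simp
    also have "1 + - (2 / lam) = - t"
      using lam by (simp add: t_def field_simps)
    also have "2 powr (- t) \<le> 1 - t / 2"
      using t by (rule two_powr_neg_le)
    finally have "t / 2 \<le> \<sigma>"
      by (simp add: \<sigma>_def)
    moreover have "(2 - lam) / 2 \<le> t"
      unfolding t_def using lam by (intro divide_left_mono) auto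
    ultimately show ?thesis by simp
  qed
  interpret rooms \<rho> "1 / \<beta>"
  proof
    have "5 * \<beta> \<le> (2 - lam) / 4"
      using \<beta>(3) by simp
    then have "5 * \<beta> \<le> \<sigma>"
      using s by (rule order_trans)
    moreover from this have "0 < \<sigma>"
      using \<beta>(1) by simp
    ultimately have "5 * \<beta> \<le> \<sigma>" "0 < \<sigma>" .
    then show "5 / \<sigma> \<le> 1 / \<beta>"
      using \<beta> by (simp add: field_simps)
  qed
  show "\<exists>G :: (real ^ 2) set. bounded_domain G \<and> quasihyperbolic_boundary_condition (\<beta> / 4) G \<and>
      upper_minkowski_dim (frontier G) = ennreal lam \<and>
      (\<forall>q p :: real. let b = 2 * \<beta> / (1 + \<beta>) in
         1 \<le> q \<and> q < p \<and> p \<le> q * (2 - lam * b) / (q + b * (2 - lam)) \<longrightarrow> \<not> poincare_inequality q p G)"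
  proof (intro exI[of _ G] conjI allI)
    show "bounded_domain G"
      by (rule bounded_domain_G)
    show "quasihyperbolic_boundary_condition (\<beta> / 4) G"
      using quasihyperbolic_boundary_condition_G by simp
    show "upper_minkowski_dim (frontier G) = ennreal lam"
      by (rule upper_minkowski_dim_frontier[OF lam eq])
    show "let b = 2 * \<beta> / (1 + \<beta>) in
        1 \<le> q \<and> q < p \<and> p \<le> q * (2 - lam * b) / (q + b * (2 - lam)) \<longrightarrow> \<not> poincare_inequality q p G" for q p
      unfolding Let_def
    proof (intro impI, elim conjE)
      assume pq: "1 \<le> q" "q < p"
        "p \<le> q * (2 - lam * (2 * \<beta> / (1 + \<beta>))) / (q + 2 * \<beta> / (1 + \<beta>) * (2 - lam))"
      show "\<not> poincare_inequality q p G"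
        using exponent_condition[OF lam \<beta>(1,2) pq] pq(1,2) by (intro not_poincare_inequality) auto
    qed
  qed
qed simp

end
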